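(* Let $n\ge2$ and $p\in\{1,\dots,\lfloor n/2\rfloor\}$. Then $$K^{C_n}_{\omega_{2p},0}(t)=K^{A_{n-1}}_{\gamma_p,0}(t^2).$$
   Context: For a simple complex Lie algebra with positive roots $R_+$, Weyl group $W$, length function $\ell$, half-sum $\rho$ of positive roots, let $\prod_{\alpha\in R_+}\frac1{1-te^\alpha}=\sum_\beta P_t(\beta)e^\beta$. For a dominant weight $\lambda$, the generalized exponent is $K_{\lambda,0}(t)=\sum_{w\in W}(-1)^{\ell(w)}P_t(w(\lambda+\rho)-\rho)$; the superscript indicates the type ($C_n$ for $\mathfrak{sp}_{2n}$, $A_{n-1}$ for $\mathfrak{sl}_n$). In type $C_n$ the nodes of the Dynkin diagram are labelled so that the special node (long simple root) is $n$, so $\omega_{2p}=\varepsilon_1+\cdots+\varepsilon_{2p}$. In type $A_{n-1}$, $\gamma_p=\varepsilon_1+\cdots+\varepsilon_p-\varepsilon_{n-p+1}-\cdots-\varepsilon_n$, where $\varepsilon_i$ are the coordinate vectors of $\mathbb R^n$; as a dominant weight of $\mathfrak{sl}_n$ it corresponds to the partition with $p$ parts equal to $2$ and $n-2p$ parts equal to $1$. *)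

theory Defs
  imports
    "HOL-Library.Function_Algebras"
    "HOL-Library.Poly_Mapping"
    "HOL-Computational_Algebra.Formal_Power_Series"
begin

text \<open>
  A vector of \<open>\<real>\<^sup>n\<close> is a function \<open>nat \<Rightarrow> real\<close> that vanishes outside \<open>{1..n}\<close>; addition is
  pointwise.  The dimension is a value, not a type, because the index set \<open>{1..n}\<close> has to be
  ordered and split.  A root system is given by its set \<open>R\<close> of positive roots, and each
  construction below depends only on \<open>n\<close> and \<open>R\<close>.
\<close>

type_synonym vec = "nat \<Rightarrow> real"

definition eps :: "nat \<Rightarrow> vec" where
  "eps i = (\<lambda>j. if j = i then 1 else 0)"

definition dot :: "nat \<Rightarrow> vec \<Rightarrow> vec \<Rightarrow> real" where
  "dot n x y = (\<Sum>i = 1..n. x i * y i)"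

definition reflection :: "nat \<Rightarrow> vec \<Rightarrow> vec \<Rightarrow> vec" where
  "reflection n \<alpha> x = (\<lambda>i. x i - 2 * dot n x \<alpha> / dot n \<alpha> \<alpha> * \<alpha> i)"

text \<open>
  Reflections in roots of \<open>\<real>\<^sup>n\<close> fix all coordinates outside \<open>{1..n}\<close>, so distinct Weyl group
  elements of \<open>\<real>\<^sup>n\<close> correspond to distinct functions here.
\<close>

inductive_set weyl_group :: "nat \<Rightarrow> vec set \<Rightarrow> (vec \<Rightarrow> vec) set"
  for n :: nat and R :: "vec set" where
  id: "id \<in> weyl_group n R"
| refl: "\<alpha> \<in> R \<Longrightarrow> w \<in> weyl_group n R \<Longrightarrow> reflection n \<alpha> \<circ> w \<in> weyl_group n R"

definition simple_roots :: "vec set \<Rightarrow> vec set" where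
  "simple_roots R = {\<alpha> \<in> R. \<not> (\<exists>\<beta>\<in>R. \<exists>\<gamma>\<in>R. \<alpha> = \<beta> + \<gamma>)}"

definition weyl_length :: "nat \<Rightarrow> vec set \<Rightarrow> (vec \<Rightarrow> vec) \<Rightarrow> nat" where
  "weyl_length n R w =
     (LEAST k. \<exists>as. length as = k \<and> set as \<subseteq> simple_roots R
                  \<and> w = foldr (\<lambda>\<alpha> f. reflection n \<alpha> \<circ> f) as id)"

definition rho :: "vec set \<Rightarrow> vec" where
  "rho R = (\<lambda>i. (\<Sum>\<alpha>\<in>R. \<alpha> i) / 2)"

text \<open>
  The generating product is taken in the power series ring in \<open>t\<close> over the group ring of the
  additive group of vectors; \<open>e\<^sup>\<beta>\<close> is the basis element \<open>Poly_Mapping.single \<beta> 1\<close>.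
  The group ring has no \<open>inverse\<close> operation, so \<open>1 / (1 - t e\<^sup>\<alpha>)\<close> is written as the geometric
  series; \<open>geom_series_inverse\<close> shows that it is the inverse of \<open>1 - t e\<^sup>\<alpha>\<close>.
\<close>

definition e_pow :: "vec \<Rightarrow> vec \<Rightarrow>\<^sub>0 int" where
  "e_pow \<beta> = Poly_Mapping.single \<beta> 1"

definition geom_series :: "vec \<Rightarrow> (vec \<Rightarrow>\<^sub>0 int) fps" where
  "geom_series \<alpha> = Abs_fps (\<lambda>k. e_pow \<alpha> ^ k)"

lemma geom_series_inverse: "(1 - fps_X * fps_const (e_pow \<alpha>)) * geom_series \<alpha> = 1"
proof (rule fps_ext)
  fix k
  show "fps_nth ((1 - fps_X * fps_const (e_pow \<alpha>)) * geom_series \<alpha>) k = fps_nth 1 k"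
    by (cases k) (simp_all add: geom_series_def left_diff_distrib mult.assoc)
qed

definition kostant_partition :: "vec set \<Rightarrow> vec \<Rightarrow> int fps" where
  "kostant_partition R \<beta> =
     Abs_fps (\<lambda>k. Poly_Mapping.lookup (fps_nth (\<Prod>\<alpha>\<in>R. geom_series \<alpha>) k) \<beta>)"

text \<open>
  The generalized exponent \<open>K\<^bsub>\<mu>,0\<^esub>(t)\<close>.  It is a polynomial in \<open>t\<close>, viewed here as an element
  of the ring of power series over the integers.
\<close>

definition gen_exponent :: "nat \<Rightarrow> vec set \<Rightarrow> vec \<Rightarrow> int fps" where
  "gen_exponent n R \<mu> =
     (\<Sum>w\<in>weyl_group n R.
        (-1) ^ weyl_length n R w * kostant_partition R (w (\<mu> + rho R) - rho R))"

text \<open>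
  Both root systems are realised in \<open>\<real>\<^sup>n\<close>: \<open>pos_roots_A n\<close> has type \<open>A\<^bsub>n-1\<^esub>\<close> (spanning the
  hyperplane of coordinate sum zero) and \<open>pos_roots_C n\<close> has type \<open>C\<^sub>n\<close>.
\<close>

definition pos_roots_A :: "nat \<Rightarrow> vec set" where
  "pos_roots_A n = {eps i - eps j | i j. 1 \<le> i \<and> i < j \<and> j \<le> n}"

definition pos_roots_C :: "nat \<Rightarrow> vec set" where
  "pos_roots_C n =
     {eps i - eps j | i j. 1 \<le> i \<and> i < j \<and> j \<le> n} \<union>
     {eps i + eps j | i j. 1 \<le> i \<and> i < j \<and> j \<le> n} \<union>
     {eps i + eps i | i. 1 \<le> i \<and> i \<le> n}"

definition omega :: "nat \<Rightarrow> vec" where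
  "omega k = (\<Sum>i = 1..k. eps i)"

definition gamma :: "nat \<Rightarrow> nat \<Rightarrow> vec" where
  "gamma n p = (\<Sum>i = 1..p. eps i) - (\<Sum>i = n - p + 1..n. eps i)"

end

theory Submission
  imports Defs "HOL-Computational_Algebra.Polynomial"
begin

text \<open>
  Write \<open>K(\<chi>)\<close> for the generalized exponent extended linearly to characters, and \<open>x\<^sub>i = e\<^bsup>\<epsilon>\<^sub>i\<^esup>\<close>.  By the
  Weyl denominator formula \<open>K(\<chi>)\<close> is the constant term of
  \<open>\<chi> \<Prod>\<^bsub>\<alpha>>0\<^esub> (1 - e\<^sup>\<alpha>) / (1 - t e\<^sup>\<alpha>)\<close>.  Instead of the irreducible characters take the generating
  characters \<open>\<chi> = \<Prod>\<^sub>i (1 + u / x\<^sub>i) (1 + v x\<^sub>i)\<close> of the exterior powers, with \<open>u = v\<close> in type \<open>C\<close>.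

  Extracting the constant term in the first variable leaves, besides \<open>(1 + u v)\<close> times the same
  expression in one variable less, a multiple of the constant term of
  \<open>\<Sum>\<^sub>j x\<^sub>j\<^sup>-\<^sup>1\<close> (type \<open>A\<close>) or \<open>\<Sum>\<^sub>j (x\<^sub>j + x\<^sub>j\<^sup>-\<^sup>1)\<close> (type \<open>C\<close>) times that expression.  For a simple root
  \<open>\<alpha>\<close>, antisymmetry turns a factor \<open>e\<^sup>\<beta>\<close> with \<open>s\<^sub>\<alpha> \<beta> = \<beta> + \<alpha>\<close> into \<open>t e\<^bsup>\<beta> + \<alpha>\<^esup>\<close>, so that all summands are
  powers of \<open>t\<close> times a single one, which can be peeled off again.  Both types therefore satisfy
  the recurrence \<open>h\<^sub>m = (1 + u v) h\<^bsub>m-1\<^esub> - (1 - q\<^bsup>m-1\<^esup>) u v h\<^bsub>m-2\<^esub>\<close> of the Rogers-Szego polynomials, with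
  \<open>q = t\<close> in type \<open>A\<close> and \<open>q = t\<^sup>2\<close> in type \<open>C\<close>.

  On the other hand straightening expands these series in \<open>K(\<gamma>\<^sub>a)\<close> and \<open>K(\<omega>\<^sub>a)\<close> with coefficients
  \<open>(u v)\<^sup>a (1 + u v + \<dots> + (u v)\<^bsup>n-2a\<^esup>)\<close> and \<open>u\<^sup>a (1 + u\<^sup>2 + \<dots> + u\<^bsup>2(n-a)\<^esup>)\<close>.  Specialising \<open>u v\<close> to \<open>u\<^sup>2\<close>
  in type \<open>A\<close> and comparing coefficients of \<open>u\<^bsup>2p\<^esup>\<close> gives the equality of the sums over \<open>a \<le> p\<close>, and
  hence the claim.
\<close>

section \<open>The group ring and constant terms\<close>

abbreviation lookup where "lookup \<equiv> Poly_Mapping.lookup"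
abbreviation keys where "keys \<equiv> Poly_Mapping.keys"

text \<open>Sums and integer multiples arise from differences, as in the induction for free abelian
  groups. Identities linear in \<open>F\<close> thus reduce to single exponentials.\<close>

lemma group_ring_induct [case_names zero e_pow diff]:
  assumes "P 0" "\<And>\<beta>. P (e_pow \<beta>)" "\<And>a b. P a \<Longrightarrow> P b \<Longrightarrow> P (a - b)"
  shows "P (F :: vec \<Rightarrow>\<^sub>0 int)"
  by (rule frag_induction[of F UNIV]) (use assms in \<open>auto simp: e_pow_def\<close>)

lemma e_pow_add: "e_pow (\<alpha> + \<beta>) = e_pow \<alpha> * e_pow \<beta>"
  by (simp add: e_pow_def mult_single)

lemma e_pow_0 [simp]: "e_pow 0 = 1"
  by (simp add: e_pow_def)

lemma lookup_e_pow: "lookup (e_pow \<alpha>) \<beta> = (if \<beta> = \<alpha> then 1 else 0)"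
  by (simp add: e_pow_def)

lemma keys_e_pow [simp]: "keys (e_pow \<alpha>) = {\<alpha>}"
  by (simp add: e_pow_def)

lemma lookup_e_pow_mult: "lookup (e_pow \<alpha> * (F :: vec \<Rightarrow>\<^sub>0 int)) \<beta> = lookup F (\<beta> - \<alpha>)"
proof (induction F rule: group_ring_induct)
  case (e_pow \<gamma>)
  show ?case by (auto simp: e_pow_add[symmetric] lookup_e_pow)
qed (simp_all add: right_diff_distrib lookup_minus)

lemma lookup_of_int_mult: "lookup (of_int c * (F :: vec \<Rightarrow>\<^sub>0 int)) \<beta> = c * lookup F \<beta>"
proof (induction F rule: group_ring_induct)
  case (e_pow \<gamma>)
  have "of_int c * e_pow \<gamma> = Poly_Mapping.single \<gamma> c"
    by (simp add: e_pow_def mult_single flip: single_of_int)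
  then show ?case by (simp add: lookup_e_pow lookup_single when_def)
qed (simp_all add: right_diff_distrib lookup_minus)

text \<open>The free abelian group on the weights extends any map linearly. The extension respects
  products when \<open>w\<close> is additive, which the lemmas on products assume.\<close>

definition act :: "(vec \<Rightarrow> vec) \<Rightarrow> (vec \<Rightarrow>\<^sub>0 int) \<Rightarrow> (vec \<Rightarrow>\<^sub>0 int)" where
  "act w = frag_extend (\<lambda>\<beta>. e_pow (w \<beta>))"

lemma act_0 [simp]: "act w 0 = 0"
  by (simp add: act_def)

lemma act_e_pow [simp]: "act w (e_pow \<beta>) = e_pow (w \<beta>)"
  unfolding act_def e_pow_def by (simp add: e_pow_def)

lemma act_add: "act w (F + G) = act w F + act w G"
  by (simp add: act_def frag_extend_add)

lemma act_diff: "act w (F - G) = act w F - act w G"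
  by (simp add: act_def frag_extend_diff)

lemma act_minus: "act w (- F) = - act w F"
  by (simp add: act_def frag_extend_minus)

lemma act_sum: "act w (sum F I) = (\<Sum>i\<in>I. act w (F i))"
  by (induction I rule: infinite_finite_induct) (simp_all add: act_add)

lemma act_id [simp]: "act id F = F"
  by (induction F rule: group_ring_induct) (simp_all add: act_diff)

lemma act_comp: "act (v \<circ> w) F = act v (act w F)"
  by (induction F rule: group_ring_induct) (simp_all add: act_diff)

lemma act_mult:
  assumes "Modules.additive w"
  shows "act w (F * G) = act w F * act w G"
proof (induction F rule: group_ring_induct)
  case (e_pow \<beta>)
  show ?case
    by (induction G rule: group_ring_induct)
       (simp_all add: act_diff right_diff_distrib additive.add[OF assms] flip: e_pow_add)
qed (simp_all add: act_diff left_diff_distrib)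

lemma act_1:
  assumes "Modules.additive w"
  shows "act w 1 = 1"
  using act_e_pow[of w 0] by (simp add: additive.zero[OF assms] del: act_e_pow)

lemma act_prod:
  assumes "Modules.additive w"
  shows "act w (prod F I) = (\<Prod>i\<in>I. act w (F i))"
  by (induction I rule: infinite_finite_induct) (simp_all add: act_mult act_1 assms)

lemma act_power:
  assumes "Modules.additive w"
  shows "act w (F ^ k) = act w F ^ k"
  by (induction k) (simp_all add: act_mult act_1 assms)

lemma act_of_int_mult: "act w (of_int c * F) = of_int c * act w F"
proof -
  \<comment> \<open>Scalar multiplication in the free abelian group is multiplication by an integer
    in the group ring.\<close>
  have "frag_cmul c F = of_int c * F" for F :: "vec \<Rightarrow>\<^sub>0 int"
    by (rule poly_mapping_eqI) (simp add: lookup_of_int_mult)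
  then show ?thesis by (metis act_def frag_extend_cmul)
qed

lemma lookup_act:
  assumes "inj w"
  shows "lookup (act w F) (w \<beta>) = lookup F \<beta>"
proof (induction F rule: group_ring_induct)
  case (e_pow \<gamma>)
  show ?case using assms by (auto simp: lookup_e_pow dest: injD)
qed (simp_all add: act_diff lookup_minus)

section \<open>Linear maps and constant terms for power series over the group ring\<close>

definition act_fps :: "(vec \<Rightarrow> vec) \<Rightarrow> (vec \<Rightarrow>\<^sub>0 int) fps \<Rightarrow> (vec \<Rightarrow>\<^sub>0 int) fps" where
  "act_fps w F = Abs_fps (\<lambda>k. act w (fps_nth F k))"

lemma act_fps_diff: "act_fps w (F - G) = act_fps w F - act_fps w G"
  by (rule fps_ext) (simp add: act_fps_def act_diff)

lemma act_fps_const: "act_fps w (fps_const c) = fps_const (act w c)"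
  by (rule fps_ext) (simp add: act_fps_def)

lemma act_fps_mult:
  assumes "Modules.additive w"
  shows "act_fps w (F * G) = act_fps w F * act_fps w G"
  by (rule fps_ext) (simp add: act_fps_def fps_mult_nth act_sum act_mult assms)

lemma act_fps_prod:
  assumes "Modules.additive w"
  shows "act_fps w (prod F I) = (\<Prod>i\<in>I. act_fps w (F i))"
proof -
  have "act_fps w 1 = 1"
    using act_fps_const[of w 1] by (simp add: act_1[OF assms])
  then show ?thesis
    by (induction I rule: infinite_finite_induct) (simp_all add: act_fps_mult assms)
qed

lemma act_fps_geom_series:
  assumes "Modules.additive w"
  shows "act_fps w (geom_series \<alpha>) = geom_series (w \<alpha>)"
  by (rule fps_ext) (simp add: act_fps_def geom_series_def act_power[OF assms])

text \<open>Constant in the weights only: the variable t, which is \<open>fps_X\<close>, is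
  kept.\<close>

definition ct :: "(vec \<Rightarrow>\<^sub>0 int) fps \<Rightarrow> int fps" where
  "ct F = Abs_fps (\<lambda>k. lookup (fps_nth F k) 0)"

lemma ct_0 [simp]: "ct 0 = 0"
  by (rule fps_ext) (simp add: ct_def)

lemma ct_1 [simp]: "ct 1 = 1"
  by (rule fps_ext) (simp add: ct_def lookup_one)

lemma ct_add: "ct (F + G) = ct F + ct G"
  by (rule fps_ext) (simp add: ct_def lookup_add)

lemma ct_minus: "ct (- F) = - ct F"
  by (rule fps_ext) (simp add: ct_def)

lemma ct_diff: "ct (F - G) = ct F - ct G"
  by (rule fps_ext) (simp add: ct_def lookup_minus)

lemma ct_sum: "ct (sum F I) = (\<Sum>i\<in>I. ct (F i))"
  by (induction I rule: infinite_finite_induct) (simp_all add: ct_add)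

lemma ct_X_mult: "ct (fps_X * F) = fps_X * ct F"
  by (rule fps_ext) (simp add: ct_def)

lemma ct_of_int_mult: "ct (of_int c * F) = of_int c * ct F"
  by (rule fps_ext) (simp add: ct_def lookup_of_int_mult flip: fps_of_int)

text \<open>An additive injection sends the weight 0 to itself and no other weight there.\<close>

lemma ct_act_fps:
  assumes "Modules.additive w" "inj w"
  shows "ct (act_fps w F) = ct F"
proof (rule fps_ext)
  fix k
  show "fps_nth (ct (act_fps w F)) k = fps_nth (ct F) k"
    using lookup_act[OF assms(2), of "fps_nth F k" 0]
    by (simp add: ct_def act_fps_def additive.zero[OF assms(1)])
qed

lemma fps_int_eq_neg_self_iff: "F = - F \<longleftrightarrow> F = (0 :: int fps)"
  by (auto simp: fps_eq_iff)

text \<open>The constant term is both preserved and negated, and integer power series have no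
  2-torsion.\<close>

lemma ct_skew:
  assumes "Modules.additive w" "inj w" "act_fps w F = - F"
  shows "ct F = 0"
  using ct_act_fps[OF assms(1,2), of F] fps_int_eq_neg_self_iff[of "ct F"]
  by (simp add: assms(3) ct_minus)

abbreviation ee :: "vec \<Rightarrow> (vec \<Rightarrow>\<^sub>0 int) fps" where
  "ee \<beta> \<equiv> fps_const (e_pow \<beta>)"

lemma ee_add: "ee (\<alpha> + \<beta>) = ee \<alpha> * ee \<beta>"
  by (simp add: e_pow_add)

lemma kostant_partition_eq_ct:
  "kostant_partition R \<beta> = ct (ee (- \<beta>) * (\<Prod>\<alpha>\<in>R. geom_series \<alpha>))"
  by (rule fps_ext) (simp add: kostant_partition_def ct_def lookup_e_pow_mult)

text \<open>A filtration by a linear functional \<open>l\<close>. Terms of positive level cannot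
  meet the weight 0 and drop out of constant terms. With \<open>l\<close> a coordinate up to sign,
  this takes the place of extracting coefficients in a single variable.\<close>

definition supp_ge :: "(vec \<Rightarrow> real) \<Rightarrow> real \<Rightarrow> (vec \<Rightarrow>\<^sub>0 int) fps set" where
  "supp_ge l r = {F. \<forall>k. \<forall>\<beta>\<in>keys (fps_nth F k). r \<le> l \<beta>}"

lemma supp_ge_mono: "F \<in> supp_ge l r \<Longrightarrow> s \<le> r \<Longrightarrow> F \<in> supp_ge l s"
  by (force simp: supp_ge_def)

lemma supp_ge_0 [simp]: "0 \<in> supp_ge l r"
  by (simp add: supp_ge_def)

lemma supp_ge_add: "F \<in> supp_ge l r \<Longrightarrow> G \<in> supp_ge l r \<Longrightarrow> F + G \<in> supp_ge l r"
  using keys_add by (fastforce simp: supp_ge_def)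

lemma supp_ge_minus: "F \<in> supp_ge l r \<Longrightarrow> - F \<in> supp_ge l r"
  by (simp add: supp_ge_def)

lemma supp_ge_diff: "F \<in> supp_ge l r \<Longrightarrow> G \<in> supp_ge l r \<Longrightarrow> F - G \<in> supp_ge l r"
  using supp_ge_add[of F l r "- G"] supp_ge_minus[of G] by simp

lemma supp_ge_sum: "(\<And>i. i \<in> I \<Longrightarrow> F i \<in> supp_ge l r) \<Longrightarrow> sum F I \<in> supp_ge l r"
  by (induction I rule: infinite_finite_induct) (auto intro: supp_ge_add)

lemma supp_ge_fps_const: "(\<And>\<beta>. \<beta> \<in> keys c \<Longrightarrow> r \<le> l \<beta>) \<Longrightarrow> fps_const c \<in> supp_ge l r"
  by (simp add: supp_ge_def)

lemma supp_ge_ee: "r \<le> l \<beta> \<Longrightarrow> ee \<beta> \<in> supp_ge l r"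
  by (rule supp_ge_fps_const) simp

lemma ct_supp_ge:
  assumes "Modules.additive l" "F \<in> supp_ge l r" "0 < r"
  shows "ct F = 0"
proof (rule fps_ext)
  fix k
  have "0 \<notin> keys (fps_nth F k)"
    using assms(2,3) by (force simp: supp_ge_def additive.zero[OF assms(1)])
  then show "fps_nth (ct F) k = fps_nth 0 k"
    by (simp add: ct_def in_keys_iff)
qed

context
  fixes l :: "vec \<Rightarrow> real"
  assumes l: "Modules.additive l"
begin

lemma supp_ge_mult:
  assumes "F \<in> supp_ge l r" "G \<in> supp_ge l s"
  shows "F * G \<in> supp_ge l (r + s)"
  unfolding supp_ge_def
proof safe
  fix k \<beta> assume "\<beta> \<in> keys (fps_nth (F * G) k)"
  then obtain i where i: "\<beta> \<in> keys (fps_nth F i * fps_nth G (k - i))"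
    using keys_sum[of "\<lambda>i. fps_nth F i * fps_nth G (k - i)" "{0..k}"] by (auto simp: fps_mult_nth)
  then obtain \<gamma> \<delta> where "\<beta> = \<gamma> + \<delta>" "\<gamma> \<in> keys (fps_nth F i)" "\<delta> \<in> keys (fps_nth G (k - i))"
    using keys_mult by blast
  then show "r + s \<le> l \<beta>"
    using assms by (force simp: supp_ge_def additive.add[OF l] intro: add_mono)
qed

lemma supp_ge_mult_0: "F \<in> supp_ge l r \<Longrightarrow> G \<in> supp_ge l 0 \<Longrightarrow> F * G \<in> supp_ge l r"
  using supp_ge_mult[of F r G 0] by simp

lemma supp_ge_1: "1 \<in> supp_ge l 0"
  by (simp add: supp_ge_def additive.zero[OF l])

lemma supp_ge_X: "fps_X \<in> supp_ge l 0"
  by (simp add: supp_ge_def fps_X_def additive.zero[OF l])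

lemma supp_ge_of_int: "of_int c \<in> supp_ge l 0"
proof (cases "c = 0")
  case False
  have "keys (of_int c :: vec \<Rightarrow>\<^sub>0 int) \<subseteq> {0}"
    by (metis keys_single single_of_int subset_insertI2 subset_refl empty_subsetI)
  then show ?thesis
    unfolding fps_of_int[symmetric]
    by (intro supp_ge_fps_const) (use additive.zero[OF l] in auto)
qed simp

lemma supp_ge_prod: "(\<And>i. i \<in> I \<Longrightarrow> F i \<in> supp_ge l 0) \<Longrightarrow> prod F I \<in> supp_ge l 0"
  by (induction I rule: infinite_finite_induct) (auto intro: supp_ge_mult_0 supp_ge_1)

lemma supp_ge_geom_series:
  assumes "0 \<le> l \<alpha>"
  shows "geom_series \<alpha> \<in> supp_ge l 0"
proof -
  have *: "ee \<alpha> ^ k \<in> supp_ge l 0" for k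
    by (induction k) (simp_all add: supp_ge_1 supp_ge_mult_0 supp_ge_ee assms del: fps_const_power)
  have "\<forall>\<beta>\<in>keys (e_pow \<alpha> ^ k). 0 \<le> l \<beta>" for k
    using *[of k] by (auto simp: supp_ge_def dest: spec[of _ 0])
  then show ?thesis
    by (simp add: supp_ge_def geom_series_def)
qed

end

section \<open>The kernel factors (1 - e^\<alpha>) / (1 - t e^\<alpha>) and their
  truncations\<close>

definition theta :: "vec \<Rightarrow> (vec \<Rightarrow>\<^sub>0 int) fps" where
  "theta \<alpha> = (1 - ee \<alpha>) * geom_series \<alpha>"

lemma geom_series_unfold: "geom_series \<alpha> = 1 + fps_X * ee \<alpha> * geom_series \<alpha>"
proof -
  have "geom_series \<alpha> = (1 - fps_X * ee \<alpha>) * geom_series \<alpha> + fps_X * ee \<alpha> * geom_series \<alpha>"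
    by (simp add: algebra_simps)
  then show ?thesis
    by (simp only: geom_series_inverse)
qed

lemma X_theta: "(1 - fps_X * ee \<alpha>) * theta \<alpha> = 1 - ee \<alpha>"
  unfolding theta_def mult.left_commute[of _ "1 - ee \<alpha>"] geom_series_inverse by simp

lemma theta_expand1: "theta \<alpha> = 1 + (fps_X - 1) * ee \<alpha> * geom_series \<alpha>"
proof -
  have "theta \<alpha> = (1 - fps_X * ee \<alpha>) * geom_series \<alpha> + (fps_X - 1) * ee \<alpha> * geom_series \<alpha>"
    unfolding theta_def by (simp add: algebra_simps)
  then show ?thesis
    by (simp only: geom_series_inverse)
qed

text \<open>The geometric series is unfolded once more, so that the remainder visibly carries e^(2
  \<alpha>). The linear coefficient t - 1 later telescopes the geometric sums in the
  recurrences.\<close>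

lemma theta_expand2:
  "theta \<alpha> = 1 + (fps_X - 1) * ee \<alpha> + ee \<alpha> * ee \<alpha> * ((fps_X - 1) * fps_X * geom_series \<alpha>)"
proof -
  have "theta \<alpha> = 1 + (fps_X - 1) * ee \<alpha> * (1 + fps_X * ee \<alpha> * geom_series \<alpha>)"
    using theta_expand1[of \<alpha>] unfolding geom_series_unfold[of \<alpha>, symmetric] .
  also have "\<dots> = 1 + (fps_X - 1) * ee \<alpha> + ee \<alpha> * ee \<alpha> * ((fps_X - 1) * fps_X * geom_series \<alpha>)"
    by (simp add: algebra_simps del: fps_const_mult)
  finally show ?thesis .
qed

context
  fixes l :: "vec \<Rightarrow> real"
  assumes l: "Modules.additive l"
begin

lemma supp_ge_theta: "0 \<le> l \<alpha> \<Longrightarrow> theta \<alpha> \<in> supp_ge l 0"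
  unfolding theta_def
  by (intro supp_ge_mult_0 supp_ge_diff supp_ge_1 supp_ge_ee supp_ge_geom_series l) auto

lemma theta_sub_1_supp_ge:
  assumes "0 \<le> r" "r \<le> l \<alpha>"
  shows "theta \<alpha> - 1 \<in> supp_ge l r"
proof -
  have "ee \<alpha> * ((fps_X - 1) * geom_series \<alpha>) \<in> supp_ge l r"
    using assms
    by (intro supp_ge_mult_0 supp_ge_diff supp_ge_1 supp_ge_X supp_ge_ee supp_ge_geom_series l) auto
  then show ?thesis by (subst theta_expand1) (simp add: algebra_simps)
qed

text \<open>All roots of \<open>S\<close> have level 1, so modulo level 2 each factor contributes
  only its constant and linear terms, and products of two linear terms are negligible.\<close>

lemma prod_theta_supp_ge:
  assumes "finite S" "\<And>\<alpha>. \<alpha> \<in> S \<Longrightarrow> l \<alpha> = 1"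
  shows "(\<Prod>\<alpha>\<in>S. theta \<alpha>) - (1 + (fps_X - 1) * (\<Sum>\<alpha>\<in>S. ee \<alpha>)) \<in> supp_ge l 2"
  using assms
proof (induction S rule: finite_induct)
  case (insert \<alpha> S)
  define T where "T = (\<Sum>\<alpha>\<in>S. ee \<alpha>)"
  define P where "P = (\<Prod>\<alpha>\<in>S. theta \<alpha>)"
  define M where "M = P - (1 + (fps_X - 1) * T)"
  define N where "N = theta \<alpha> - (1 + (fps_X - 1) * ee \<alpha>)"
  have la: "l \<alpha> = 1" and lS: "\<And>\<beta>. \<beta> \<in> S \<Longrightarrow> l \<beta> = 1" using insert by auto
  have M: "M \<in> supp_ge l 2"
    using insert unfolding M_def T_def P_def by simp
  have "2 \<le> l (\<alpha> + \<alpha>)"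
    by (simp only: additive.add[OF l] la)
  then have "ee (\<alpha> + \<alpha>) * ((fps_X - 1) * fps_X * geom_series \<alpha>) \<in> supp_ge l 2"
    using la by (intro supp_ge_mult_0 supp_ge_diff supp_ge_1 supp_ge_X supp_ge_ee supp_ge_geom_series l) auto
  then have N: "N \<in> supp_ge l 2"
    unfolding N_def e_pow_add by (subst theta_expand2) simp
  have T: "T \<in> supp_ge l 1"
    unfolding T_def using lS by (intro supp_ge_sum supp_ge_ee) auto
  have "ee \<alpha> \<in> supp_ge l 1" using la by (intro supp_ge_ee) auto
  then have "ee \<alpha> * T \<in> supp_ge l (1 + 1)"
    using T by (intro supp_ge_mult l)
  moreover have "(fps_X - 1) * (fps_X - 1) \<in> supp_ge l 0"
    by (intro supp_ge_mult_0 supp_ge_diff supp_ge_1 supp_ge_X l)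
  ultimately have "(ee \<alpha> * T) * ((fps_X - 1) * (fps_X - 1)) \<in> supp_ge l 2"
    by (intro supp_ge_mult_0[OF l, of "ee \<alpha> * T"]) (simp_all only: one_add_one)
  moreover have "N * P \<in> supp_ge l 2"
    unfolding P_def using lS by (intro supp_ge_mult_0 N supp_ge_prod supp_ge_theta l) auto
  moreover have "M * (1 + (fps_X - 1) * ee \<alpha>) \<in> supp_ge l 2"
    using la by (intro supp_ge_mult_0 M supp_ge_add supp_ge_diff supp_ge_1 supp_ge_X supp_ge_ee l) auto
  \<comment> \<open>The new discrepancy splits into the product of the two linear parts, the error
    of the new factor times the old product, and the old error times the truncated new
    factor.\<close>
  ultimately have "(ee \<alpha> * T) * ((fps_X - 1) * (fps_X - 1)) + N * P + M * (1 + (fps_X - 1) * ee \<alpha>)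
      \<in> supp_ge l 2"
    by (intro supp_ge_add)
  also have "(ee \<alpha> * T) * ((fps_X - 1) * (fps_X - 1)) + N * P + M * (1 + (fps_X - 1) * ee \<alpha>) =
      theta \<alpha> * P - (1 + (fps_X - 1) * (ee \<alpha> + T))"
    unfolding N_def M_def by (simp add: algebra_simps del: fps_const_mult)
  finally show ?case
    using insert unfolding T_def P_def by simp
qed simp

lemma prod_theta_sub_1_supp_ge:
  assumes "finite S" "\<And>\<alpha>. \<alpha> \<in> S \<Longrightarrow> l \<alpha> = 1"
  shows "(\<Prod>\<alpha>\<in>S. theta \<alpha>) - 1 \<in> supp_ge l 1"
proof -
  have "(fps_X - 1) * (\<Sum>\<alpha>\<in>S. ee \<alpha>) \<in> supp_ge l (0 + 1)"
    using assms by (intro supp_ge_mult supp_ge_diff supp_ge_1 supp_ge_X supp_ge_sum supp_ge_ee l) auto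
  then show ?thesis
    using supp_ge_add[OF supp_ge_mono[OF prod_theta_supp_ge[OF assms], of 1]] by fastforce
qed

end

text \<open>Apart from the factor at \<alpha>, the kernel is invariant under \<open>w\<close>, while
  e^\<beta> and e^(\<beta> + \<alpha>) are exchanged. Their difference times the invariant part is
  skew and has constant term 0. Since e^\<beta> (1 - e^\<alpha>) equals e^\<beta> (1 - t e^\<alpha>)
  times \<open>theta \<alpha>\<close>, this vanishing is the claim.\<close>

lemma ct_swap:
  assumes w: "Modules.additive w" "inj w"
    and S: "finite S" "\<alpha> \<in> S" "w ` (S - {\<alpha>}) = S - {\<alpha>}" "w \<alpha> = - \<alpha>"
    and F: "act_fps w F = F" and \<beta>: "w \<beta> = \<beta> + \<alpha>"
  shows "ct (ee \<beta> * (F * (\<Prod>\<alpha>\<in>S. theta \<alpha>))) = fps_X * ct (ee (\<beta> + \<alpha>) * (F * (\<Prod>\<alpha>\<in>S. theta \<alpha>)))"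
proof -
  define P where "P = (\<Prod>\<alpha>\<in>S - {\<alpha>}. theta \<alpha>)"
  have "act_fps w (theta \<gamma>) = theta (w \<gamma>)" for \<gamma>
    unfolding theta_def using act_fps_const[of w 1]
    by (simp add: act_fps_mult act_fps_diff act_fps_const act_fps_geom_series act_1 w)
  then have "act_fps w P = (\<Prod>\<gamma>\<in>S - {\<alpha>}. theta (w \<gamma>))"
    unfolding P_def by (simp add: act_fps_prod w)
  also have "\<dots> = (\<Prod>\<gamma>\<in>w ` (S - {\<alpha>}). theta \<gamma>)"
    using w by (subst prod.reindex) (auto intro: inj_on_subset)
  finally have P: "act_fps w P = P"
    using S by (simp add: P_def)
  have w2: "w (\<beta> + \<alpha>) = \<beta>"
    using \<beta> S(4) by (simp add: additive.add[OF w(1)])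
  have "act_fps w ((ee \<beta> - ee (\<beta> + \<alpha>)) * (F * P)) = (ee (\<beta> + \<alpha>) - ee \<beta>) * (F * P)"
    by (simp only: act_fps_mult act_fps_diff w F P act_fps_const act_e_pow w2 \<beta>)
  then have "ct ((ee \<beta> - ee (\<beta> + \<alpha>)) * (F * P)) = 0"
    by (intro ct_skew[OF w]) (simp add: algebra_simps del: fps_const_sub)
  also have "(ee \<beta> - ee (\<beta> + \<alpha>)) * (F * P) = ee \<beta> * (1 - ee \<alpha>) * (F * P)"
    by (simp add: ee_add algebra_simps del: fps_const_mult)
  also have "\<dots> = ee \<beta> * ((1 - fps_X * ee \<alpha>) * theta \<alpha>) * (F * P)"
    by (simp only: X_theta)
  also have "\<dots> = ee \<beta> * (F * (theta \<alpha> * P)) - fps_X * (ee (\<beta> + \<alpha>) * (F * (theta \<alpha> * P)))"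
    by (simp add: ee_add algebra_simps del: fps_const_mult)
  also have "theta \<alpha> * P = (\<Prod>\<alpha>\<in>S. theta \<alpha>)"
    unfolding P_def using S by (simp add: prod.remove[of S \<alpha>])
  finally show ?thesis
    by (simp only: ct_diff ct_X_mult right_minus_eq)
qed

text \<open>The factor (1 + u / x) (1 + v x) at x = e^(eps i), multiplied out. The parameters are
  integers; the polynomial identity in u is recovered at the end from infinitely many
  values.\<close>

definition phi :: "int \<Rightarrow> int \<Rightarrow> nat \<Rightarrow> vec \<Rightarrow>\<^sub>0 int" where
  "phi u v i = of_int (1 + u * v) + of_int u * e_pow (- eps i) + of_int v * e_pow (eps i)"

lemma act_phi:
  assumes "Modules.additive w" "w (eps i) = eps j"
  shows "act w (phi u v i) = phi u v j"
  using act_of_int_mult[of w "1 + u * v" 1]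
  by (simp add: phi_def act_add act_of_int_mult act_1 assms additive.minus[OF assms(1)] del: of_int_add of_int_mult)

lemma fps_const_phi:
  "fps_const (phi u v i) = of_int (1 + u * v) + of_int u * ee (- eps i) + of_int v * ee (eps i)"
  unfolding phi_def fps_of_int[symmetric] by simp

lemma fps_const_prod: "fps_const (prod F I) = (\<Prod>i\<in>I. fps_const (F i :: 'a :: comm_ring_1))"
  by (induction I rule: infinite_finite_induct) (simp_all flip: fps_const_mult)

lemma additive_coord: "Modules.additive (\<lambda>\<beta> :: vec. \<beta> k)"
  by unfold_locales simp

lemma additive_neg_coord: "Modules.additive (\<lambda>\<beta> :: vec. - \<beta> k)"
  by unfold_locales simp

text \<open>Extraction of the constant term in the variable x_k, which does not occur in
  \<open>rest\<close> by the two support conditions. The summand 1 + u v of \<open>phi\<close> meets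
  the constant term 1 of the kernel, and u / x_k meets the linear terms (t - 1) e^\<alpha>; nothing
  else has level 0. \<open>E\<close> is 1 in type A and the factor of a long root in type C.\<close>

lemma ct_peel:
  fixes k :: nat and rest E :: "(vec \<Rightarrow>\<^sub>0 int) fps"
  defines "l \<equiv> \<lambda>\<beta> :: vec. \<beta> k"
  assumes S: "finite S" "\<And>\<alpha>. \<alpha> \<in> S \<Longrightarrow> l \<alpha> = 1"
    and E: "E - 1 \<in> supp_ge l 2"
    and rest: "rest \<in> supp_ge l 0" "rest \<in> supp_ge (\<lambda>\<beta>. - l \<beta>) 0"
  shows "ct (fps_const (phi u v k) * (E * (\<Prod>\<alpha>\<in>S. theta \<alpha>)) * rest) =
    of_int (1 + u * v) * ct rest +
    of_int u * ((fps_X - 1) * (\<Sum>\<alpha>\<in>S. ct (ee (\<alpha> - eps k) * rest)))"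
proof -
  have l: "Modules.additive l" unfolding l_def by (rule additive_coord)
  have nl: "Modules.additive (\<lambda>\<beta>. - l \<beta>)" unfolding l_def by (rule additive_neg_coord)
  have lk: "l (eps k) = 1" "l (- eps k) = -1" by (simp_all add: l_def eps_def)
  define T where "T = (\<Sum>\<alpha>\<in>S. ee \<alpha>)"
  define P where "P = (\<Prod>\<alpha>\<in>S. theta \<alpha>)"
  define W where "W = (fps_X - 1) * T"
  define M where "M = E * P - (1 + W)"
  have P: "P \<in> supp_ge l 0"
    unfolding P_def using S by (intro supp_ge_prod supp_ge_theta l) simp
  have W: "W \<in> supp_ge l 1"
    using supp_ge_mult[OF l, of "fps_X - 1" 0 T 1] S unfolding W_def T_def
    by (simp add: supp_ge_diff supp_ge_X supp_ge_1 l supp_ge_sum supp_ge_ee)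
  have "(E - 1) * P + (P - (1 + W)) \<in> supp_ge l 2"
    unfolding W_def using P S
    by (intro supp_ge_add supp_ge_mult_0 E l) (simp_all add: P_def T_def prod_theta_supp_ge l)
  then have M: "M \<in> supp_ge l 2"
    by (simp add: M_def algebra_simps)
  have ee1: "ee (eps k) \<in> supp_ge l 1" "ee (- eps k) \<in> supp_ge l (-1)"
    "ee (- eps k) \<in> supp_ge (\<lambda>\<beta>. - l \<beta>) 1"
    using lk by (auto intro: supp_ge_ee)
  have phi: "fps_const (phi u v k) \<in> supp_ge l (-1)"
    unfolding fps_const_phi
    using supp_ge_mult[OF l supp_ge_of_int[OF l] ee1(2), of u]
      supp_ge_mult[OF l supp_ge_of_int[OF l] ee1(1), of v] supp_ge_of_int[OF l, of "1 + u * v"]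
    by (intro supp_ge_add) (auto elim: supp_ge_mono)
  have "fps_const (phi u v k) * M * rest \<in> supp_ge l 1"
    using supp_ge_mult_0[OF l supp_ge_mult[OF l phi M] rest(1)] by simp
  \<comment> \<open>Facts 1 to 5 discard the terms of nonzero level in x_k; fact 6 evaluates the
    pairing of u / x_k with the linear part of the kernel.\<close>
  then have 1: "ct (fps_const (phi u v k) * M * rest) = 0"
    by (rule ct_supp_ge[OF l]) simp
  have 2: "ct (ee (- eps k) * rest) = 0"
    using supp_ge_mult_0[OF nl ee1(3) rest(2)] by (rule ct_supp_ge[OF nl]) simp
  have 3: "ct (ee (eps k) * rest) = 0"
    using supp_ge_mult_0[OF l ee1(1) rest(1)] by (rule ct_supp_ge[OF l]) simp
  have W0: "W * rest \<in> supp_ge l 1"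
    by (rule supp_ge_mult_0[OF l W rest(1)])
  then have 4: "ct (W * rest) = 0"
    by (rule ct_supp_ge[OF l]) simp
  have 5: "ct (ee (eps k) * (W * rest)) = 0"
    using supp_ge_mult[OF l ee1(1) W0] by (rule ct_supp_ge[OF l]) simp
  have "ct (ee (- eps k) * (W * rest)) = (fps_X - 1) * ct ((\<Sum>\<alpha>\<in>S. ee (\<alpha> - eps k)) * rest)"
  proof -
    have "ee (- eps k) * (W * rest) = fps_X * ((\<Sum>\<alpha>\<in>S. ee (- eps k) * ee \<alpha>) * rest)
        - (\<Sum>\<alpha>\<in>S. ee (- eps k) * ee \<alpha>) * rest"
      unfolding W_def T_def sum_distrib_left[symmetric] by (simp add: algebra_simps del: fps_const_mult)
    also have "(\<Sum>\<alpha>\<in>S. ee (- eps k) * ee \<alpha>) = (\<Sum>\<alpha>\<in>S. ee (\<alpha> - eps k))"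
      unfolding ee_add[symmetric] by simp
    finally show ?thesis by (simp only: ct_diff ct_X_mult left_diff_distrib mult_1_left)
  qed
  then have 6: "ct (ee (- eps k) * (W * rest)) = (fps_X - 1) * (\<Sum>\<alpha>\<in>S. ct (ee (\<alpha> - eps k) * rest))"
    by (simp only: sum_distrib_right ct_sum)
  have "fps_const (phi u v k) * (E * P) * rest =
      fps_const (phi u v k) * M * rest + of_int (1 + u * v) * rest + of_int u * (ee (- eps k) * rest)
      + of_int v * (ee (eps k) * rest) + of_int (1 + u * v) * (W * rest)
      + of_int u * (ee (- eps k) * (W * rest)) + of_int v * (ee (eps k) * (W * rest))"
    unfolding M_def fps_const_phi by (simp add: algebra_simps del: fps_const_mult)
  then have "ct (fps_const (phi u v k) * (E * P) * rest) = of_int (1 + u * v) * ct rest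
      + of_int u * ct (ee (- eps k) * (W * rest))"
    by (simp only: ct_add ct_of_int_mult 1 2 3 4 5 mult_zero_right add_0_left add_0_right)
  then show ?thesis
    by (simp only: 6 P_def)
qed

text \<open>Only the leading terms \<open>c\<close> of \<open>Y\<close> and 1 of \<open>E\<close>
  have level 0; everything else is of positive level against \<open>rest\<close>.\<close>

lemma ct_leading:
  assumes l: "Modules.additive l"
    and "Y - of_int c \<in> supp_ge l 1" "E - 1 \<in> supp_ge l 1" "rest \<in> supp_ge l 0"
  shows "ct (Y * (E * rest)) = of_int c * ct rest"
proof -
  have "(Y - of_int c) + of_int c \<in> supp_ge l 0"
    by (intro supp_ge_add supp_ge_mono[OF assms(2)] supp_ge_of_int l) simp
  then have "Y * (E - 1) \<in> supp_ge l 1"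
    using supp_ge_mult[OF l, of Y 0 "E - 1" 1] assms(3) by simp
  then have "(Y * (E - 1) + (Y - of_int c)) * rest \<in> supp_ge l 1"
    using assms by (intro supp_ge_mult_0[OF l, of "Y * (E - 1) + (Y - of_int c)"] supp_ge_add)
  then have "ct ((Y * (E - 1) + (Y - of_int c)) * rest) = 0"
    by (rule ct_supp_ge[OF l]) simp
  also have "(Y * (E - 1) + (Y - of_int c)) * rest = Y * (E * rest) - of_int c * rest"
    by (simp add: algebra_simps)
  finally show ?thesis
    by (simp only: ct_diff ct_of_int_mult right_minus_eq)
qed

section \<open>Simple reflections in coordinates, and root systems on an index interval\<close>

definition swap_coord :: "nat \<Rightarrow> vec \<Rightarrow> vec" where
  "swap_coord j x = (\<lambda>i. x (if i = j then Suc j else if i = Suc j then j else i))"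

definition neg_coord :: "nat \<Rightarrow> vec \<Rightarrow> vec" where
  "neg_coord j x = x(j := - x j)"

lemma swap_coord_eps [simp]:
  "swap_coord j (eps i) = eps (if i = j then Suc j else if i = Suc j then j else i)"
  by (auto simp: swap_coord_def eps_def fun_eq_iff)

lemma neg_coord_eps [simp]: "neg_coord j (eps i) = (if i = j then - eps i else eps i)"
  by (auto simp: neg_coord_def eps_def fun_eq_iff)

lemma swap_coord_swap_coord [simp]: "swap_coord j (swap_coord j x) = x"
  by (auto simp: swap_coord_def fun_eq_iff)

lemma neg_coord_neg_coord [simp]: "neg_coord j (neg_coord j x) = x"
  by (auto simp: neg_coord_def fun_eq_iff)

lemma additive_swap_coord: "Modules.additive (swap_coord j)"
  by unfold_locales (simp add: swap_coord_def fun_eq_iff)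

lemma additive_neg_coord_map: "Modules.additive (neg_coord j)"
  by unfold_locales (simp add: neg_coord_def fun_eq_iff)

lemma inj_swap_coord: "inj (swap_coord j)"
  by (metis injI swap_coord_swap_coord)

lemma inj_neg_coord: "inj (neg_coord j)"
  by (metis injI neg_coord_neg_coord)

lemmas swap_coord_linear [simp] =
  additive.add[OF additive_swap_coord] additive.diff[OF additive_swap_coord]
  additive.minus[OF additive_swap_coord]

lemmas neg_coord_linear [simp] =
  additive.add[OF additive_neg_coord_map] additive.diff[OF additive_neg_coord_map]
  additive.minus[OF additive_neg_coord_map]

lemma coord_double [simp]:
  "swap_coord j (2 * x) = 2 * swap_coord j x" "neg_coord j (2 * x) = 2 * neg_coord j x"
  by (simp_all only: mult_2 swap_coord_linear neg_coord_linear)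

text \<open>Both ends of the index interval vary, because variables are peeled off on the left and,
  in type A, also on the right.\<close>

definition roots_A :: "nat \<Rightarrow> nat \<Rightarrow> vec set" where
  "roots_A a b = {eps i - eps j | i j. a \<le> i \<and> i < j \<and> j < b}"

definition roots_C :: "nat \<Rightarrow> nat \<Rightarrow> vec set" where
  "roots_C a b = roots_A a b \<union> {eps i + eps j | i j. a \<le> i \<and> i \<le> j \<and> j < b}"

lemma roots_A_I: "a \<le> i \<Longrightarrow> i < j \<Longrightarrow> j < b \<Longrightarrow> eps i - eps j \<in> roots_A a b"
  by (auto simp: roots_A_def)

lemma roots_A_E:
  assumes "x \<in> roots_A a b"
  obtains i j where "a \<le> i" "i < j" "j < b" "x = eps i - eps j"
  using assms by (auto simp: roots_A_def)

lemma roots_C_I: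
  "a \<le> i \<Longrightarrow> i < j \<Longrightarrow> j < b \<Longrightarrow> eps i - eps j \<in> roots_C a b"
  "a \<le> i \<Longrightarrow> a \<le> j \<Longrightarrow> i < b \<Longrightarrow> j < b \<Longrightarrow> eps i + eps j \<in> roots_C a b"
proof -
  have le: "eps i + eps j \<in> roots_C a b" if "a \<le> i" "i \<le> j" "j < b" for i j
  proof -
    have "\<exists>i' j'. eps i + eps j = eps i' + eps j' \<and> a \<le> i' \<and> i' \<le> j' \<and> j' < b"
      by (rule exI[of _ i], rule exI[of _ j]) (simp add: that)
    then show ?thesis
      unfolding roots_C_def by (intro UnI2 CollectI)
  qed
  assume *: "a \<le> i" "a \<le> j" "i < b" "j < b"
  show "eps i + eps j \<in> roots_C a b"
  proof (cases "i \<le> j")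
    case False
    then have "eps j + eps i \<in> roots_C a b" using * by (intro le) auto
    then show ?thesis by (subst add.commute)
  qed (use * in \<open>intro le\<close>)
next
  assume "a \<le> i" "i < j" "j < b"
  then show "eps i - eps j \<in> roots_C a b"
    unfolding roots_C_def by (intro UnI1 roots_A_I)
qed

lemma roots_C_long: "a \<le> i \<Longrightarrow> i < b \<Longrightarrow> 2 * eps i \<in> roots_C a b"
  using roots_C_I(2)[of a i i b] by (simp only: mult_2)

lemma roots_C_cases:
  assumes "x \<in> roots_C a b"
  obtains i j where "a \<le> i" "i < j" "j < b" "x = eps i - eps j"
    | i j where "a \<le> i" "i \<le> j" "j < b" "x = eps i + eps j"
  using assms by (auto simp: roots_C_def roots_A_def)

lemma finite_roots_A: "finite (roots_A a b)"
proof (rule finite_subset)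
  show "roots_A a b \<subseteq> (\<lambda>(i, j). eps i - eps j) ` ({..<b} \<times> {..<b})"
    by (force simp: roots_A_def)
qed simp

lemma finite_roots_C: "finite (roots_C a b)"
proof (rule finite_subset)
  show "roots_C a b \<subseteq> roots_A a b \<union> (\<lambda>(i, j). eps i + eps j) ` ({..<b} \<times> {..<b})"
    by (force simp: roots_C_def)
qed (simp add: finite_roots_A)

lemma roots_A_outside: "\<alpha> \<in> roots_A a b \<Longrightarrow> k < a \<or> b \<le> k \<Longrightarrow> \<alpha> k = 0"
  by (auto simp: roots_A_def eps_def)

lemma roots_C_outside: "\<alpha> \<in> roots_C a b \<Longrightarrow> k < a \<or> b \<le> k \<Longrightarrow> \<alpha> k = 0"
  by (auto simp: roots_A_def roots_C_def eps_def)

lemma eps_diff_eq_iff: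
  "i \<noteq> j \<Longrightarrow> k \<noteq> m \<Longrightarrow> eps i - eps j = eps k - eps m \<longleftrightarrow> i = k \<and> j = m"
proof safe
  assume *: "i \<noteq> j" "k \<noteq> m" "eps i - eps j = eps k - eps m"
  show "i = k" "j = m"
    using fun_cong[OF *(3), of i] fun_cong[OF *(3), of j] *(1,2)
    by (auto simp: eps_def split: if_splits)
qed

text \<open>An injection of a finite set into itself is onto, so an inclusion suffices. The value
  \<alpha> is not taken, since it comes from - \<alpha> alone, which lies outside
  \<open>S\<close>.\<close>

lemma image_diff_simple_eq:
  assumes "inj w" "finite S" "w ` (S - {\<alpha>}) \<subseteq> S" "w \<alpha> = - \<alpha>" "w (- \<alpha>) = \<alpha>" "- \<alpha> \<notin> S"
  shows "w ` (S - {\<alpha>}) = S - {\<alpha>}"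
proof (rule card_subset_eq)
  show "w ` (S - {\<alpha>}) \<subseteq> S - {\<alpha>}"
    using assms by (auto dest: injD)
  show "card (w ` (S - {\<alpha>})) = card (S - {\<alpha>})"
    using assms by (intro card_image) (auto intro: inj_on_subset)
qed (use assms in simp)

text \<open>Twice the usual height in type C: the simple roots, long or short, all have value 2. The
  same functional serves the type A subsystem.\<close>

definition height :: "nat \<Rightarrow> nat \<Rightarrow> vec \<Rightarrow> real" where
  "height a b \<beta> = (\<Sum>i = a..<b. (2 * real b - 2 * real i - 1) * \<beta> i)"

lemma height_eps: "a \<le> k \<Longrightarrow> k < b \<Longrightarrow> height a b (eps k) = 2 * real b - 2 * real k - 1"
  by (simp add: height_def eps_def if_distrib[of "(*) _"] sum.delta' cong: if_cong)

lemma height_add: "height a b (\<beta> + \<gamma>) = height a b \<beta> + height a b \<gamma>"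
  by (simp add: height_def distrib_left sum.distrib)

lemma height_minus: "height a b (- \<beta>) = - height a b \<beta>"
  by (simp add: height_def sum_negf)

lemma height_diff: "height a b (\<beta> - \<gamma>) = height a b \<beta> - height a b \<gamma>"
  using height_add[of a b \<beta> "- \<gamma>"] by (simp add: height_minus)

lemma height_root_ge_2:
  assumes "\<alpha> \<in> roots_C a b"
  shows "2 \<le> height a b \<alpha>"
  using assms
  by (cases rule: roots_C_cases) (simp_all only: height_add height_diff, simp_all add: height_eps)

lemma neg_root_notin: "\<alpha> \<in> roots_C a b \<Longrightarrow> - \<alpha> \<notin> roots_C a b"
  using height_root_ge_2[of \<alpha> a b] height_root_ge_2[of "- \<alpha>" a b] by (auto simp: height_minus)

lemma swap_coord_roots_A:
  assumes "a \<le> j" "Suc j < b"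
  defines "\<alpha> \<equiv> eps j - eps (Suc j)"
  shows "swap_coord j ` (roots_A a b - {\<alpha>}) = roots_A a b - {\<alpha>}"
proof (rule image_diff_simple_eq[OF inj_swap_coord finite_roots_A])
  show "swap_coord j ` (roots_A a b - {\<alpha>}) \<subseteq> roots_A a b"
    using assms(1,2) by (auto simp: roots_A_def \<alpha>_def eps_diff_eq_iff split: if_splits)
  show "- \<alpha> \<notin> roots_A a b"
    using neg_root_notin[of \<alpha> a b] roots_C_I(1)[of a j "Suc j" b] assms by (auto simp: roots_C_def)
qed (simp_all add: \<alpha>_def)

lemma swap_coord_roots_C:
  assumes "a \<le> j" "Suc j < b"
  defines "\<alpha> \<equiv> eps j - eps (Suc j)"
  shows "swap_coord j ` (roots_C a b - {\<alpha>}) = roots_C a b - {\<alpha>}"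
proof (rule image_diff_simple_eq[OF inj_swap_coord finite_roots_C])
  have "swap_coord j x \<in> roots_C a b" if x: "x \<in> roots_C a b" "x \<noteq> \<alpha>" for x
    using x(1)
  proof (cases rule: roots_C_cases)
    case (1 i k)
    then have "x \<in> roots_A a b - {\<alpha>}" using x by (auto simp: roots_A_def)
    then show ?thesis
      using swap_coord_roots_A[OF assms(1,2)] by (auto simp: roots_C_def \<alpha>_def)
  next
    case (2 i k)
    then show ?thesis using assms(1,2) by (auto intro!: roots_C_I roots_C_long)
  qed
  then show "swap_coord j ` (roots_C a b - {\<alpha>}) \<subseteq> roots_C a b" by auto
  show "- \<alpha> \<notin> roots_C a b"
    using assms by (intro neg_root_notin) (auto intro!: roots_C_I)
qed (simp_all add: \<alpha>_def)

lemma neg_coord_roots_C: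
  assumes "a \<le> n"
  defines "\<alpha> \<equiv> eps n + eps n"
  shows "neg_coord n ` (roots_C a (Suc n) - {\<alpha>}) = roots_C a (Suc n) - {\<alpha>}"
proof (rule image_diff_simple_eq[OF inj_neg_coord finite_roots_C])
  have "neg_coord n x \<in> roots_C a (Suc n)" if x: "x \<in> roots_C a (Suc n)" "x \<noteq> \<alpha>" for x
    using x(1)
  proof (cases rule: roots_C_cases)
    case (1 i k)
    then show ?thesis using assms(1) by (cases "k = n") (auto intro!: roots_C_I)
  next
    case (2 i k)
    have "i < n"
    proof (rule ccontr)
      assume "\<not> i < n"
      then have "i = n" "k = n" using 2 by auto
      then show False using x(2) 2(4) unfolding \<alpha>_def by blast
    qed
    then show ?thesis using 2 assms(1) by (cases "k = n") (auto intro!: roots_C_I simp: less_Suc_eq)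
  qed
  then show "neg_coord n ` (roots_C a (Suc n) - {\<alpha>}) \<subseteq> roots_C a (Suc n)" by auto
  show "- \<alpha> \<notin> roots_C a (Suc n)"
    unfolding \<alpha>_def using assms by (intro neg_root_notin roots_C_I(2)) auto
qed (simp_all add: \<alpha>_def)

lemma act_swap_prod_phi:
  assumes "a \<le> j" "Suc j < b"
  shows "act (swap_coord j) (\<Prod>i = a..<b. phi u v i) = (\<Prod>i = a..<b. phi u v i)"
proof -
  let ?\<sigma> = "\<lambda>i. if i = j then Suc j else if i = Suc j then j else i"
  have "act (swap_coord j) (\<Prod>i = a..<b. phi u v i) = (\<Prod>i = a..<b. phi u v (?\<sigma> i))"
    unfolding act_prod[OF additive_swap_coord] act_phi[OF additive_swap_coord swap_coord_eps] ..
  also have "\<dots> = (\<Prod>i = a..<b. phi u v i)"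
    using assms by (intro prod.reindex_bij_witness[of _ ?\<sigma> ?\<sigma>]) auto
  finally show ?thesis .
qed

text \<open>Inverting x_n exchanges u / x_n and v x_n; equal parameters make this a symmetry, hence
  the single parameter in type C.\<close>

lemma act_neg_prod_phi:
  "act (neg_coord n) (\<Prod>i = a..<b. phi u u i) = (\<Prod>i = a..<b. phi u u i)"
proof -
  have "act (neg_coord n) (phi u u i) = phi u u i" for i
    using act_of_int_mult[of "neg_coord n" "1 + u * u" 1]
    by (cases "i = n") (simp_all add: phi_def act_add act_of_int_mult act_1 additive_neg_coord_map
        del: of_int_add of_int_mult)
  then show ?thesis
    by (simp add: act_prod additive_neg_coord_map)
qed

lemma act_fps_const_eq: "act w F = F \<Longrightarrow> act_fps w (fps_const F) = fps_const F"
  by (simp add: act_fps_const)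

section \<open>Recurrences for the constant terms\<close>

text \<open>The generating character times the kernel. On the full interval its constant term is the
  generalized exponent of that character, by \<open>pairing_symmetric\<close>.\<close>

definition hall :: "(nat \<Rightarrow> nat \<Rightarrow> vec set) \<Rightarrow> nat \<Rightarrow> nat \<Rightarrow> int \<Rightarrow> int \<Rightarrow> (vec \<Rightarrow>\<^sub>0 int) fps" where
  "hall R a b u v = fps_const (\<Prod>i = a..<b. phi u v i) * (\<Prod>\<alpha>\<in>R a b. theta \<alpha>)"

lemma prod_phi_supp_ge_0:
  assumes "k < a \<or> b \<le> k"
  shows "fps_const (\<Prod>i = a..<b. phi u v i) \<in> supp_ge (\<lambda>\<beta>. \<beta> k) 0"
    and "fps_const (\<Prod>i = a..<b. phi u v i) \<in> supp_ge (\<lambda>\<beta>. - \<beta> k) 0"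
  unfolding fps_const_prod fps_const_phi using assms
  by (auto intro!: supp_ge_prod supp_ge_add supp_ge_of_int additive_coord additive_neg_coord supp_ge_mult_0
      supp_ge_ee simp: eps_def simp del: of_int_add of_int_mult)

text \<open>The two bounds together say that a variable outside the interval does not occur.\<close>

lemma hall_supp_ge_0:
  assumes "k < a \<or> b \<le> k" "R = roots_A \<or> R = roots_C"
  shows "hall R a b u v \<in> supp_ge (\<lambda>\<beta>. \<beta> k) 0" "hall R a b u v \<in> supp_ge (\<lambda>\<beta>. - \<beta> k) 0"
proof -
  have "\<alpha> k = 0" if "\<alpha> \<in> R a b" for \<alpha>
    using that assms roots_A_outside roots_C_outside by metis
  then have "0 \<le> \<alpha> k" "\<alpha> k \<le> 0" if "\<alpha> \<in> R a b" for \<alpha>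
    using that by (metis order_refl)+
  then show "hall R a b u v \<in> supp_ge (\<lambda>\<beta>. \<beta> k) 0" "hall R a b u v \<in> supp_ge (\<lambda>\<beta>. - \<beta> k) 0"
    unfolding hall_def
    by (auto intro!: supp_ge_mult_0 supp_ge_prod supp_ge_theta additive_coord additive_neg_coord
        prod_phi_supp_ge_0 assms(1))
qed

lemma hall_empty: "hall roots_A a a u v = 1" "hall roots_C a a u v = 1"
proof -
  have "roots_A a a = {}" "roots_C a a = {}"
    by (auto elim!: roots_A_E roots_C_cases)
  then show "hall roots_A a a u v = 1" "hall roots_C a a u v = 1"
    by (simp_all add: hall_def)
qed

text \<open>The product is bracketed for \<open>ct_peel\<close>; the factor 1 stands where type C
  has the long root 2 eps a.\<close>

lemma hall_A_left:
  assumes "a < b"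
  shows "hall roots_A a b u v =
    fps_const (phi u v a) * (1 * (\<Prod>\<alpha>\<in>(\<lambda>j. eps a - eps j) ` {a<..<b}. theta \<alpha>)) * hall roots_A (Suc a) b u v"
proof -
  have "roots_A a b = (\<lambda>j. eps a - eps j) ` {a<..<b} \<union> roots_A (Suc a) b"
  proof safe
    fix x assume "x \<in> roots_A a b" "x \<notin> roots_A (Suc a) b"
    then show "x \<in> (\<lambda>j. eps a - eps j) ` {a<..<b}"
      unfolding roots_A_def by safe (metis (no_types, lifting) Suc_leI greaterThanLessThan_iff image_eqI le_neq_implies_less)
  qed (use assms in \<open>auto elim!: roots_A_E intro!: roots_A_I\<close>)
  moreover have "(\<lambda>j. eps a - eps j) ` {a<..<b} \<inter> roots_A (Suc a) b = {}"
  proof -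
    have "(eps a - eps j) a = 1" if "a < j" for j
      using that by (simp add: eps_def)
    then show ?thesis using roots_A_outside[of _ "Suc a" b a] by fastforce
  qed
  ultimately show ?thesis
    unfolding hall_def prod.atLeast_Suc_lessThan[OF assms]
    by (simp add: prod.union_disjoint finite_roots_A mult_ac flip: fps_const_mult)
qed

lemma hall_A_right:
  assumes "a \<le> b"
  shows "hall roots_A a (Suc b) u v =
    fps_const (phi u v b) * ((\<Prod>\<alpha>\<in>(\<lambda>i. eps i - eps b) ` {a..<b}. theta \<alpha>) * hall roots_A a b u v)"
proof -
  have "roots_A a (Suc b) = (\<lambda>i. eps i - eps b) ` {a..<b} \<union> roots_A a b"
  proof safe
    fix x assume "x \<in> roots_A a (Suc b)" "x \<notin> roots_A a b"
    then show "x \<in> (\<lambda>i. eps i - eps b) ` {a..<b}"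
      unfolding roots_A_def by safe (metis (no_types, lifting) atLeastLessThan_iff image_eqI less_antisym)
  qed (use assms in \<open>auto elim!: roots_A_E intro!: roots_A_I\<close>)
  moreover have "(\<lambda>i. eps i - eps b) ` {a..<b} \<inter> roots_A a b = {}"
  proof -
    have "(eps i - eps b) b = -1" if "i < b" for i
      using that by (simp add: eps_def)
    then show ?thesis using roots_A_outside[of _ a b b] by fastforce
  qed
  ultimately show ?thesis
    unfolding hall_def prod.atLeastLessThan_Suc[OF assms]
    by (simp add: prod.union_disjoint finite_roots_A mult_ac flip: fps_const_mult)
qed

lemma hall_C_left:
  assumes "a < b"
  shows "hall roots_C a b u v =
    fps_const (phi u v a) * (theta (eps a + eps a) *
      (\<Prod>\<alpha>\<in>(\<lambda>j. eps a - eps j) ` {a<..<b} \<union> (\<lambda>j. eps a + eps j) ` {a<..<b}. theta \<alpha>)) *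
    hall roots_C (Suc a) b u v"
proof -
  let ?S = "(\<lambda>j. eps a - eps j) ` {a<..<b} \<union> (\<lambda>j. eps a + eps j) ` {a<..<b}"
  have eq: "roots_C a b = insert (eps a + eps a) (?S \<union> roots_C (Suc a) b)"
  proof (intro subset_antisym subsetI)
    fix x assume "x \<in> roots_C a b"
    then show "x \<in> insert (eps a + eps a) (?S \<union> roots_C (Suc a) b)"
    proof (cases rule: roots_C_cases)
      case (1 i j)
      then show ?thesis using roots_C_I(1)[of "Suc a" i j b] by (cases "i = a") auto
    next
      case (2 i j)
      then show ?thesis
        using roots_C_I(2)[of "Suc a" i j b] by (cases "i = a"; cases "j = a") auto
    qed
  next
    fix x assume "x \<in> insert (eps a + eps a) (?S \<union> roots_C (Suc a) b)"
    moreover have "roots_C (Suc a) b \<subseteq> roots_C a b"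
      by (auto elim!: roots_C_cases intro!: roots_C_I)
    ultimately show "x \<in> roots_C a b"
      using assms by (auto intro!: roots_C_I roots_C_long)
  qed
  have S: "x a = 1" if "x \<in> ?S" for x
    using that by (auto simp: eps_def)
  have R: "x a = 0" if "x \<in> roots_C (Suc a) b" for x
    using roots_C_outside[OF that, of a] by simp
  have "(eps a + eps a) a = 2"
    by (simp add: eps_def)
  then have "eps a + eps a \<notin> ?S \<union> roots_C (Suc a) b" "?S \<inter> roots_C (Suc a) b = {}"
    using S R by force+
  then have "(\<Prod>\<alpha>\<in>roots_C a b. theta \<alpha>) =
      theta (eps a + eps a) * ((\<Prod>\<alpha>\<in>?S. theta \<alpha>) * (\<Prod>\<alpha>\<in>roots_C (Suc a) b. theta \<alpha>))"
    unfolding eq by (subst prod.insert; (subst prod.union_disjoint)?) (auto simp: finite_roots_C)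
  then show ?thesis
    unfolding hall_def prod.atLeast_Suc_lessThan[OF assms]
    by (simp only: fps_const_mult[symmetric] mult_ac)
qed

definition LA :: "nat \<Rightarrow> nat \<Rightarrow> int \<Rightarrow> int \<Rightarrow> int fps" where
  "LA a b u v = ct (hall roots_A a b u v)"

definition LC :: "nat \<Rightarrow> nat \<Rightarrow> int \<Rightarrow> int fps" where
  "LC a b u = ct (hall roots_C a b u u)"

lemma ct_swap_A:
  assumes "a \<le> j" "Suc j < b"
  shows "ct (ee (- eps j) * hall roots_A a b u v) = fps_X * ct (ee (- eps (Suc j)) * hall roots_A a b u v)"
proof -
  let ?\<alpha> = "eps j - eps (Suc j)"
  have "ct (ee (- eps j) * hall roots_A a b u v) = fps_X * ct (ee (- eps j + ?\<alpha>) * hall roots_A a b u v)"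
    unfolding hall_def
    by (rule ct_swap[OF additive_swap_coord inj_swap_coord finite_roots_A _ swap_coord_roots_A[OF assms]
          _ act_fps_const_eq[OF act_swap_prod_phi[OF assms]]]) (use assms in \<open>auto intro: roots_A_I\<close>)
  then show ?thesis by simp
qed

lemma ct_swap_C:
  assumes "a \<le> j" "Suc j < b"
  shows "ct (ee (- eps j) * hall roots_C a b u v) = fps_X * ct (ee (- eps (Suc j)) * hall roots_C a b u v)"
    and "ct (ee (eps (Suc j)) * hall roots_C a b u v) = fps_X * ct (ee (eps j) * hall roots_C a b u v)"
proof -
  let ?\<alpha> = "eps j - eps (Suc j)"
  have *: "swap_coord j \<beta> = \<beta> + ?\<alpha> \<Longrightarrow>
      ct (ee \<beta> * hall roots_C a b u v) = fps_X * ct (ee (\<beta> + ?\<alpha>) * hall roots_C a b u v)" for \<beta>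
    unfolding hall_def
    by (rule ct_swap[OF additive_swap_coord inj_swap_coord finite_roots_C _ swap_coord_roots_C[OF assms]
          _ act_fps_const_eq[OF act_swap_prod_phi[OF assms]]]) (use assms in \<open>auto intro: roots_C_I\<close>)
  show "ct (ee (- eps j) * hall roots_C a b u v) = fps_X * ct (ee (- eps (Suc j)) * hall roots_C a b u v)"
    using *[of "- eps j"] by simp
  show "ct (ee (eps (Suc j)) * hall roots_C a b u v) = fps_X * ct (ee (eps j) * hall roots_C a b u v)"
    using *[of "eps (Suc j)"] by simp
qed

lemma ct_neg_C:
  assumes "a \<le> n"
  shows "ct (ee (- eps n) * hall roots_C a (Suc n) u u) = fps_X * ct (ee (eps n) * hall roots_C a (Suc n) u u)"
proof -
  let ?\<alpha> = "eps n + eps n"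
  have "ct (ee (- eps n) * hall roots_C a (Suc n) u u) =
      fps_X * ct (ee (- eps n + ?\<alpha>) * hall roots_C a (Suc n) u u)"
    unfolding hall_def
    by (rule ct_swap[OF additive_neg_coord_map inj_neg_coord finite_roots_C _ neg_coord_roots_C[OF assms]
          _ act_fps_const_eq[OF act_neg_prod_phi]]) (use assms in \<open>auto intro: roots_C_long\<close>)
  then show ?thesis by (simp only: add.assoc[symmetric] left_minus add_0_left)
qed

text \<open>Each transposition costs a factor t, so every summand is a power of t times the one with
  1 / x_b. There, in powers of 1 / x_b, the product of 1 / x_b with \<open>phi u v b\<close> has
  leading term v and the kernel factors involving x_b have leading term 1; thus x_b is peeled off on
  the right.\<close>

lemma ct_sum_A:
  assumes "a \<le> b"
  shows "(\<Sum>j = a..<Suc b. ct (ee (- eps j) * hall roots_A a (Suc b) u v)) =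
    (\<Sum>i<Suc b - a. fps_X ^ i) * (of_int v * LA a b u v)"
proof -
  define g where "g = (\<lambda>j. ct (ee (- eps j) * hall roots_A a (Suc b) u v))"
  define Z where "Z = g b"
  have *: "g (b - i) = fps_X ^ i * Z" if "i \<le> b - a" for i
    using that
  proof (induction i)
    case (Suc i)
    then have "g (b - Suc i) = fps_X * g (Suc (b - Suc i))"
      unfolding g_def using assms by (intro ct_swap_A) auto
    moreover have "Suc (b - Suc i) = b - i" using Suc by simp
    ultimately show ?case
      using Suc by (simp add: mult.assoc)
  qed (simp add: Z_def)
  have "(\<Sum>j = a..<Suc b. g j) = (\<Sum>i<Suc b - a. g (b - i))"
    using assms by (intro sum.reindex_bij_witness[of _ "\<lambda>i. b - i" "\<lambda>j. b - j"]) auto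
  also have "\<dots> = (\<Sum>i<Suc b - a. fps_X ^ i * Z)"
    using assms by (intro sum.cong * refl) auto
  finally have 1: "(\<Sum>j = a..<Suc b. g j) = (\<Sum>i<Suc b - a. fps_X ^ i) * Z"
    by (simp add: sum_distrib_right)
  let ?l = "\<lambda>\<beta> :: vec. - \<beta> b"
  have l: "Modules.additive ?l" by (rule additive_neg_coord)
  have "ee (- eps b) * fps_const (phi u v b) - of_int v =
      of_int (1 + u * v) * ee (- eps b) + of_int u * ee (- eps b + - eps b)"
    unfolding fps_const_phi ee_add
    by (simp add: algebra_simps del: fps_const_mult) (simp add: flip: e_pow_add)
  moreover have "of_int (1 + u * v) * ee (- eps b) \<in> supp_ge ?l 1"
    "of_int u * ee (- eps b + - eps b) \<in> supp_ge ?l 1"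
    using supp_ge_mult[OF l supp_ge_of_int[OF l] supp_ge_ee, of 1 "- eps b" "1 + u * v"]
      supp_ge_mult[OF l supp_ge_of_int[OF l] supp_ge_ee, of 1 "- eps b + - eps b" u]
    by (simp_all add: eps_def del: of_int_add of_int_mult)
  ultimately have Y: "ee (- eps b) * fps_const (phi u v b) - of_int v \<in> supp_ge ?l 1"
    by (simp add: supp_ge_add del: of_int_add of_int_mult)
  have E: "(\<Prod>\<alpha>\<in>(\<lambda>i. eps i - eps b) ` {a..<b}. theta \<alpha>) - 1 \<in> supp_ge ?l 1"
    by (intro prod_theta_sub_1_supp_ge l) (auto simp: eps_def)
  have "Z = of_int v * LA a b u v"
    using ct_leading[OF l Y E hall_supp_ge_0(2)[of b a b roots_A u v]]
    unfolding Z_def g_def LA_def hall_A_right[OF assms] by (simp add: mult.assoc del: fps_const_mult)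
  then show ?thesis using 1 by (simp only: g_def)
qed

text \<open>The monomials form one chain x_a, ..., x_(b-1), 1 / x_(b-1), ..., 1 / x_a along which
  the constant term gains a factor t at each step. The chain is twice as long as in type A, which is
  the origin of q = t^2. Its first term is then peeled in the variable x_a.\<close>

lemma ct_sum_C:
  assumes "a < b"
  shows "(\<Sum>j = a..<b. ct (ee (eps j) * hall roots_C a b u u) + ct (ee (- eps j) * hall roots_C a b u u)) =
    (\<Sum>i<2 * (b - a). fps_X ^ i) * (of_int u * LC (Suc a) b u)"
proof -
  define g where "g = (\<lambda>j. ct (ee (eps j) * hall roots_C a b u u))"
  define h where "h = (\<lambda>j. ct (ee (- eps j) * hall roots_C a b u u))"
  define Z where "Z = g a"
  define m where "m = b - a"
  have g: "g (a + i) = fps_X ^ i * Z" if "i < m" for i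
    using that
  proof (induction i)
    case (Suc i)
    then have "g (Suc (a + i)) = fps_X * g (a + i)"
      unfolding g_def by (intro ct_swap_C) (auto simp: m_def)
    then show ?case
      using Suc by (simp add: mult.assoc)
  qed (simp add: Z_def)
  have h: "h (b - Suc i) = fps_X ^ (m + i) * Z" if "i < m" for i
    using that
  proof (induction i)
    case 0
    \<comment> \<open>The turning point of the chain, where the long simple root takes x_(b-1) to
      its inverse.\<close>
    then have "h (b - 1) = fps_X * g (b - 1)"
      using ct_neg_C[of a "b - 1" u] assms unfolding g_def h_def by simp
    moreover have "a + (m - 1) = b - 1" "Suc (m - 1) = m"
      using assms by (simp_all add: m_def)
    ultimately show ?case
      using g[of "m - 1"] 0 by (simp flip: mult.assoc power_Suc)
  next
    case (Suc i)
    then have "h (b - Suc (Suc i)) = fps_X * h (Suc (b - Suc (Suc i)))"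
      unfolding h_def by (intro ct_swap_C) (auto simp: m_def)
    moreover have "Suc (b - Suc (Suc i)) = b - Suc i"
      using Suc by (simp add: m_def)
    ultimately show ?case
      using Suc by (simp add: mult.assoc)
  qed
  have "(\<Sum>j = a..<b. g j) = (\<Sum>i<m. fps_X ^ i * Z)"
    by (rule sum.reindex_bij_witness[of _ "\<lambda>i. a + i" "\<lambda>j. j - a"]) (auto simp: m_def g[unfolded m_def, symmetric])
  moreover have "(\<Sum>j = a..<b. h j) = (\<Sum>i = m..<2 * m. fps_X ^ i * Z)"
  proof (rule sum.reindex_bij_witness[of _ "\<lambda>i. b - Suc (i - m)" "\<lambda>j. m + (b - Suc j)"])
    fix j assume "j \<in> {a..<b}"
    then show "fps_X ^ (m + (b - Suc j)) * Z = h j"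
      using h[of "b - Suc j"] by (auto simp: m_def)
  qed (auto simp: m_def)
  moreover have "{..<2 * m} = {..<m} \<union> {m..<2 * m}" by auto
  then have "(\<Sum>i<2 * m. fps_X ^ i * Z) = (\<Sum>i<m. fps_X ^ i * Z) + (\<Sum>i = m..<2 * m. fps_X ^ i * Z)"
    by (metis (no_types, lifting) finite_atLeastLessThan finite_lessThan ivl_disj_int_one(2) sum.union_disjoint)
  ultimately have 1: "(\<Sum>j = a..<b. g j + h j) = (\<Sum>i<2 * m. fps_X ^ i) * Z"
    by (simp add: sum.distrib sum_distrib_right)
  let ?l = "\<lambda>\<beta> :: vec. \<beta> a"
  let ?S = "(\<lambda>j. eps a - eps j) ` {a<..<b} \<union> (\<lambda>j. eps a + eps j) ` {a<..<b}"
  have l: "Modules.additive ?l" by (rule additive_coord)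
  have "ee (eps a) * fps_const (phi u u a) - of_int u =
      of_int (1 + u * u) * ee (eps a) + of_int u * ee (eps a + eps a)"
    unfolding fps_const_phi ee_add
    by (simp add: algebra_simps del: fps_const_mult) (simp add: flip: e_pow_add)
  moreover have "of_int (1 + u * u) * ee (eps a) \<in> supp_ge ?l 1"
    "of_int u * ee (eps a + eps a) \<in> supp_ge ?l 1"
    using supp_ge_mult[OF l supp_ge_of_int[OF l] supp_ge_ee, of 1 "eps a" "1 + u * u"]
      supp_ge_mult[OF l supp_ge_of_int[OF l] supp_ge_ee, of 1 "eps a + eps a" u]
    by (simp_all add: eps_def del: of_int_add of_int_mult)
  ultimately have Y: "ee (eps a) * fps_const (phi u u a) - of_int u \<in> supp_ge ?l 1"
    by (simp add: supp_ge_add del: of_int_add of_int_mult)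
  have P: "(\<Prod>\<alpha>\<in>?S. theta \<alpha>) - 1 \<in> supp_ge ?l 1"
    by (intro prod_theta_sub_1_supp_ge l) (auto simp: eps_def)
  have T: "theta (eps a + eps a) - 1 \<in> supp_ge ?l 1"
    by (intro theta_sub_1_supp_ge l) (auto simp: eps_def)
  \<comment> \<open>The factors in x_a are removed in two applications of \<open>ct_leading\<close>:
    first \<open>phi\<close> and the long root, then the short roots with \<open>Y\<close> equal to
    1.\<close>
  have "ct ((ee (eps a) * fps_const (phi u u a)) *
      (theta (eps a + eps a) * ((\<Prod>\<alpha>\<in>?S. theta \<alpha>) * hall roots_C (Suc a) b u u))) =
    of_int u * ct ((\<Prod>\<alpha>\<in>?S. theta \<alpha>) * hall roots_C (Suc a) b u u)"
    by (intro ct_leading[OF l Y T] supp_ge_mult_0 l hall_supp_ge_0 supp_ge_prod supp_ge_theta) (auto simp: eps_def)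
  also have "ct ((\<Prod>\<alpha>\<in>?S. theta \<alpha>) * hall roots_C (Suc a) b u u) = LC (Suc a) b u"
    using ct_leading[OF l _ P hall_supp_ge_0(1)[of a "Suc a" b roots_C u u], of 1 1] by (simp add: LC_def)
  finally have "Z = of_int u * LC (Suc a) b u"
    unfolding Z_def g_def hall_C_left[OF assms] by (simp only: mult.assoc)
  then show ?thesis using 1 by (simp only: m_def g_def h_def)
qed

text \<open>The Rogers-Szego polynomials, that is, the sums of the powers of z weighted by Gaussian
  binomial coefficients, given by their three-term recurrence.\<close>

fun rs_poly :: "'a :: comm_ring_1 \<Rightarrow> 'a \<Rightarrow> nat \<Rightarrow> 'a" where
  "rs_poly q z 0 = 1"
| "rs_poly q z (Suc 0) = 1 + z"
| "rs_poly q z (Suc (Suc m)) = (1 + z) * rs_poly q z (Suc m) - (1 - q ^ Suc m) * z * rs_poly q z m"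

lemma LA_recurrence:
  assumes "a < b"
  shows "LA a b u v = of_int (1 + u * v) * LA (Suc a) b u v +
    of_int u * ((fps_X - 1) * (\<Sum>j = Suc a..<b. ct (ee (- eps j) * hall roots_A (Suc a) b u v)))"
proof -
  have inj: "inj_on (\<lambda>j. eps a - eps j) {a<..<b}"
    by (auto simp: inj_on_def eps_diff_eq_iff)
  have "LA a b u v = of_int (1 + u * v) * ct (hall roots_A (Suc a) b u v) + of_int u * ((fps_X - 1) *
      (\<Sum>\<alpha>\<in>(\<lambda>j. eps a - eps j) ` {a<..<b}. ct (ee (\<alpha> - eps a) * hall roots_A (Suc a) b u v)))"
    unfolding LA_def hall_A_left[OF assms]
    by (rule ct_peel) (auto simp: eps_def intro!: hall_supp_ge_0)
  also have "(\<Sum>\<alpha>\<in>(\<lambda>j. eps a - eps j) ` {a<..<b}. ct (ee (\<alpha> - eps a) * hall roots_A (Suc a) b u v)) =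
      (\<Sum>j = Suc a..<b. ct (ee (- eps j) * hall roots_A (Suc a) b u v))"
    unfolding sum.reindex[OF inj] o_def atLeastSucLessThan_greaterThanLessThan by simp
  finally show ?thesis by (simp only: LA_def)
qed

text \<open>The roots eps a - eps j and eps a + eps j leave the monomials 1 / x_j and x_j. The long
  root 2 eps a has level 2 in x_a and is the \<open>E\<close> of \<open>ct_peel\<close>, so it
  leaves no trace.\<close>

lemma LC_recurrence:
  assumes "a < b"
  shows "LC a b u = of_int (1 + u * u) * LC (Suc a) b u +
    of_int u * ((fps_X - 1) * (\<Sum>j = Suc a..<b. ct (ee (eps j) * hall roots_C (Suc a) b u u) +
      ct (ee (- eps j) * hall roots_C (Suc a) b u u)))"
proof -
  let ?S1 = "(\<lambda>j. eps a - eps j) ` {a<..<b}" and ?S2 = "(\<lambda>j. eps a + eps j) ` {a<..<b}"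
  have inj: "inj_on (\<lambda>j. eps a - eps j) {a<..<b}"
    by (auto simp: inj_on_def eps_diff_eq_iff)
  have inj2: "inj_on (\<lambda>j. eps a + eps j) {a<..<b}"
  proof (rule inj_onI)
    fix i j assume "eps a + eps i = eps a + eps j"
    then show "i = j" by (auto simp: eps_def fun_eq_iff split: if_splits)
  qed
  have disj: "?S1 \<inter> ?S2 = {}"
  proof -
    have "eps a - eps i \<noteq> eps a + eps j" for i j
      by (auto simp: eps_def fun_eq_iff)
    then show ?thesis by blast
  qed
  have "LC a b u = of_int (1 + u * u) * ct (hall roots_C (Suc a) b u u) + of_int u * ((fps_X - 1) *
      (\<Sum>\<alpha>\<in>?S1 \<union> ?S2. ct (ee (\<alpha> - eps a) * hall roots_C (Suc a) b u u)))"
    unfolding LC_def hall_C_left[OF assms]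
    by (rule ct_peel) (auto simp: eps_def intro!: hall_supp_ge_0 theta_sub_1_supp_ge additive_coord)
  also have "(\<Sum>\<alpha>\<in>?S1 \<union> ?S2. ct (ee (\<alpha> - eps a) * hall roots_C (Suc a) b u u)) =
      (\<Sum>\<alpha>\<in>?S1. ct (ee (\<alpha> - eps a) * hall roots_C (Suc a) b u u)) +
      (\<Sum>\<alpha>\<in>?S2. ct (ee (\<alpha> - eps a) * hall roots_C (Suc a) b u u))"
    by (intro sum.union_disjoint disj) auto
  also have "\<dots> = (\<Sum>j = Suc a..<b. ct (ee (eps j) * hall roots_C (Suc a) b u u) +
      ct (ee (- eps j) * hall roots_C (Suc a) b u u))"
    unfolding sum.reindex[OF inj] sum.reindex[OF inj2] o_def atLeastSucLessThan_greaterThanLessThan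
    by (simp add: sum.distrib)
  finally show ?thesis by (simp only: LC_def)
qed

text \<open>The factor t - 1 from \<open>LA_recurrence\<close> telescopes the geometric sum from
  \<open>ct_sum_A\<close>. The left end \<open>a\<close> is generalized because peeling moves it;
  only the length of the interval matters.\<close>

lemma LA_eq_rs_poly: "LA a (a + m) u v = rs_poly fps_X (of_int (u * v)) m"
proof (induction m arbitrary: a rule: induct_nat_012)
  case 0
  then show ?case by (simp add: LA_def hall_empty)
next
  case 1
  then show ?case using LA_recurrence[of a "Suc a" u v] by (simp add: LA_def hall_empty)
next
  case (ge2 m)
  define s where "s = (\<Sum>i<Suc m. fps_X ^ i :: int fps)"
  have "(fps_X - 1) * s = fps_X ^ Suc m - 1"
    unfolding s_def by (rule power_diff_1_eq[symmetric])
  moreover have "LA (Suc a) (a + Suc (Suc m)) u v = rs_poly fps_X (of_int (u * v)) (Suc m)"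
    "LA (Suc a) (a + Suc m) u v = rs_poly fps_X (of_int (u * v)) m"
    using ge2[of "Suc a"] by simp_all
  moreover have "LA a (a + Suc (Suc m)) u v = of_int (1 + u * v) * LA (Suc a) (a + Suc (Suc m)) u v +
      of_int u * ((fps_X - 1) * (s * (of_int v * LA (Suc a) (a + Suc m) u v)))"
    using LA_recurrence[of a "a + Suc (Suc m)" u v] ct_sum_A[of "Suc a" "a + Suc m" u v]
    by (simp add: s_def)
  moreover have "(fps_X - 1) * (s * (of_int v * R)) = of_int v * (((fps_X - 1) * s) * R)" for R
    by (simp only: mult_ac)
  ultimately have "LA a (a + Suc (Suc m)) u v = of_int (1 + u * v) * rs_poly fps_X (of_int (u * v)) (Suc m) +
      of_int u * (of_int v * ((fps_X ^ Suc m - 1) * rs_poly fps_X (of_int (u * v)) m))"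
    by simp
  then show ?case
    by (simp add: algebra_simps)
qed

text \<open>As in type A, except that the sum from \<open>ct_sum_C\<close> has 2 (m + 1) terms and
  telescopes to a power of t^2, and that both variables are removed on the left.\<close>

lemma LC_eq_rs_poly: "LC a (a + m) u = rs_poly (fps_X ^ 2) (of_int (u * u)) m"
proof (induction m arbitrary: a rule: induct_nat_012)
  case 0
  then show ?case by (simp add: LC_def hall_empty)
next
  case 1
  then show ?case using LC_recurrence[of a "Suc a" u] by (simp add: LC_def hall_empty)
next
  case (ge2 m)
  define s where "s = (\<Sum>i<2 * Suc m. fps_X ^ i :: int fps)"
  have "(fps_X - 1) * s = (fps_X ^ 2) ^ Suc m - 1"
    unfolding s_def power_mult[symmetric] by (rule power_diff_1_eq[symmetric])
  moreover have "LC (Suc a) (a + Suc (Suc m)) u = rs_poly (fps_X ^ 2) (of_int (u * u)) (Suc m)"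
    "LC (Suc (Suc a)) (a + Suc (Suc m)) u = rs_poly (fps_X ^ 2) (of_int (u * u)) m"
    using ge2(2)[of "Suc a"] ge2(1)[of "Suc (Suc a)"] by simp_all
  moreover have "LC a (a + Suc (Suc m)) u = of_int (1 + u * u) * LC (Suc a) (a + Suc (Suc m)) u +
      of_int u * ((fps_X - 1) * (s * (of_int u * LC (Suc (Suc a)) (a + Suc (Suc m)) u)))"
    using LC_recurrence[of a "a + Suc (Suc m)" u] ct_sum_C[of "Suc a" "a + Suc (Suc m)" u]
    by (simp add: s_def)
  moreover have "(fps_X - 1) * (s * (of_int u * R)) = of_int u * (((fps_X - 1) * s) * R)" for R
    by (simp only: mult_ac)
  ultimately have "LC a (a + Suc (Suc m)) u = of_int (1 + u * u) * rs_poly (fps_X ^ 2) (of_int (u * u)) (Suc m) +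
      of_int u * (of_int u * (((fps_X ^ 2) ^ Suc m - 1) * rs_poly (fps_X ^ 2) (of_int (u * u)) m))"
    by simp
  then show ?case
    by (simp add: algebra_simps)
qed

text \<open>Both sides obey the same recurrence once t is replaced by t^2 in type A. The parameters
  u^2 and 1 are chosen to have product u^2.\<close>

lemma LC_eq_LA_compose: "LC a (a + m) u = LA a (a + m) (u * u) 1 oo fps_X ^ 2"
proof -
  have "rs_poly fps_X (of_int z) m oo fps_X ^ 2 = rs_poly (fps_X ^ 2) (of_int z :: int fps) m" for z
  proof (induction m rule: induct_nat_012)
    case (ge2 m)
    have z: "of_int z oo fps_X ^ 2 = (of_int z :: int fps)"
      by (simp flip: fps_of_int)
    have X: "fps_X ^ Suc m oo fps_X ^ 2 = (fps_X ^ 2 :: int fps) ^ Suc m"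
      by (subst fps_compose_power[symmetric]) (simp_all add: fps_X_power_nth)
    show ?case
      using ge2 by (simp add: fps_compose_sub_distrib fps_compose_add_distrib fps_compose_mult_distrib
          X z del: power_Suc)
  qed (simp_all add: fps_compose_add_distrib flip: fps_of_int)
  then show ?thesis
    by (simp only: LC_eq_rs_poly LA_eq_rs_poly mult_1_right)
qed

section \<open>Reflections and the Weyl denominator formula\<close>

lemma dot_add_left: "dot n (x + y) z = dot n x z + dot n y z"
  by (simp add: dot_def distrib_right sum.distrib)

lemma dot_minus_left: "dot n (- x) z = - dot n x z"
  by (simp add: dot_def sum_negf)

lemma dot_diff_left: "dot n (x - y) z = dot n x z - dot n y z"
  by (simp add: dot_def left_diff_distrib sum_subtractf)

lemma dot_commute: "dot n x y = dot n y x"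
  by (simp add: dot_def mult.commute)

lemma dot_sum_left: "dot n (sum f A) z = (\<Sum>a\<in>A. dot n (f a) z)"
proof -
  have "dot n 0 z = 0" by (simp add: dot_def)
  then show ?thesis
    by (induction A rule: infinite_finite_induct) (simp_all add: dot_add_left)
qed

lemma dot_scale_left: "dot n (\<lambda>i. c * x i) z = c * dot n x z"
  by (simp add: dot_def sum_distrib_left mult.assoc)

lemma additive_reflection: "Modules.additive (reflection n \<alpha>)"
  by unfold_locales (simp add: reflection_def fun_eq_iff dot_add_left algebra_simps add_divide_distrib)

lemma reflection_self: "dot n \<alpha> \<alpha> \<noteq> 0 \<Longrightarrow> reflection n \<alpha> \<alpha> = - \<alpha>"
  by (simp add: reflection_def fun_eq_iff)

lemma dot_reflection_left:
  "dot n (reflection n \<alpha> x) y = dot n x y - 2 * dot n x \<alpha> / dot n \<alpha> \<alpha> * dot n \<alpha> y"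
proof -
  have "reflection n \<alpha> x = x - (\<lambda>i. 2 * dot n x \<alpha> / dot n \<alpha> \<alpha> * \<alpha> i)"
    by (simp add: reflection_def fun_eq_iff)
  then show ?thesis by (simp only: dot_diff_left dot_scale_left)
qed

lemma dot_reflection_adjoint: "dot n (reflection n \<alpha> x) y = dot n x (reflection n \<alpha> y)"
  unfolding dot_commute[of n x "reflection n \<alpha> y"] dot_reflection_left
  by (simp add: dot_commute[of n y x] dot_commute[of n y \<alpha>] dot_commute[of n \<alpha> x])

text \<open>For \<alpha> of norm 0 the quotient is 0 by convention and the reflection is the
  identity.\<close>

lemma reflection_reflection: "reflection n \<alpha> (reflection n \<alpha> x) = x"
proof (cases "dot n \<alpha> \<alpha> = 0")
  case False
  then have "dot n (reflection n \<alpha> x) \<alpha> = - dot n x \<alpha>"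
    by (simp add: dot_reflection_left)
  then show ?thesis
    unfolding reflection_def[of n \<alpha> "reflection n \<alpha> x"] by (simp add: reflection_def)
qed (simp add: reflection_def)

lemma inj_reflection: "inj (reflection n \<alpha>)"
  by (metis injI reflection_reflection)

text \<open>The reflection in \<beta> is a self-adjoint linear involution, hence an isometry. It
  carries reflections to reflections by conjugation.\<close>

lemma reflection_conj:
  "reflection n (reflection n \<beta> \<alpha>) = reflection n \<beta> \<circ> (reflection n \<alpha> \<circ> reflection n \<beta>)"
proof
  fix x
  have norm: "dot n (reflection n \<beta> \<alpha>) (reflection n \<beta> \<alpha>) = dot n \<alpha> \<alpha>"
    by (simp add: dot_reflection_adjoint reflection_reflection)
  have adj: "dot n x (reflection n \<beta> \<alpha>) = dot n (reflection n \<beta> x) \<alpha>"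
    by (simp add: dot_reflection_adjoint)
  define c where "c = 2 * dot n (reflection n \<beta> x) \<alpha> / dot n \<alpha> \<alpha>"
  have 1: "reflection n \<alpha> (reflection n \<beta> x) = reflection n \<beta> x - (\<lambda>i. c * \<alpha> i)"
    by (simp add: reflection_def[of n \<alpha>] c_def fun_eq_iff)
  have "reflection n \<beta> (\<lambda>i. c * \<alpha> i) = (\<lambda>i. c * reflection n \<beta> \<alpha> i)"
    by (simp add: reflection_def dot_scale_left fun_eq_iff algebra_simps)
  then have "reflection n \<beta> (reflection n \<alpha> (reflection n \<beta> x)) = x - (\<lambda>i. c * reflection n \<beta> \<alpha> i)"
    unfolding 1 additive.diff[OF additive_reflection] by (simp add: reflection_reflection)
  also have "\<dots> = reflection n (reflection n \<beta> \<alpha>) x"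
    unfolding reflection_def[of n "reflection n \<beta> \<alpha>"] norm adj by (simp add: c_def fun_eq_iff)
  finally show "reflection n (reflection n \<beta> \<alpha>) x =
      (reflection n \<beta> \<circ> (reflection n \<alpha> \<circ> reflection n \<beta>)) x"
    by simp
qed

lemma weyl_group_comp: "v \<in> weyl_group n R \<Longrightarrow> w \<in> weyl_group n R \<Longrightarrow> v \<circ> w \<in> weyl_group n R"
  by (induction v rule: weyl_group.induct) (simp_all add: comp_assoc weyl_group.intros)

lemma reflection_in_weyl_group: "\<alpha> \<in> R \<Longrightarrow> reflection n \<alpha> \<in> weyl_group n R"
  using weyl_group.refl[OF _ weyl_group.id] by fastforce

lemma reflection_conj_in_weyl_group:
  "reflection n \<alpha> \<in> weyl_group n S \<Longrightarrow> \<beta> \<in> S \<Longrightarrow> reflection n (reflection n \<beta> \<alpha>) \<in> weyl_group n S"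
  unfolding reflection_conj
  by (intro weyl_group.refl weyl_group_comp) (auto intro: reflection_in_weyl_group)

lemma weyl_group_subset:
  assumes "\<And>\<alpha>. \<alpha> \<in> R \<Longrightarrow> reflection n \<alpha> \<in> weyl_group n S"
  shows "weyl_group n R \<subseteq> weyl_group n S"
proof
  fix w assume "w \<in> weyl_group n R"
  then show "w \<in> weyl_group n S"
    by induction (intro weyl_group.id, intro weyl_group_comp assms)
qed

lemma weyl_group_mono: "S \<subseteq> R \<Longrightarrow> weyl_group n S \<subseteq> weyl_group n R"
  by (intro weyl_group_subset) (auto intro: reflection_in_weyl_group)

text \<open>With \<open>S\<close> the set of simple roots, this makes the minimum in
  \<open>weyl_length\<close> one over a nonempty set.\<close>

lemma weyl_group_word:
  assumes "w \<in> weyl_group n S"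
  shows "\<exists>as. set as \<subseteq> S \<and> w = foldr (\<lambda>\<alpha> f. reflection n \<alpha> \<circ> f) as id"
  using assms
proof induction
  case id
  show ?case by (rule exI[of _ "[]"]) (simp only: foldr.simps id_apply list.set empty_subsetI)
next
  case (refl \<alpha> w)
  then obtain as where "set as \<subseteq> S" "w = foldr (\<lambda>\<alpha> f. reflection n \<alpha> \<circ> f) as id" by blast
  then have "set (\<alpha> # as) \<subseteq> S \<and> reflection n \<alpha> \<circ> w = foldr (\<lambda>\<alpha> f. reflection n \<alpha> \<circ> f) (\<alpha> # as) id"
    using refl by (simp only: foldr.simps comp_apply[of "(\<circ>) _"] list.set insert_subset)
  then show ?case by (rule exI)
qed

lemma additive_weyl_group: "w \<in> weyl_group n R \<Longrightarrow> Modules.additive w"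
proof (induction rule: weyl_group.induct)
  case (refl \<alpha> w)
  then show ?case
    by (simp add: Modules.additive_def additive.add[OF additive_reflection])
qed (simp add: Modules.additive_def)

lemma inj_weyl_group: "w \<in> weyl_group n R \<Longrightarrow> inj w"
  by (induction rule: weyl_group.induct) (rule inj_on_id, rule inj_compose[OF inj_reflection])

text \<open>The root \<alpha> changes sign and the others are permuted, so the sum of the roots
  loses 2 \<alpha> and its half loses \<alpha>.\<close>

lemma reflection_rho_of_permutes:
  assumes finite_R: "finite R" and a: "\<alpha> \<in> R" and norm: "dot n \<alpha> \<alpha> \<noteq> 0"
    and permute: "reflection n \<alpha> ` (R - {\<alpha>}) = R - {\<alpha>}"
  shows "reflection n \<alpha> (rho R) = rho R - \<alpha>"
proof -
  let ?s = "reflection n \<alpha>"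
  define S where "S = \<Sum>(R - {\<alpha>})"
  have R: "\<Sum>R = \<alpha> + S"
    unfolding S_def using finite_R a by (rule sum.remove)
  have "?s S = (\<Sum>\<beta>\<in>R - {\<alpha>}. ?s \<beta>)"
    unfolding S_def by (rule additive.sum[OF additive_reflection])
  also have "\<dots> = \<Sum>(?s ` (R - {\<alpha>}))"
    by (subst sum.reindex) (auto intro: inj_on_subset[OF inj_reflection])
  finally have S: "?s S = S"
    by (simp only: permute S_def)
  have half: "?s (\<lambda>i. 1 / 2 * x i) = (\<lambda>i. 1 / 2 * ?s x i)" for x
    unfolding reflection_def dot_scale_left by (simp add: fun_eq_iff algebra_simps)
  have "(\<Sum>\<alpha>\<in>R. \<alpha> i) = (\<Sum>R) i" for i
    using finite_R by (induction R rule: finite_induct) auto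
  then have rho: "rho R = (\<lambda>i. 1 / 2 * (\<alpha> + S) i)"
    unfolding rho_def R by simp
  show ?thesis
    unfolding rho half additive.add[OF additive_reflection] S reflection_self[OF norm]
    by (simp add: fun_eq_iff field_simps)
qed

lemma fps_const_sum: "fps_const (sum F I) = (\<Sum>i\<in>I. fps_const (F i :: 'a :: comm_ring_1))"
  by (induction I rule: infinite_finite_induct) (simp_all flip: fps_const_add)

text \<open>What the denominator formula and its consequences require of a root system; both types
  are shown to be instances. The assumption \<open>antidominant\<close> packages the integrality
  argument: a subset sum that is strictly antidominant after subtracting \<rho> is itself
  antidominant.\<close>

locale reflection_data =
  fixes n :: nat and R :: "vec set"
  assumes finite_R: "finite R"
    and finite_W: "finite (weyl_group n R)"
    and generated: "weyl_group n R \<subseteq> weyl_group n (simple_roots R)"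
    and permute: "\<alpha> \<in> simple_roots R \<Longrightarrow> reflection n \<alpha> ` (R - {\<alpha>}) = R - {\<alpha>}"
    and norm: "\<alpha> \<in> R \<Longrightarrow> dot n \<alpha> \<alpha> \<noteq> 0"
    and height: "\<exists>h. \<forall>\<alpha>\<in>R. 0 < dot n h \<alpha>"
    and outside: "\<alpha> \<in> R \<Longrightarrow> i \<notin> {1..n} \<Longrightarrow> \<alpha> i = 0"
    and stabilizer: "w \<in> weyl_group n R \<Longrightarrow> w (rho R) = rho R \<Longrightarrow> w = id"
    and antidominant: "\<Phi> \<subseteq> R \<Longrightarrow> (\<And>\<alpha>. \<alpha> \<in> simple_roots R \<Longrightarrow> dot n \<alpha> (\<Sum>\<Phi> - rho R) < 0)
      \<Longrightarrow> \<beta> \<in> R \<Longrightarrow> dot n \<beta> (\<Sum>\<Phi>) \<le> 0"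
begin

abbreviation "W \<equiv> weyl_group n R"

lemma simple_in_R: "\<alpha> \<in> simple_roots R \<Longrightarrow> \<alpha> \<in> R"
  by (simp add: simple_roots_def)

lemma reflection_rho:
  assumes "\<alpha> \<in> simple_roots R"
  shows "reflection n \<alpha> (rho R) = rho R - \<alpha>"
  using finite_R simple_in_R[OF assms] norm[OF simple_in_R[OF assms]] permute[OF assms]
  by (rule reflection_rho_of_permutes)

text \<open>Normalized by the lowest exponent - \<rho>, to fit a generating product expanded in
  positive roots.\<close>

definition weyl_denominator :: "vec \<Rightarrow>\<^sub>0 int" where
  "weyl_denominator = e_pow (- rho R) * (\<Prod>\<alpha>\<in>R. 1 - e_pow \<alpha>)"

lemma act_simple_weyl_denominator:
  assumes "\<alpha> \<in> simple_roots R"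
  shows "act (reflection n \<alpha>) weyl_denominator = - weyl_denominator"
proof -
  let ?s = "reflection n \<alpha>"
  have a: "\<alpha> \<in> R" using assms by (rule simple_in_R)
  define P where "P = (\<Prod>\<beta>\<in>R - {\<alpha>}. 1 - e_pow \<beta>)"
  have 1: "act ?s (1 - e_pow \<beta>) = 1 - e_pow (?s \<beta>)" for \<beta>
    by (simp add: act_diff act_1 additive_reflection)
  have "act ?s P = (\<Prod>\<beta>\<in>R - {\<alpha>}. 1 - e_pow (?s \<beta>))"
    unfolding P_def by (simp add: act_prod additive_reflection 1)
  also have "\<dots> = (\<Prod>\<beta>\<in>?s ` (R - {\<alpha>}). 1 - e_pow \<beta>)"
    by (subst prod.reindex) (auto intro: inj_on_subset[OF inj_reflection])
  finally have P: "act ?s P = P"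
    by (simp only: permute[OF assms] P_def)
  have D: "weyl_denominator = e_pow (- rho R) * ((1 - e_pow \<alpha>) * P)"
    unfolding weyl_denominator_def P_def by (simp only: prod.remove[OF finite_R a])
  have "act ?s weyl_denominator = e_pow (- (rho R - \<alpha>)) * ((1 - e_pow (- \<alpha>)) * P)"
    unfolding D act_mult[OF additive_reflection] P 1 act_e_pow additive.minus[OF additive_reflection]
      reflection_rho[OF assms] reflection_self[OF norm[OF a]] ..
  also have "\<dots> = e_pow (- rho R) * ((e_pow \<alpha> - e_pow (\<alpha> + - \<alpha>)) * P)"
    by (simp add: algebra_simps flip: e_pow_add)
  also have "\<dots> = - weyl_denominator"
    unfolding D by (simp add: algebra_simps)
  finally show ?thesis .
qed

lemma keys_prod_one_minus:
  assumes "finite S"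
  shows "keys (\<Prod>\<alpha>\<in>S. 1 - e_pow \<alpha>) \<subseteq> Sum ` Pow S"
  using assms
proof (induction S rule: finite_induct)
  case (insert \<alpha> S)
  let ?P = "\<Prod>\<alpha>\<in>S. 1 - e_pow \<alpha>"
  show ?case
  proof
    fix \<beta> assume "\<beta> \<in> keys (\<Prod>\<alpha>\<in>insert \<alpha> S. 1 - e_pow \<alpha>)"
    then have "\<beta> \<in> keys (?P - e_pow \<alpha> * ?P)"
      using insert by (simp add: left_diff_distrib)
    then have "\<beta> \<in> keys ?P \<or> \<beta> - \<alpha> \<in> keys ?P"
      using keys_diff[of ?P "e_pow \<alpha> * ?P"] by (auto simp: in_keys_iff lookup_e_pow_mult lookup_minus)
    then show "\<beta> \<in> Sum ` Pow (insert \<alpha> S)"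
    proof
      assume "\<beta> \<in> keys ?P"
      then show ?thesis using insert.IH by blast
    next
      assume "\<beta> - \<alpha> \<in> keys ?P"
      then obtain \<Phi> where \<Phi>: "\<Phi> \<subseteq> S" "\<beta> - \<alpha> = \<Sum>\<Phi>" using insert.IH by blast
      have "\<alpha> \<notin> \<Phi>" "finite \<Phi>" using \<Phi> insert by (auto intro: finite_subset)
      then have "\<Sum>(insert \<alpha> \<Phi>) = \<alpha> + \<Sum>\<Phi>" by simp
      then have "\<beta> = \<Sum>(insert \<alpha> \<Phi>)" using \<Phi>(2) by (metis add_diff_cancel_left' diff_add_cancel add.commute)
      then show ?thesis using \<Phi>(1) by blast
    qed
  qed
next
  case empty
  have "keys (\<Prod>\<alpha>\<in>{}. 1 - e_pow \<alpha>) = {\<Sum>{}}"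
    by (simp only: prod.empty sum.empty keys_one)
  then show ?case by blast
qed

text \<open>A functional positive on all roots forbids cancellation. Hence the denominator has
  coefficient 1 at - \<rho>, from which signs will be read off.\<close>

lemma sum_subset_eq_0:
  assumes "\<Phi> \<subseteq> R" "\<Sum>\<Phi> = 0"
  shows "\<Phi> = {}"
proof -
  obtain h where h: "\<And>\<alpha>. \<alpha> \<in> R \<Longrightarrow> 0 < dot n h \<alpha>" using height by blast
  have "(\<Sum>\<alpha>\<in>\<Phi>. dot n \<alpha> h) = 0"
    using dot_sum_left[of n "\<lambda>x. x" \<Phi> h] assms(2) by (simp add: dot_def)
  moreover have "finite \<Phi>" using assms finite_R finite_subset by blast
  moreover have "0 < dot n \<alpha> h" if "\<alpha> \<in> \<Phi>" for \<alpha>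
    using h that assms(1) by (simp add: dot_commute subset_iff)
  ultimately show ?thesis
    by (metis less_irrefl sum_pos)
qed

lemma lookup_prod_one_minus_0: "S \<subseteq> R \<Longrightarrow> lookup (\<Prod>\<alpha>\<in>S. 1 - e_pow \<alpha>) 0 = 1"
proof -
  assume S: "S \<subseteq> R"
  then have "finite S" using finite_R by (rule finite_subset)
  then show ?thesis using S
  proof (induction S rule: finite_induct)
    case (insert \<alpha> S)
    let ?P = "\<Prod>\<alpha>\<in>S. 1 - e_pow \<alpha>"
    have "- \<alpha> \<notin> keys ?P"
    proof
      assume "- \<alpha> \<in> keys ?P"
      then obtain \<Phi> where \<Phi>: "\<Phi> \<subseteq> S" "- \<alpha> = \<Sum>\<Phi>" using keys_prod_one_minus[OF insert(1)] by blast
      have "\<alpha> \<notin> \<Phi>" "finite \<Phi>" using \<Phi> insert by (auto intro: finite_subset)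
      then have "\<Sum>(insert \<alpha> \<Phi>) = \<alpha> + \<Sum>\<Phi>" by simp
      then have "\<Sum>(insert \<alpha> \<Phi>) = 0" using \<Phi>(2) by (metis add.right_inverse)
      then show False using sum_subset_eq_0[of "insert \<alpha> \<Phi>"] \<Phi>(1) insert by blast
    qed
    moreover have "lookup ?P 0 = 1"
      using insert by blast
    ultimately have "lookup (?P - e_pow \<alpha> * ?P) 0 = 1"
      by (simp add: lookup_minus lookup_e_pow_mult in_keys_iff)
    then show ?case using insert(1,2) by (simp add: left_diff_distrib del: zero_fun_apply)
  qed (simp del: zero_fun_apply)
qed

lemma lookup_weyl_denominator: "lookup weyl_denominator (- rho R) = 1"
  unfolding weyl_denominator_def lookup_e_pow_mult by (simp add: lookup_prod_one_minus_0)

lemma keys_weyl_denominator: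
  assumes "\<beta> \<in> keys weyl_denominator"
  obtains \<Phi> where "\<Phi> \<subseteq> R" "\<beta> = \<Sum>\<Phi> - rho R"
proof -
  have "\<beta> + rho R \<in> keys (\<Prod>\<alpha>\<in>R. 1 - e_pow \<alpha>)"
    using assms by (simp add: weyl_denominator_def in_keys_iff lookup_e_pow_mult)
  then obtain \<Phi> where "\<Phi> \<subseteq> R" "\<beta> + rho R = \<Sum>\<Phi>"
    using keys_prod_one_minus[OF finite_R] by blast
  then show ?thesis using that by (metis add_diff_cancel_right')
qed

definition sgn_W :: "(vec \<Rightarrow> vec) \<Rightarrow> int" where
  "sgn_W w = (-1) ^ weyl_length n R w"

text \<open>Each letter of a word in simple reflections contributes one sign; a word attaining the
  minimum in \<open>weyl_length\<close> gives the stated sign.\<close>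

lemma act_weyl_denominator:
  assumes "w \<in> W"
  shows "act w weyl_denominator = of_int (sgn_W w) * weyl_denominator"
proof -
  let ?P = "\<lambda>k. \<exists>as. length as = k \<and> set as \<subseteq> simple_roots R
                  \<and> w = foldr (\<lambda>\<alpha> f. reflection n \<alpha> \<circ> f) as id"
  have "\<exists>as. set as \<subseteq> simple_roots R \<and> w = foldr (\<lambda>\<alpha> f. reflection n \<alpha> \<circ> f) as id"
    using assms generated by (intro weyl_group_word) auto
  then have "\<exists>k. ?P k" by blast
  then have "?P (weyl_length n R w)"
    unfolding weyl_length_def by (rule LeastI_ex)
  then obtain as where as: "length as = weyl_length n R w" "set as \<subseteq> simple_roots R"
      "w = foldr (\<lambda>\<alpha> f. reflection n \<alpha> \<circ> f) as id" by blast
  have pow: "act (reflection n \<alpha>) ((-1) ^ k * F) = (-1) ^ k * act (reflection n \<alpha>) F" for \<alpha> k F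
    using act_of_int_mult[of "reflection n \<alpha>" "(-1) ^ k" F] by simp
  have "act (foldr (\<lambda>\<alpha> f. reflection n \<alpha> \<circ> f) as id) weyl_denominator =
      (-1) ^ length as * weyl_denominator" if "set as \<subseteq> simple_roots R" for as
    using that
  proof (induction as)
    case Nil
    show ?case by (simp only: foldr.simps(1) id_apply[of id] act_id list.size power_0 mult_1_left)
  next
    case (Cons \<alpha> as)
    define w where "w = foldr (\<lambda>\<alpha> f. reflection n \<alpha> \<circ> f) as id"
    have "act w weyl_denominator = (-1) ^ length as * weyl_denominator" "\<alpha> \<in> simple_roots R"
      using Cons by (auto simp only: w_def list.set)
    then have "act (reflection n \<alpha> \<circ> w) weyl_denominator = (-1) ^ length (\<alpha> # as) * weyl_denominator"
      unfolding act_comp by (simp add: pow act_simple_weyl_denominator)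
    then show ?case
      by (simp only: foldr.simps comp_apply[of "(\<circ>) _"] w_def)
  qed
  then show ?thesis
    unfolding sgn_W_def as(1)[symmetric] using as(2,3) by simp
qed

text \<open>Comparison of coefficients at - \<rho>. Signs of products can thus be found by acting on
  the denominator, without any study of the parity of lengths.\<close>

lemma sgn_W_unique:
  assumes "w \<in> W" "act w weyl_denominator = of_int c * weyl_denominator"
  shows "sgn_W w = c"
proof -
  have "lookup (of_int (sgn_W w) * weyl_denominator) (- rho R) = lookup (of_int c * weyl_denominator) (- rho R)"
    using assms act_weyl_denominator by simp
  then show ?thesis
    by (simp only: lookup_of_int_mult lookup_weyl_denominator mult_1_right)
qed

lemma sgn_W_id: "sgn_W id = 1"
  by (rule sgn_W_unique) (rule weyl_group.id, simp only: act_id of_int_1 mult_1_left)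

lemma simple_in_W: "\<alpha> \<in> simple_roots R \<Longrightarrow> reflection n \<alpha> \<in> W"
  by (intro reflection_in_weyl_group simple_in_R)

lemma sgn_W_comp_simple:
  assumes "w \<in> W" "\<alpha> \<in> simple_roots R"
  shows "sgn_W (w \<circ> reflection n \<alpha>) = - sgn_W w" "sgn_W (reflection n \<alpha> \<circ> w) = - sgn_W w"
  using assms
  by (auto intro!: sgn_W_unique weyl_group_comp simple_in_W
      simp: act_comp act_simple_weyl_denominator act_minus act_weyl_denominator act_of_int_mult)

definition alt :: "(vec \<Rightarrow>\<^sub>0 int) \<Rightarrow> (vec \<Rightarrow>\<^sub>0 int)" where
  "alt F = (\<Sum>w\<in>W. of_int (sgn_W w) * act w F)"

lemma alt_diff: "alt (F - G) = alt F - alt G"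
  by (simp add: alt_def act_diff right_diff_distrib sum_subtractf)

text \<open>Right multiplication by a simple reflection is an involution of \<open>W\<close> that
  reverses all signs; \<open>act_simple_alt\<close> uses left multiplication in the same
  way.\<close>

lemma alt_act_simple:
  assumes "\<alpha> \<in> simple_roots R"
  shows "alt (act (reflection n \<alpha>) F) = - alt F"
proof -
  let ?s = "reflection n \<alpha>"
  have ss: "w \<circ> ?s \<circ> ?s = w" for w :: "vec \<Rightarrow> vec" by (simp add: fun_eq_iff reflection_reflection)
  have "alt (act ?s F) = (\<Sum>w\<in>W. - (of_int (sgn_W (w \<circ> ?s)) * act (w \<circ> ?s) F))"
    unfolding alt_def using assms by (intro sum.cong) (simp_all add: sgn_W_comp_simple act_comp)
  also have "\<dots> = (\<Sum>w\<in>W. - (of_int (sgn_W w) * act w F))"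
    by (rule sum.reindex_bij_witness[of _ "\<lambda>w. w \<circ> ?s" "\<lambda>w. w \<circ> ?s"])
       (use assms in \<open>auto intro!: weyl_group_comp simple_in_W simp: ss\<close>)
  finally show ?thesis by (simp add: alt_def sum_negf)
qed

lemma act_simple_alt:
  assumes "\<alpha> \<in> simple_roots R"
  shows "act (reflection n \<alpha>) (alt F) = - alt F"
proof -
  let ?s = "reflection n \<alpha>"
  have ss: "?s \<circ> (?s \<circ> w) = w" for w by (simp add: fun_eq_iff reflection_reflection)
  have "act ?s (alt F) = (\<Sum>w\<in>W. - (of_int (sgn_W (?s \<circ> w)) * act (?s \<circ> w) F))"
    unfolding alt_def act_sum using assms
    by (intro sum.cong) (simp_all add: sgn_W_comp_simple act_comp act_of_int_mult)
  also have "\<dots> = (\<Sum>w\<in>W. - (of_int (sgn_W w) * act w F))"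
    by (rule sum.reindex_bij_witness[of _ "\<lambda>w. ?s \<circ> w" "\<lambda>w. ?s \<circ> w"])
       (use assms in \<open>auto intro!: weyl_group_comp simple_in_W simp: ss\<close>)
  finally show ?thesis by (simp add: alt_def sum_negf)
qed

text \<open>Take an exponent \<beta> minimizing the pairing with \<rho>. Its reflection is again an
  exponent, and the pairing changes by - dot n \<alpha> \<beta>, so this inner product is at most 0.
  It is not 0, since a fixed exponent has coefficient 0 in a skew element.\<close>

lemma skew_has_antidominant_key:
  assumes skew: "\<And>\<alpha>. \<alpha> \<in> simple_roots R \<Longrightarrow> act (reflection n \<alpha>) F = - F" and "F \<noteq> 0"
  obtains \<beta> where "\<beta> \<in> keys F" "\<And>\<alpha>. \<alpha> \<in> simple_roots R \<Longrightarrow> dot n \<alpha> \<beta> < 0"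
proof -
  have "keys F \<noteq> {}" using assms(2) by simp
  then obtain \<beta> where \<beta>: "\<beta> \<in> keys F" "\<And>\<gamma>. \<gamma> \<in> keys F \<Longrightarrow> dot n (rho R) \<beta> \<le> dot n (rho R) \<gamma>"
    using arg_min_if_finite[of "keys F" "dot n (rho R)"] finite_keys by (metis not_le_imp_less)
  have "dot n \<alpha> \<beta> < 0" if a: "\<alpha> \<in> simple_roots R" for \<alpha>
  proof -
    let ?s = "reflection n \<alpha>"
    have L: "lookup F \<beta> = - lookup F (?s \<beta>)"
      using lookup_act[OF inj_reflection, of n \<alpha> F \<beta>] skew[OF a] by simp
    then have "?s \<beta> \<in> keys F" using \<beta>(1) by (simp add: in_keys_iff)
    then have "dot n (rho R) \<beta> \<le> dot n (rho R) (?s \<beta>)" by (rule \<beta>(2))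
    also have "\<dots> = dot n (rho R) \<beta> - dot n \<alpha> \<beta>"
      by (simp add: dot_reflection_adjoint[symmetric] reflection_rho[OF a] dot_diff_left)
    finally have "dot n \<alpha> \<beta> \<le> 0" by simp
    moreover have "dot n \<alpha> \<beta> \<noteq> 0"
    proof
      assume "dot n \<alpha> \<beta> = 0"
      then have "?s \<beta> = \<beta>" by (simp add: reflection_def dot_commute)
      then show False using L \<beta>(1) by (simp add: in_keys_iff)
    qed
    ultimately show ?thesis by simp
  qed
  with \<beta>(1) show ?thesis by (rule that)
qed

text \<open>Write \<beta> = \<gamma> - \<rho> with \<gamma> the sum of a set of roots. By
  \<open>antidominant\<close> each of these roots pairs nonpositively with \<gamma>, so \<gamma> has
  nonpositive square norm and vanishes.\<close>

lemma antidominant_key_weyl_denominator: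
  assumes "\<beta> \<in> keys weyl_denominator" "\<And>\<alpha>. \<alpha> \<in> simple_roots R \<Longrightarrow> dot n \<alpha> \<beta> < 0"
  shows "\<beta> = - rho R"
proof -
  obtain \<Phi> where \<Phi>: "\<Phi> \<subseteq> R" "\<beta> = \<Sum>\<Phi> - rho R"
    using assms(1) by (rule keys_weyl_denominator)
  define \<gamma> where "\<gamma> = \<Sum>\<Phi>"
  have fin: "finite \<Phi>" using \<Phi>(1) finite_R by (rule finite_subset)
  have "dot n \<gamma> \<gamma> = (\<Sum>\<alpha>\<in>\<Phi>. dot n \<alpha> \<gamma>)"
    using dot_sum_left[of n "\<lambda>x. x" \<Phi> \<gamma>] by (simp only: \<gamma>_def)
  also have "\<dots> \<le> 0"
    using antidominant[OF \<Phi>(1) assms(2)[unfolded \<Phi>(2)]] \<Phi>(1) unfolding \<gamma>_def by (intro sum_nonpos) auto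
  finally have le: "dot n \<gamma> \<gamma> \<le> 0" .
  \<comment> \<open>The inner product controls only the coordinates in \<open>{1..n}\<close>; the
    others vanish by \<open>outside\<close>.\<close>
  have "\<gamma> i = 0" for i
  proof (cases "i \<in> {1..n}")
    case True
    have "(\<gamma> i)\<^sup>2 \<le> (\<Sum>i = 1..n. (\<gamma> i)\<^sup>2)"
      using True by (intro member_le_sum) auto
    also have "\<dots> \<le> 0" using le by (simp add: dot_def power2_eq_square)
    finally show ?thesis by simp
  next
    case False
    then have "\<alpha> i = 0" if "\<alpha> \<in> \<Phi>" for \<alpha>
      using outside \<Phi>(1) that by blast
    then have "(\<Sum>\<alpha>\<in>\<Phi>. \<alpha> i) = 0"
      by (intro sum.neutral) blast
    moreover have "(\<Sum>\<Phi>) i = (\<Sum>\<alpha>\<in>\<Phi>. \<alpha> i)"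
      using fin by (induction \<Phi> rule: finite_induct) auto
    ultimately show ?thesis by (simp add: \<gamma>_def)
  qed
  then have "\<gamma> = 0" by (simp add: fun_eq_iff)
  then show ?thesis using \<Phi>(2) by (simp add: \<gamma>_def)
qed

text \<open>The Weyl denominator formula. A nonzero difference of the two sides is skew and so has a
  strictly antidominant exponent. All exponents on the left occur in the denominator, so this
  exponent is - \<rho>, where both sides have coefficient 1.\<close>

lemma alt_rho: "alt (e_pow (- rho R)) = weyl_denominator"
proof (rule ccontr)
  define E where "E = alt (e_pow (- rho R)) - weyl_denominator"
  assume "alt (e_pow (- rho R)) \<noteq> weyl_denominator"
  then have "E \<noteq> 0" by (simp add: E_def)
  moreover have "act (reflection n \<alpha>) E = - E" if "\<alpha> \<in> simple_roots R" for \<alpha>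
    using that by (simp add: E_def act_diff act_simple_alt act_simple_weyl_denominator)
  ultimately obtain \<beta> where \<beta>: "\<beta> \<in> keys E" "\<And>\<alpha>. \<alpha> \<in> simple_roots R \<Longrightarrow> dot n \<alpha> \<beta> < 0"
    using skew_has_antidominant_key by blast
  have orbit: "w (- rho R) \<in> keys weyl_denominator" if "w \<in> W" for w
  proof -
    have "lookup (act w weyl_denominator) (w (- rho R)) = 1"
      using lookup_act[OF inj_weyl_group[OF that]] lookup_weyl_denominator by simp
    then have "sgn_W w * lookup weyl_denominator (w (- rho R)) = 1"
      by (simp only: act_weyl_denominator[OF that] lookup_of_int_mult)
    then show ?thesis by (auto simp: in_keys_iff)
  qed
  have lookup_alt: "lookup (alt (e_pow (- rho R))) \<gamma> = (\<Sum>w\<in>W. sgn_W w * (if \<gamma> = w (- rho R) then 1 else 0))" for \<gamma>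
    unfolding alt_def lookup_sum lookup_of_int_mult act_e_pow lookup_e_pow ..
  have "\<beta> \<in> keys weyl_denominator"
  proof (rule ccontr)
    assume *: "\<beta> \<notin> keys weyl_denominator"
    then have "lookup (alt (e_pow (- rho R))) \<beta> = 0"
      unfolding lookup_alt using orbit by (intro sum.neutral) auto
    then show False using \<beta>(1) * by (simp add: E_def in_keys_iff lookup_minus)
  qed
  then have \<beta>_rho: "\<beta> = - rho R"
    using \<beta>(2) by (rule antidominant_key_weyl_denominator)
  \<comment> \<open>Only the identity fixes \<rho>, so a single group element contributes.\<close>
  have "lookup (alt (e_pow (- rho R))) (- rho R) = (\<Sum>w\<in>W. if w = id then 1 else 0)"
    unfolding lookup_alt
  proof (rule sum.cong)
    fix w assume w: "w \<in> W"
    have "- rho R = w (- rho R) \<longleftrightarrow> w = id"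
      using stabilizer[OF w] additive.minus[OF additive_weyl_group[OF w], of "rho R"] by auto
    then show "sgn_W w * (if - rho R = w (- rho R) then 1 else 0) = (if w = id then 1 else 0)"
      by (auto simp: sgn_W_id)
  qed simp
  also have "\<dots> = 1"
    using finite_W by (simp add: weyl_group.id)
  finally have "lookup E (- rho R) = 0"
    by (simp add: E_def lookup_minus lookup_weyl_denominator)
  then show False using \<beta>(1) \<beta>_rho by (simp add: in_keys_iff)
qed

text \<open>
  Weights enter with the opposite sign: \<open>\<nu>\<close> is represented by \<open>e\<^bsup>-\<nu>\<^esup>\<close>, because \<open>P\<^sub>t(\<beta>)\<close> is the constant
  term of \<open>e\<^bsup>-\<beta>\<^esup>\<close> times the generating product.
\<close>

definition pairing :: "(vec \<Rightarrow>\<^sub>0 int) \<Rightarrow> int fps" where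
  "pairing F = ct (fps_const (alt (F * e_pow (- rho R)) * e_pow (rho R)) * (\<Prod>\<alpha>\<in>R. geom_series \<alpha>))"

lemma pairing_diff: "pairing (F - G) = pairing F - pairing G"
  by (simp add: pairing_def left_diff_distrib alt_diff ct_diff flip: fps_const_sub)

lemma pairing_0: "pairing 0 = 0"
  using pairing_diff[of 0 0] by simp

lemma pairing_add: "pairing (F + G) = pairing F + pairing G"
  using pairing_diff[of F "0 - G"] pairing_diff[of 0 G] by (simp add: pairing_0)

lemma pairing_of_int_mult: "pairing (of_int c * F) = of_int c * pairing F"
proof -
  have nat: "pairing (of_nat k * F) = of_nat k * pairing F" for k
    by (induction k) (simp_all add: pairing_0 pairing_add distrib_right)
  obtain k m where c: "c = int k - int m"
    by (metis int_diff_cases)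
  show ?thesis
    by (simp add: c left_diff_distrib pairing_diff nat)
qed

lemma pairing_e_pow: "pairing (e_pow (- \<nu>)) = gen_exponent n R \<nu>"
proof -
  let ?G = "\<Prod>\<alpha>\<in>R. geom_series \<alpha>"
  have "alt (e_pow (- \<nu>) * e_pow (- rho R)) * e_pow (rho R) =
      (\<Sum>w\<in>W. of_int (sgn_W w) * e_pow (- (w (\<nu> + rho R) - rho R)))"
  proof -
    have "e_pow (- \<nu>) * e_pow (- rho R) = e_pow (- (\<nu> + rho R))"
      by (simp add: algebra_simps flip: e_pow_add)
    moreover have "act w (e_pow (- (\<nu> + rho R))) * e_pow (rho R) = e_pow (- (w (\<nu> + rho R) - rho R))"
      if "w \<in> W" for w
      by (simp add: additive.minus[OF additive_weyl_group[OF that]] del: minus_add_distrib flip: e_pow_add)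
    ultimately show ?thesis
      by (simp add: alt_def sum_distrib_right mult.assoc)
  qed
  then have "pairing (e_pow (- \<nu>)) =
      ct (\<Sum>w\<in>W. of_int (sgn_W w) * (ee (- (w (\<nu> + rho R) - rho R)) * ?G))"
    unfolding pairing_def
    by (simp add: sum_distrib_right mult.assoc fps_const_sum flip: fps_of_int fps_const_mult)
  also have "\<dots> = (\<Sum>w\<in>W. of_int (sgn_W w) * ct (ee (- (w (\<nu> + rho R) - rho R)) * ?G))"
    by (simp only: ct_sum ct_of_int_mult)
  also have "\<dots> = gen_exponent n R \<nu>"
    unfolding gen_exponent_def kostant_partition_eq_ct sgn_W_def by simp
  finally show ?thesis .
qed

text \<open>The straightening rule: \<open>gen_exponent\<close> is taken at arbitrary weights and is
  skew for the action shifted by \<rho>.\<close>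

lemma gen_exponent_skew:
  assumes "\<alpha> \<in> simple_roots R" "reflection n \<alpha> (\<nu> + rho R) = \<nu>' + rho R"
  shows "gen_exponent n R \<nu>' = - gen_exponent n R \<nu>"
proof -
  have e: "e_pow (- \<nu>) * e_pow (- rho R) = e_pow (- (\<nu> + rho R))" for \<nu>
    by (simp add: algebra_simps flip: e_pow_add)
  have "alt (e_pow (- \<nu>') * e_pow (- rho R)) = - alt (e_pow (- \<nu>) * e_pow (- rho R))"
    using alt_act_simple[OF assms(1), of "e_pow (- (\<nu> + rho R))"]
    unfolding e act_e_pow additive.minus[OF additive_reflection] assms(2) .
  then have "pairing (e_pow (- \<nu>')) = - pairing (e_pow (- \<nu>))"
    by (simp add: pairing_def ct_minus flip: fps_const_neg)
  then show ?thesis by (simp add: pairing_e_pow)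
qed

text \<open>An invariant \<open>F\<close> can be pulled out of the alternating sum. What remains is
  the denominator formula, whose product turns each geometric series into
  \<open>theta\<close>.\<close>

lemma pairing_symmetric:
  assumes "\<And>\<alpha>. \<alpha> \<in> simple_roots R \<Longrightarrow> act (reflection n \<alpha>) F = F"
  shows "pairing F = ct (fps_const F * (\<Prod>\<alpha>\<in>R. theta \<alpha>))"
proof -
  have "act w F = F" if "w \<in> W" for w
  proof -
    have "w \<in> weyl_group n (simple_roots R)" using that generated by blast
    then show ?thesis by induction (simp_all add: act_comp assms del: id_apply comp_apply)
  qed
  then have "alt (F * e_pow (- rho R)) = F * alt (e_pow (- rho R))"
    by (simp add: alt_def act_mult additive_weyl_group sum_distrib_left mult.left_commute)
  then have "alt (F * e_pow (- rho R)) * e_pow (rho R) = F * (\<Prod>\<alpha>\<in>R. 1 - e_pow \<alpha>)"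
    unfolding alt_rho weyl_denominator_def by (simp add: mult_ac flip: e_pow_add) (simp flip: mult.assoc e_pow_add)
  moreover have "(\<Prod>\<alpha>\<in>R. theta \<alpha>) = fps_const (\<Prod>\<alpha>\<in>R. 1 - e_pow \<alpha>) * (\<Prod>\<alpha>\<in>R. geom_series \<alpha>)"
    unfolding theta_def prod.distrib fps_const_prod by (simp flip: fps_const_sub)
  ultimately show ?thesis
    unfolding pairing_def by (simp add: mult.assoc flip: fps_const_mult)
qed

end

section \<open>Straightening\<close>

lemma sum_eq_first_two:
  fixes f :: "nat \<Rightarrow> 'a :: comm_monoid_add"
  assumes "0 < n" "\<And>a. 2 \<le> a \<Longrightarrow> a \<le> n \<Longrightarrow> f a = 0"
  shows "(\<Sum>a\<le>n. f a) = f 0 + f 1"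
proof -
  have "(\<Sum>a\<le>n. f a) = (\<Sum>a\<in>{0, 1}. f a)"
    using assms by (intro sum.mono_neutral_right) (auto simp: numeral_2_eq_2 not_less_eq_eq[symmetric] le_Suc_eq)
  then show ?thesis by simp
qed

definition geom_sum :: "int \<Rightarrow> nat \<Rightarrow> int" where
  "geom_sum z r = (\<Sum>i<r. z ^ i)"

lemma geom_sum_0 [simp]: "geom_sum z 0 = 0"
  by (simp add: geom_sum_def)

lemma geom_sum_1 [simp]: "geom_sum z (Suc 0) = 1"
  by (simp add: geom_sum_def)

text \<open>The recurrence with characteristic roots 1 and z, which the three terms of
  \<open>phi\<close> reproduce in \<open>pairing_straighten\<close>.\<close>

lemma geom_sum_Suc_Suc: "geom_sum z (Suc (Suc r)) = (1 + z) * geom_sum z (Suc r) - z * geom_sum z r"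
  by (simp add: geom_sum_def algebra_simps)

text \<open>The shape of weights left by straightening: ones right after position k, entries -1 at
  the end, zeros between. Writing \<open>n < i + b\<close> avoids truncated subtraction.\<close>

definition tail_weight :: "nat \<Rightarrow> nat \<Rightarrow> nat \<Rightarrow> nat \<Rightarrow> vec" where
  "tail_weight n k a b = (\<lambda>i. if k < i \<and> i \<le> k + a then 1 else if n < i + b \<and> i \<le> n then -1 else 0)"

text \<open>The rule for the shifted action of an adjacent transposition, in coordinates. The shifts
  by 1 reflect that \<rho> drops by 1 from each coordinate to the next in both types.\<close>

locale straightening =
  fixes n :: nat and S :: "vec \<Rightarrow> int fps"
  assumes swap: "1 \<le> j \<Longrightarrow> j < n \<Longrightarrow> \<nu>' j = \<nu> (Suc j) - 1 \<Longrightarrow> \<nu>' (Suc j) = \<nu> j + 1 \<Longrightarrow>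
      (\<And>i. i \<noteq> j \<Longrightarrow> i \<noteq> Suc j \<Longrightarrow> \<nu>' i = \<nu> i) \<Longrightarrow> S \<nu>' = - S \<nu>"
begin

text \<open>The shifted transposition fixes such a weight.\<close>

lemma ascent_eq_0: "1 \<le> j \<Longrightarrow> j < n \<Longrightarrow> \<nu> (Suc j) = \<nu> j + 1 \<Longrightarrow> S \<nu> = 0"
  using swap[of j \<nu> \<nu>] fps_int_eq_neg_self_iff[of "S \<nu>"] by simp

section \<open>The effect of placing 1, 0 or -1 in front of a tail\<close>

context
  fixes k m :: nat and \<nu> :: vec
  assumes km: "k + Suc m = n" and \<nu>: "\<forall>i>k. \<nu> i = 0"
begin

lemma tail_plus:
  "a + b \<le> m \<Longrightarrow> \<nu> + eps (Suc k) + tail_weight n (Suc k) a b = \<nu> + tail_weight n k (Suc a) b"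
  using km by (auto simp: tail_weight_def eps_def fun_eq_iff)

lemma tail_zero: "b \<le> m \<Longrightarrow> tail_weight n (Suc k) 0 b = tail_weight n k 0 b"
  using km by (auto simp: tail_weight_def fun_eq_iff)

lemma tail_zero_ascent: "1 \<le> a \<Longrightarrow> a + b \<le> m \<Longrightarrow> S (\<nu> + tail_weight n (Suc k) a b) = 0"
  using km by (intro ascent_eq_0[of "Suc k"]) (auto simp: tail_weight_def \<nu>)

lemma tail_minus_full:
  "\<nu> - eps (Suc k) + tail_weight n (Suc k) 0 m = \<nu> + tail_weight n k 0 (Suc m)"
  using km by (auto simp: tail_weight_def eps_def fun_eq_iff)

lemma tail_minus_ascent: "b < m \<Longrightarrow> S (\<nu> - eps (Suc k) + tail_weight n (Suc k) 0 b) = 0"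
  using km by (intro ascent_eq_0[of "Suc k"]) (auto simp: tail_weight_def eps_def \<nu>)

text \<open>The shifted transposition turns the adjacent entries -1, 1 into 0, 0.\<close>

lemma tail_minus_1:
  "b < m \<Longrightarrow> S (\<nu> - eps (Suc k) + tail_weight n (Suc k) 1 b) = - S (\<nu> + tail_weight n k 0 b)"
  using km by (intro swap[of "Suc k"]) (auto simp: tail_weight_def eps_def \<nu>)

lemma tail_minus_2:
  assumes "2 \<le> a" "a + b \<le> m"
  shows "S (\<nu> - eps (Suc k) + tail_weight n (Suc k) a b) = 0"
proof -
  let ?\<mu> = "\<nu> - eps (Suc k) + tail_weight n (Suc k) a b"
  \<comment> \<open>The entries -1, 1, 1 become 0, 0, 1, which contain an ascent.\<close>
  let ?\<mu>' = "?\<mu>(Suc k := 0, Suc (Suc k) := 0)"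
  have "S ?\<mu>' = - S ?\<mu>"
    using km assms by (intro swap[of "Suc k"]) (auto simp: tail_weight_def eps_def \<nu>)
  moreover have "S ?\<mu>' = 0"
    using km assms by (intro ascent_eq_0[of "Suc (Suc k)"]) (auto simp: tail_weight_def eps_def \<nu>)
  ultimately show ?thesis by simp
qed

end

text \<open>
  Ranging over all \<open>a, b \<le> n\<close> is harmless because \<open>geom_sum z 0 = 0\<close> kills the terms with
  \<open>a + b > m\<close>, where \<open>tail_weight\<close> has no meaning.
\<close>

lemma pairing_straighten:
  fixes pair :: "(vec \<Rightarrow>\<^sub>0 int) \<Rightarrow> int fps" and u v :: int
  assumes pair_add: "\<And>F G. pair (F + G) = pair F + pair G"
    and pair_of_int: "\<And>c F. pair (of_int c * F) = of_int c * pair F"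
    and pair_e_pow: "\<And>\<nu>. pair (e_pow (- \<nu>)) = S \<nu>"
    and "k + m = n" "\<forall>i>k. \<nu> i = 0"
  shows "pair (e_pow (- \<nu>) * (\<Prod>i = Suc k..<Suc n. phi u v i)) =
    (\<Sum>a\<le>n. \<Sum>b\<le>n. of_int (u ^ a * v ^ b * geom_sum (u * v) (m + 1 - a - b)) * S (\<nu> + tail_weight n k a b))"
  using assms(4,5)
proof (induction m arbitrary: k \<nu>)
  case 0
  \<comment> \<open>With no factor left, only a = b = 0 gives a nonempty geometric sum.\<close>
  have "(\<Sum>b\<le>n. of_int (u ^ a * v ^ b * geom_sum (u * v) (0 + 1 - a - b)) * S (\<nu> + tail_weight n k a b)) =
      (if a = 0 then S \<nu> else 0)" for a
  proof -
    have "\<nu> + tail_weight n k 0 0 = \<nu>"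
      by (auto simp: tail_weight_def fun_eq_iff)
    then have "of_int (u ^ a * v ^ b * geom_sum (u * v) (0 + 1 - a - b)) * S (\<nu> + tail_weight n k a b) =
        (if b = 0 then if a = 0 then S \<nu> else 0 else 0)" for b
      by (cases a; cases b) simp_all
    then show ?thesis by (simp only: sum.delta finite_atMost atMost_iff) simp
  qed
  then have "(\<Sum>a\<le>n. \<Sum>b\<le>n. of_int (u ^ a * v ^ b * geom_sum (u * v) (0 + 1 - a - b)) *
      S (\<nu> + tail_weight n k a b)) = S \<nu>"
    by (simp only: sum.delta finite_atMost atMost_iff) simp
  moreover have "e_pow (- \<nu>) * (\<Prod>i = Suc k..<Suc n. phi u v i) = e_pow (- \<nu>)"
    using 0 by simp
  ultimately show ?case
    by (simp only: pair_e_pow)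
next
  case (Suc m)
  let ?z = "u * v" and ?\<epsilon> = "eps (Suc k)"
  let ?c = "\<lambda>m a b. u ^ a * v ^ b * geom_sum ?z (m + 1 - a - b)"
  let ?P = "\<Prod>i = Suc (Suc k)..<Suc n. phi u v i"
  \<comment> \<open>\<open>T\<close> is the right-hand side of the induction hypothesis behind
    position k + 1. \<open>K\<close> collects the weights without ones, which are the only ones
    produced by the terms 1 + u v and v.\<close>
  define T where "T \<mu> = (\<Sum>a\<le>n. \<Sum>b\<le>n. of_int (?c m a b) * S (\<mu> + tail_weight n (Suc k) a b))" for \<mu>
  define K where "K b = S (\<nu> + tail_weight n k 0 b)" for b
  note km = Suc.prems(1) and nz = Suc.prems(2)
  have c0: "?c m a b = 0" if "m < a + b" for a b using that by simp
  have IH: "pair (e_pow (- \<mu>) * ?P) = T \<mu>" if "\<forall>i>Suc k. \<mu> i = 0" for \<mu>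
    unfolding T_def using km that by (intro Suc.IH) auto
  \<comment> \<open>Entry 0 at position k + 1: a following 1 is an ascent, so only a = 0
    survives.\<close>
  have T0: "T \<nu> = (\<Sum>b\<le>n. of_int (?c m 0 b) * K b)"
  proof -
    have "(\<Sum>b\<le>n. of_int (?c m a b) * S (\<nu> + tail_weight n (Suc k) a b)) =
        (if a = 0 then \<Sum>b\<le>n. of_int (?c m 0 b) * K b else 0)" for a
    proof (cases "a = 0")
      case True
      have "of_int (?c m 0 b) * S (\<nu> + tail_weight n (Suc k) 0 b) = of_int (?c m 0 b) * K b" for b
        using tail_zero[where b = b, OF km nz] c0[of 0 b] by (cases "b \<le> m") (simp_all add: K_def)
      then show ?thesis using True by (simp only: if_True simp_thms)
    next
      case False
      have "of_int (?c m a b) * S (\<nu> + tail_weight n (Suc k) a b) = 0" for b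
        using tail_zero_ascent[where a = a and b = b, OF km nz] c0[of a b] False by (cases "a + b \<le> m") simp_all
      then show ?thesis using False by (simp only: if_False simp_thms sum.neutral_const)
    qed
    then show ?thesis unfolding T_def by (simp only: sum.delta finite_atMost atMost_iff) simp
  qed
  \<comment> \<open>Entry 1 lengthens the run of ones, shifting a to a + 1; the term a = n drops out
    since its coefficient is 0.\<close>
  have T1: "of_int u * T (\<nu> + ?\<epsilon>) =
      (\<Sum>a<n. \<Sum>b\<le>n. of_int (?c (Suc m) (Suc a) b) * S (\<nu> + tail_weight n k (Suc a) b))"
  proof -
    have "of_int (?c m a b) * S (\<nu> + ?\<epsilon> + tail_weight n (Suc k) a b) =
        of_int (?c m a b) * S (\<nu> + tail_weight n k (Suc a) b)" for a b
    proof (cases "a + b \<le> m")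
      case True
      then show ?thesis by (simp only: tail_plus[OF km nz])
    qed (simp only: c0 not_le of_int_0 mult_zero_left)
    then have eq: "T (\<nu> + ?\<epsilon>) = (\<Sum>a\<le>n. \<Sum>b\<le>n. of_int (?c m a b) * S (\<nu> + tail_weight n k (Suc a) b))"
      unfolding T_def by (simp only:)
    have "?c m n b = 0" for b using km by (intro c0) simp
    then have "(\<Sum>b\<le>n. of_int (?c m n b) * S (\<nu> + tail_weight n k (Suc n) b)) = 0"
      by (simp only: of_int_0 mult_zero_left sum.neutral_const)
    then have "T (\<nu> + ?\<epsilon>) = (\<Sum>a<n. \<Sum>b\<le>n. of_int (?c m a b) * S (\<nu> + tail_weight n k (Suc a) b))"
      unfolding eq lessThan_Suc_atMost[symmetric, of n] sum.lessThan_Suc[of _ n] by (simp only: lessThan_Suc_atMost add_0_right)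
    then show ?thesis by (simp add: sum_distrib_left mult.assoc)
  qed
  \<comment> \<open>Entry -1: without ones only the full block b = m survives, a single 1 cancels
    against it with a sign, and two or more ones give 0.\<close>
  have Tm: "of_int v * T (\<nu> - ?\<epsilon>) =
      (\<Sum>b\<le>n. of_int (if b = Suc m then v ^ Suc m else 0) * K b - of_int (?z * v ^ b * geom_sum ?z (m - b)) * K b)"
  proof -
    let ?f = "\<lambda>a. \<Sum>b\<le>n. of_int (?c m a b) * S (\<nu> - ?\<epsilon> + tail_weight n (Suc k) a b)"
    have "of_int (?c m a b) * S (\<nu> - ?\<epsilon> + tail_weight n (Suc k) a b) = 0" if "2 \<le> a" for a b
      using tail_minus_2[where b = b, OF km nz that] c0[of a b] by (cases "a + b \<le> m") simp_all
    then have "T (\<nu> - ?\<epsilon>) = ?f 0 + ?f 1"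
      unfolding T_def using km by (intro sum_eq_first_two) (auto intro!: sum.neutral)
    moreover have "of_int (?c m 1 b) * S (\<nu> - ?\<epsilon> + tail_weight n (Suc k) 1 b) =
        - (of_int (u * v ^ b * geom_sum ?z (m - b)) * K b)" for b
      using tail_minus_1[where b = b, OF km nz] by (cases "b < m") (simp_all add: K_def)
    then have "of_int v * ?f 1 = (\<Sum>b\<le>n. - (of_int (?z * v ^ b * geom_sum ?z (m - b)) * K b))"
      by (simp only: sum_distrib_left) (simp add: mult_ac)
    moreover have "of_int v * ?f 0 = (\<Sum>b\<le>n. of_int (if b = Suc m then v ^ Suc m else 0) * K b)"
    proof -
      have "of_int (?c m 0 b) * S (\<nu> - ?\<epsilon> + tail_weight n (Suc k) 0 b) =
          (if b = m then of_int (v ^ m) * K (Suc m) else 0)" for b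
      proof (cases b m rule: linorder_cases)
        case less
        then show ?thesis using tail_minus_ascent[OF km nz less] by simp
      next
        case equal
        then show ?thesis by (simp only: equal tail_minus_full[OF km nz]) (simp add: K_def)
      qed simp
      then have "?f 0 = of_int (v ^ m) * K (Suc m)"
        using km by (simp only: sum.delta finite_atMost atMost_iff) simp
      moreover have "of_int (if b = Suc m then v ^ Suc m else 0) * K b =
          (if b = Suc m then of_int (v ^ Suc m) * K (Suc m) else 0)" for b by simp
      then have "(\<Sum>b\<le>n. of_int (if b = Suc m then v ^ Suc m else 0) * K b) = of_int (v ^ Suc m) * K (Suc m)"
        using km by (simp only: sum.delta finite_atMost atMost_iff) simp
      ultimately show ?thesis by simp
    qed
    ultimately show ?thesis
      by (simp only: distrib_left sum_subtractf sum_negf) simp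
  qed
  have "e_pow (- \<nu>) * (\<Prod>i = Suc k..<Suc n. phi u v i) = of_int (1 + ?z) * (e_pow (- \<nu>) * ?P) +
      of_int u * (e_pow (- (\<nu> + ?\<epsilon>)) * ?P) + of_int v * (e_pow (- (\<nu> - ?\<epsilon>)) * ?P)"
  proof -
    have lt: "Suc k < Suc n" using km by simp
    have e: "e_pow (- (\<nu> + ?\<epsilon>)) = e_pow (- \<nu>) * e_pow (- ?\<epsilon>)" "e_pow (- (\<nu> - ?\<epsilon>)) = e_pow (- \<nu>) * e_pow ?\<epsilon>"
      by (simp_all flip: e_pow_add)
    have "e_pow (- \<nu>) * (phi u v (Suc k) * P) = of_int (1 + ?z) * (e_pow (- \<nu>) * P) +
        of_int u * (e_pow (- (\<nu> + ?\<epsilon>)) * P) + of_int v * (e_pow (- (\<nu> - ?\<epsilon>)) * P)" for P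
      unfolding e phi_def by (simp add: algebra_simps)
    then show ?thesis
      unfolding prod.atLeast_Suc_lessThan[OF lt] by blast
  qed
  then have "pair (e_pow (- \<nu>) * (\<Prod>i = Suc k..<Suc n. phi u v i)) =
      of_int (1 + ?z) * pair (e_pow (- \<nu>) * ?P) +
      of_int u * pair (e_pow (- (\<nu> + ?\<epsilon>)) * ?P) + of_int v * pair (e_pow (- (\<nu> - ?\<epsilon>)) * ?P)"
    by (simp only: pair_add pair_of_int)
  also have "pair (e_pow (- \<nu>) * ?P) = T \<nu>" using nz by (intro IH) simp
  also have "pair (e_pow (- (\<nu> + ?\<epsilon>)) * ?P) = T (\<nu> + ?\<epsilon>)" using nz by (intro IH) (simp add: eps_def)
  also have "pair (e_pow (- (\<nu> - ?\<epsilon>)) * ?P) = T (\<nu> - ?\<epsilon>)" using nz by (intro IH) (simp add: eps_def)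
  also have "of_int (1 + ?z) * T \<nu> + of_int u * T (\<nu> + ?\<epsilon>) + of_int v * T (\<nu> - ?\<epsilon>) =
      (of_int (1 + ?z) * T \<nu> + of_int v * T (\<nu> - ?\<epsilon>)) + of_int u * T (\<nu> + ?\<epsilon>)" by simp
  also have "of_int (1 + ?z) * T \<nu> + of_int v * T (\<nu> - ?\<epsilon>) = (\<Sum>b\<le>n. of_int (?c (Suc m) 0 b) * K b)"
  proof -
    \<comment> \<open>The recurrence of \<open>geom_sum\<close>; at b = m + 1 the whole coefficient
      comes from the full block of entries -1.\<close>
    have "(1 + ?z) * ?c m 0 b + ((if b = Suc m then v ^ Suc m else 0) - ?z * v ^ b * geom_sum ?z (m - b)) =
        ?c (Suc m) 0 b" for b
    proof (cases b "Suc m" rule: linorder_cases)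
      case less
      then have "Suc m + 1 - 0 - b = Suc (Suc (m - b))" "m + 1 - 0 - b = Suc (m - b)" by auto
      then show ?thesis using less by (simp add: geom_sum_Suc_Suc algebra_simps)
    qed simp_all
    then have "of_int (1 + ?z) * (of_int (?c m 0 b) * K b) + (of_int (if b = Suc m then v ^ Suc m else 0) * K b
        - of_int (?z * v ^ b * geom_sum ?z (m - b)) * K b) = of_int (?c (Suc m) 0 b) * K b" for b
      by (metis (no_types, lifting) distrib_right left_diff_distrib mult.assoc of_int_add of_int_diff of_int_mult)
    then show ?thesis
      unfolding T0 Tm by (simp only: sum_distrib_left sum.distrib[symmetric])
  qed
  also have "(\<Sum>b\<le>n. of_int (?c (Suc m) 0 b) * K b) + of_int u * T (\<nu> + ?\<epsilon>) =
      (\<Sum>a\<le>n. \<Sum>b\<le>n. of_int (?c (Suc m) a b) * S (\<nu> + tail_weight n k a b))"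
    unfolding T1 K_def by (rule sum.atMost_shift[symmetric])
  finally show ?case .
qed

end

section \<open>The root systems of types A and C\<close>

lemma pos_roots_A_eq: "pos_roots_A n = roots_A 1 (Suc n)"
  by (simp add: pos_roots_A_def roots_A_def less_Suc_eq_le)

lemma pos_roots_C_eq: "pos_roots_C n = roots_C 1 (Suc n)"
proof (intro subset_antisym subsetI)
  fix x assume "x \<in> pos_roots_C n"
  then show "x \<in> roots_C 1 (Suc n)"
    unfolding pos_roots_C_def by (auto intro!: roots_C_I roots_C_long)
next
  fix x assume "x \<in> roots_C 1 (Suc n)"
  then show "x \<in> pos_roots_C n"
  proof (cases rule: roots_C_cases)
    case (1 i j)
    have "\<exists>i j. x = eps i - eps j \<and> 1 \<le> i \<and> i < j \<and> j \<le> n"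
      by (rule exI[of _ i], rule exI[of _ j]) (use 1 in simp)
    then show ?thesis unfolding pos_roots_C_def by blast
  next
    case (2 i j)
    show ?thesis
    proof (cases "i = j")
      case True
      with 2 have "\<exists>i. x = eps i + eps i \<and> 1 \<le> i \<and> i \<le> n" by (intro exI[of _ i]) simp
      then show ?thesis unfolding pos_roots_C_def by blast
    next
      case False
      have "\<exists>i j. x = eps i + eps j \<and> 1 \<le> i \<and> i < j \<and> j \<le> n"
        by (rule exI[of _ i], rule exI[of _ j]) (use 2 False in simp)
      then show ?thesis unfolding pos_roots_C_def by blast
    qed
  qed
qed

definition simple_A :: "nat \<Rightarrow> vec set" where
  "simple_A n = {eps j - eps (Suc j) | j. 1 \<le> j \<and> j < n}"

lemma simple_A_I: "1 \<le> j \<Longrightarrow> j < n \<Longrightarrow> eps j - eps (Suc j) \<in> simple_A n"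
  by (auto simp: simple_A_def)

lemma simple_A_E:
  assumes "x \<in> simple_A n"
  obtains j where "1 \<le> j" "j < n" "x = eps j - eps (Suc j)"
  using assms by (auto simp: simple_A_def)

text \<open>A sum of two positive roots has height at least 4.\<close>

lemma height_2_indecomposable:
  assumes "R \<subseteq> roots_C a b" "\<alpha> \<in> R" "height a b \<alpha> = 2"
  shows "\<alpha> \<in> simple_roots R"
proof -
  have "4 \<le> height a b (\<beta> + \<gamma>)" if "\<beta> \<in> R" "\<gamma> \<in> R" for \<beta> \<gamma>
    using that assms(1) height_root_ge_2[of \<beta> a b] height_root_ge_2[of \<gamma> a b]
    unfolding height_add by fastforce
  then show ?thesis
    using assms by (force simp: simple_roots_def)
qed

lemma roots_A_subset: "roots_A a b \<subseteq> roots_C a b"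
  by (simp add: roots_C_def)

lemma simple_roots_A: "simple_roots (pos_roots_A n) = simple_A n"
proof (intro subset_antisym subsetI)
  fix x assume x: "x \<in> simple_roots (pos_roots_A n)"
  then have "x \<in> roots_A 1 (Suc n)" by (simp add: simple_roots_def pos_roots_A_eq)
  then obtain i j where ij: "1 \<le> i" "i < j" "j < Suc n" "x = eps i - eps j"
    by (rule roots_A_E)
  have "j = Suc i"
  proof (rule ccontr)
    assume "j \<noteq> Suc i"
    then have "eps i - eps (Suc i) \<in> pos_roots_A n" "eps (Suc i) - eps j \<in> pos_roots_A n"
      using ij by (auto simp: pos_roots_A_eq intro!: roots_A_I)
    moreover have "x = (eps i - eps (Suc i)) + (eps (Suc i) - eps j)"
      using ij by simp
    ultimately show False using x unfolding simple_roots_def by blast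
  qed
  then show "x \<in> simple_A n" using ij by (auto intro: simple_A_I)
next
  fix x assume "x \<in> simple_A n"
  then show "x \<in> simple_roots (pos_roots_A n)"
    by (elim simple_A_E)
       (auto intro!: height_2_indecomposable[of _ 1 "Suc n"] roots_A_I subsetD[OF roots_A_subset]
         simp: pos_roots_A_eq height_diff height_eps)
qed

lemma simple_roots_C:
  assumes "1 \<le> n"
  shows "simple_roots (pos_roots_C n) = insert (eps n + eps n) (simple_A n)"
proof (intro subset_antisym subsetI)
  fix x assume x: "x \<in> simple_roots (pos_roots_C n)"
  then have ind: "\<not> (\<exists>\<beta>\<in>roots_C 1 (Suc n). \<exists>\<gamma>\<in>roots_C 1 (Suc n). x = \<beta> + \<gamma>)"
    by (simp add: simple_roots_def pos_roots_C_eq)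
  have "x \<in> roots_C 1 (Suc n)" using x by (simp add: simple_roots_def pos_roots_C_eq)
  then show "x \<in> insert (eps n + eps n) (simple_A n)"
  proof (cases rule: roots_C_cases)
    case (1 i j)
    have "j = Suc i"
    proof (rule ccontr)
      assume "j \<noteq> Suc i"
      then have "eps i - eps (Suc i) \<in> roots_C 1 (Suc n)" "eps (Suc i) - eps j \<in> roots_C 1 (Suc n)"
        using 1 by (auto intro!: roots_C_I)
      moreover have "x = (eps i - eps (Suc i)) + (eps (Suc i) - eps j)"
        using 1 by simp
      ultimately show False using ind by blast
    qed
    then show ?thesis using 1 by (auto intro: simple_A_I)
  next
    case (2 i j)
    have "i = n"
    proof (rule ccontr)
      assume "i \<noteq> n"
      then have "eps i - eps (Suc i) \<in> roots_C 1 (Suc n)" "eps (Suc i) + eps j \<in> roots_C 1 (Suc n)"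
        using 2 by (auto intro!: roots_C_I)
      moreover have "x = (eps i - eps (Suc i)) + (eps (Suc i) + eps j)"
        using 2 by simp
      ultimately show False using ind by blast
    qed
    moreover have "j = n" using 2 calculation by simp
    ultimately show ?thesis using 2(4) by blast
  qed
next
  fix x assume "x \<in> insert (eps n + eps n) (simple_A n)"
  then show "x \<in> simple_roots (pos_roots_C n)"
  proof
    assume "x = eps n + eps n"
    moreover have "height 1 (Suc n) (eps n + eps n) = 2"
      using assms unfolding height_add by (simp add: height_eps)
    ultimately show ?thesis
      using assms by (intro height_2_indecomposable[of _ 1 "Suc n"])
        (auto intro!: roots_C_long simp: pos_roots_C_eq)
  next
    assume "x \<in> simple_A n"
    then show ?thesis
      by (elim simple_A_E)
         (auto intro!: height_2_indecomposable[of _ 1 "Suc n"] roots_C_I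
           simp: pos_roots_C_eq height_diff height_eps)
  qed
qed

section \<open>Reflections in coordinates and generation by simple reflections\<close>

lemma dot_eps: "i \<in> {1..n} \<Longrightarrow> dot n x (eps i) = x i"
  by (simp add: dot_def eps_def if_distrib[of "(*) _"] sum.delta' cong: if_cong)

lemma dot_eps_left: "i \<in> {1..n} \<Longrightarrow> dot n (eps i) x = x i"
  by (subst dot_commute) (rule dot_eps)

lemma reflection_eq_swap_coord:
  assumes "1 \<le> j" "j < n"
  shows "reflection n (eps j - eps (Suc j)) = swap_coord j"
proof
  fix x
  let ?\<alpha> = "eps j - eps (Suc j)"
  have "dot n x ?\<alpha> = x j - x (Suc j)" for x
    using assms by (subst dot_commute) (simp add: dot_diff_left dot_eps_left)
  moreover from this[of ?\<alpha>] have "dot n ?\<alpha> ?\<alpha> = 2" by (simp add: eps_def)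
  ultimately show "reflection n ?\<alpha> x = swap_coord j x"
    by (auto simp: reflection_def swap_coord_def eps_def fun_eq_iff diff_divide_distrib)
qed

lemma reflection_eq_neg_coord:
  assumes "1 \<le> n"
  shows "reflection n (eps n + eps n) = neg_coord n"
proof
  fix x
  let ?\<alpha> = "eps n + eps n"
  have "dot n x ?\<alpha> = 2 * x n" for x
    using assms by (subst dot_commute) (simp only: dot_add_left dot_eps_left[of n n] atLeastAtMost_iff order_refl mult_2 simp_thms)
  moreover from this[of ?\<alpha>] have "dot n ?\<alpha> ?\<alpha> = 4" by (simp add: eps_def)
  ultimately show "reflection n ?\<alpha> x = neg_coord n x"
    by (auto simp: reflection_def neg_coord_def eps_def fun_eq_iff)
qed

lemma norm_root:
  assumes "\<alpha> \<in> pos_roots_C n"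
  shows "dot n \<alpha> \<alpha> \<noteq> 0"
proof -
  have r: "\<alpha> \<in> roots_C 1 (Suc n)" using assms by (simp add: pos_roots_C_eq)
  have "\<alpha> i = 0" if "dot n \<alpha> \<alpha> = 0" "i \<in> {1..n}" for i
  proof -
    have "(\<Sum>i = 1..n. (\<alpha> i)\<^sup>2) = 0" using that by (simp add: dot_def power2_eq_square)
    then show ?thesis using that(2) by (subst (asm) sum_nonneg_eq_0_iff) auto
  qed
  then have "height 1 (Suc n) \<alpha> = 0" if "dot n \<alpha> \<alpha> = 0"
    using that unfolding height_def by (intro sum.neutral) auto
  then show ?thesis using height_root_ge_2[OF r] by auto
qed

lemma dot_height: "dot n (\<lambda>i. 2 * real (Suc n) - 2 * real i - 1) \<alpha> = height 1 (Suc n) \<alpha>"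
  by (simp add: dot_def height_def atLeastLessThanSuc_atLeastAtMost)

text \<open>Conjugation by simple reflections moves the indices of a root one step at a time.
  Differences start at adjacent indices; sums start at eps i + eps n, the reflection of eps i - eps
  n in the long simple root; the remaining long roots descend from 2 eps n.\<close>

lemma reflection_in_simple_weyl_group:
  assumes "1 \<le> n" "\<alpha> \<in> pos_roots_C n"
  shows "reflection n \<alpha> \<in> weyl_group n (insert (eps n + eps n) (simple_A n))"
    and "\<alpha> \<in> pos_roots_A n \<Longrightarrow> reflection n \<alpha> \<in> weyl_group n (simple_A n)"
proof -
  let ?C = "insert (eps n + eps n) (simple_A n)"
  have A: "reflection n (eps i - eps j) \<in> weyl_group n (simple_A n)" if "1 \<le> i" "i < j" "j \<le> n" for i j
  proof -
    have "Suc i \<le> j" using that by simp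
    then show ?thesis
      using that(3)
    proof (induction j rule: dec_induct)
      case base
      then show ?case using that by (intro reflection_in_weyl_group simple_A_I) auto
    next
      case (step j)
      have "reflection n (eps i - eps j) \<in> weyl_group n (simple_A n)"
        by (rule step.IH) (use step in simp)
      then have "reflection n (reflection n (eps j - eps (Suc j)) (eps i - eps j)) \<in> weyl_group n (simple_A n)"
        by (rule reflection_conj_in_weyl_group, intro simple_A_I) (use that step in auto)
      moreover have "reflection n (eps j - eps (Suc j)) (eps i - eps j) = eps i - eps (Suc j)"
        using step that(1) by (simp add: reflection_eq_swap_coord)
      ultimately show ?case by (simp only:)
    qed
  qed
  have AC: "weyl_group n (simple_A n) \<subseteq> weyl_group n ?C"
    by (rule weyl_group_mono) blast
  have plus: "reflection n (eps i + eps j) \<in> weyl_group n ?C" if "1 \<le> i" "i < j" "j \<le> n" for i j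
    using that(3) that(2)
  proof (induction j rule: inc_induct)
    case base
    have "reflection n (reflection n (eps n + eps n) (eps i - eps n)) \<in> weyl_group n ?C"
      using A[of i n] AC that base by (intro reflection_conj_in_weyl_group) auto
    moreover have "reflection n (eps n + eps n) (eps i - eps n) = eps i + eps n"
      using base unfolding reflection_eq_neg_coord[OF assms(1)] by simp
    ultimately show ?case by (simp only:)
  next
    case (step j)
    have "reflection n (eps i + eps (Suc j)) \<in> weyl_group n ?C"
      by (rule step.IH) (use step in simp)
    then have "reflection n (reflection n (eps j - eps (Suc j)) (eps i + eps (Suc j))) \<in> weyl_group n ?C"
      by (rule reflection_conj_in_weyl_group) (use step that(1) in \<open>auto intro: simple_A_I\<close>)
    moreover have "reflection n (eps j - eps (Suc j)) (eps i + eps (Suc j)) = eps i + eps j"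
      using step that(1) by (simp add: reflection_eq_swap_coord)
    ultimately show ?case by (simp only:)
  qed
  have double: "reflection n (2 * eps i) \<in> weyl_group n ?C" if "1 \<le> i" "i \<le> n" for i
    using that(2) that(1)
  proof (induction i rule: inc_induct)
    case base
    have "reflection n (eps n + eps n) \<in> weyl_group n ?C"
      by (intro reflection_in_weyl_group) blast
    then show ?case by (simp only: mult_2)
  next
    case (step j)
    have "reflection n (2 * eps (Suc j)) \<in> weyl_group n ?C"
      by (rule step.IH) (use step in simp)
    then have "reflection n (reflection n (eps j - eps (Suc j)) (2 * eps (Suc j))) \<in> weyl_group n ?C"
      by (rule reflection_conj_in_weyl_group) (use step in \<open>auto intro: simple_A_I\<close>)
    moreover have "reflection n (eps j - eps (Suc j)) (2 * eps (Suc j)) = 2 * eps j"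
      using step by (simp add: reflection_eq_swap_coord)
    ultimately show ?case by (simp only:)
  qed
  have "\<alpha> \<in> roots_C 1 (Suc n)" using assms(2) by (simp add: pos_roots_C_eq)
  then show "reflection n \<alpha> \<in> weyl_group n ?C"
  proof (cases rule: roots_C_cases)
    case (1 i j)
    then show ?thesis using A[of i j] AC by auto
  next
    case (2 i j)
    show ?thesis
    proof (cases "i = j")
      case True
      have "reflection n (2 * eps i) \<in> weyl_group n ?C" using 2 True by (intro double) auto
      then show ?thesis using 2(4) True by (simp only: mult_2)
    next
      case False
      have "reflection n (eps i + eps j) \<in> weyl_group n ?C" using 2 False by (intro plus) auto
      then show ?thesis using 2(4) by (simp only:)
    qed
  qed
  show "reflection n \<alpha> \<in> weyl_group n (simple_A n)" if "\<alpha> \<in> pos_roots_A n"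
    using that A by (auto simp: pos_roots_A_def)
qed

text \<open>A family containing the Weyl group on which finiteness and stabilizers are easy to see;
  \<sigma> ranges over self-maps of \<open>{1..n}\<close>.\<close>

definition signed_perms :: "nat \<Rightarrow> real set \<Rightarrow> (vec \<Rightarrow> vec) set" where
  "signed_perms n P = {w. \<exists>s \<sigma>. w = (\<lambda>x i. s i * x (\<sigma> i)) \<and>
     (\<forall>i\<in>{1..n}. s i \<in> P \<and> \<sigma> i \<in> {1..n}) \<and> (\<forall>i. i \<notin> {1..n} \<longrightarrow> s i = 1 \<and> \<sigma> i = i)}"

lemma signed_perms_E:
  assumes "w \<in> signed_perms n P"
  obtains s \<sigma> where "w = (\<lambda>x i. s i * x (\<sigma> i))" "\<forall>i\<in>{1..n}. s i \<in> P" "\<forall>i\<in>{1..n}. \<sigma> i \<in> {1..n}"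
    "\<forall>i. i \<notin> {1..n} \<longrightarrow> s i = 1" "\<forall>i. i \<notin> {1..n} \<longrightarrow> \<sigma> i = i"
  using assms unfolding signed_perms_def by blast

lemma signed_perms_I:
  assumes "w = (\<lambda>x i. s i * x (\<sigma> i))" "\<And>i. i \<in> {1..n} \<Longrightarrow> s i \<in> P" "\<And>i. i \<in> {1..n} \<Longrightarrow> \<sigma> i \<in> {1..n}"
    "\<And>i. i \<notin> {1..n} \<Longrightarrow> s i = 1" "\<And>i. i \<notin> {1..n} \<Longrightarrow> \<sigma> i = i"
  shows "w \<in> signed_perms n P"
  using assms unfolding signed_perms_def by blast

lemma finite_signed_perms:
  assumes "finite P"
  shows "finite (signed_perms n P)"
proof (rule finite_subset)
  let ?s = "{s. \<forall>i. (i \<in> {1..n} \<longrightarrow> s i \<in> P) \<and> (i \<notin> {1..n} \<longrightarrow> s i = 1)}"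
  \<comment> \<open>Finiteness of a set of functions is available for a constant default value, so
    \<sigma> is cut off to 0 outside \<open>{1..n}\<close>; the image map restores the identity
    there.\<close>
  let ?p = "{\<sigma>. \<forall>i. (i \<in> {1..n} \<longrightarrow> \<sigma> i \<in> {1..n}) \<and> (i \<notin> {1..n} \<longrightarrow> \<sigma> i = 0)}"
  show "signed_perms n P \<subseteq>
      (\<lambda>(s, \<sigma>) (x :: vec) i. s i * x (if i \<in> {1..n} then \<sigma> i else i)) ` (?s \<times> ?p)"
  proof
    fix w assume "w \<in> signed_perms n P"
    then obtain s \<sigma> where w: "w = (\<lambda>x i. s i * x (\<sigma> i))" "\<forall>i\<in>{1..n}. s i \<in> P" "\<forall>i\<in>{1..n}. \<sigma> i \<in> {1..n}"
    "\<forall>i. i \<notin> {1..n} \<longrightarrow> s i = 1" "\<forall>i. i \<notin> {1..n} \<longrightarrow> \<sigma> i = i"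
      by (rule signed_perms_E)
    define \<tau> where "\<tau> i = (if i \<in> {1..n} then \<sigma> i else 0)" for i
    have "\<sigma> = (\<lambda>i. if i \<in> {1..n} then \<tau> i else i)"
      using w(5) by (auto simp: \<tau>_def fun_eq_iff)
    then have "w = (\<lambda>(s, \<sigma>) (x :: vec) i. s i * x (if i \<in> {1..n} then \<sigma> i else i)) (s, \<tau>)"
      using w(1) by simp
    moreover have "(s, \<tau>) \<in> ?s \<times> ?p"
      using w by (simp add: \<tau>_def)
    ultimately show "w \<in> (\<lambda>(s, \<sigma>) (x :: vec) i. s i * x (if i \<in> {1..n} then \<sigma> i else i)) ` (?s \<times> ?p)"
      by blast
  qed
  show "finite ((\<lambda>(s, \<sigma>) (x :: vec) i. s i * x (if i \<in> {1..n} then \<sigma> i else i)) ` (?s \<times> ?p))"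
    by (intro finite_imageI finite_cartesian_product finite_set_of_finite_funs assms finite_atLeastAtMost)
qed

lemma id_in_signed_perms: "1 \<in> P \<Longrightarrow> id \<in> signed_perms n P"
  by (rule signed_perms_I[of _ "\<lambda>_. 1" "\<lambda>i. i"]) (auto simp: fun_eq_iff)

lemma swap_comp_signed_perms:
  assumes "w \<in> signed_perms n P" "1 \<le> j" "j < n"
  shows "swap_coord j \<circ> w \<in> signed_perms n P"
proof -
  define t where "t i = (if i = j then Suc j else if i = Suc j then j else i)" for i
  obtain s \<sigma> where w: "w = (\<lambda>x i. s i * x (\<sigma> i))" "\<forall>i\<in>{1..n}. s i \<in> P" "\<forall>i\<in>{1..n}. \<sigma> i \<in> {1..n}"
    "\<forall>i. i \<notin> {1..n} \<longrightarrow> s i = 1" "\<forall>i. i \<notin> {1..n} \<longrightarrow> \<sigma> i = i"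
    using assms(1) by (rule signed_perms_E)
  have t: "t i \<in> {1..n} \<longleftrightarrow> i \<in> {1..n}" "i \<notin> {1..n} \<Longrightarrow> t i = i" for i
    using assms(2,3) by (auto simp: t_def)
  show ?thesis
  proof (rule signed_perms_I)
    show "swap_coord j \<circ> w = (\<lambda>x i. s (t i) * x (\<sigma> (t i)))"
      by (simp add: w(1) swap_coord_def t_def fun_eq_iff)
    fix i
    show "s (t i) \<in> P" "\<sigma> (t i) \<in> {1..n}" if "i \<in> {1..n}"
      using w(2,3) t(1)[of i] that by blast+
    show "s (t i) = 1" "\<sigma> (t i) = i" if "i \<notin> {1..n}"
      unfolding t(2)[OF that] using w(4,5) that by blast+
  qed
qed

lemma neg_comp_signed_perms:
  assumes "w \<in> signed_perms n P" "1 \<le> n" "\<And>c. c \<in> P \<Longrightarrow> - c \<in> P"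
  shows "neg_coord n \<circ> w \<in> signed_perms n P"
proof -
  obtain s \<sigma> where w: "w = (\<lambda>x i. s i * x (\<sigma> i))" "\<forall>i\<in>{1..n}. s i \<in> P" "\<forall>i\<in>{1..n}. \<sigma> i \<in> {1..n}"
    "\<forall>i. i \<notin> {1..n} \<longrightarrow> s i = 1" "\<forall>i. i \<notin> {1..n} \<longrightarrow> \<sigma> i = i"
    using assms(1) by (rule signed_perms_E)
  show ?thesis
  proof (rule signed_perms_I)
    show "neg_coord n \<circ> w = (\<lambda>x i. (if i = n then - s i else s i) * x (\<sigma> i))"
      by (simp add: w(1) neg_coord_def fun_eq_iff)
    fix i
    show "(if i = n then - s i else s i) \<in> P" "\<sigma> i \<in> {1..n}" if "i \<in> {1..n}"
      using w(2,3) assms(3) that by auto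
    have "n \<in> {1..n}" using assms(2) by simp
    then show "(if i = n then - s i else s i) = 1" "\<sigma> i = i" if "i \<notin> {1..n}"
      using w(4,5) that by metis+
  qed
qed

lemma signed_perms_stabilizer:
  assumes "w \<in> signed_perms n P" "w x = x"
    and regular: "\<And>i j c. i \<in> {1..n} \<Longrightarrow> j \<in> {1..n} \<Longrightarrow> c \<in> P \<Longrightarrow> c * x j = x i \<Longrightarrow> j = i \<and> c = 1"
  shows "w = id"
proof -
  obtain s \<sigma> where w: "w = (\<lambda>x i. s i * x (\<sigma> i))" "\<forall>i\<in>{1..n}. s i \<in> P" "\<forall>i\<in>{1..n}. \<sigma> i \<in> {1..n}"
    "\<forall>i. i \<notin> {1..n} \<longrightarrow> s i = 1" "\<forall>i. i \<notin> {1..n} \<longrightarrow> \<sigma> i = i"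
    using assms(1) by (rule signed_perms_E)
  have "\<sigma> i = i \<and> s i = 1" for i
    using w(2-5) regular[of i "\<sigma> i" "s i"] fun_cong[OF assms(2), of i] w(1) by (cases "i \<in> {1..n}") auto
  then show ?thesis by (simp add: w(1) fun_eq_iff)
qed

lemma weyl_group_simple_A_signed_perms: "weyl_group n (simple_A n) \<subseteq> signed_perms n {1}"
proof
  fix w assume "w \<in> weyl_group n (simple_A n)"
  then show "w \<in> signed_perms n {1}"
  proof induction
    case (refl \<alpha> w)
    then obtain j where "1 \<le> j" "j < n" "\<alpha> = eps j - eps (Suc j)" by (elim simple_A_E)
    then show ?case
      using refl swap_comp_signed_perms by (simp only: reflection_eq_swap_coord)
  qed (rule id_in_signed_perms, simp)
qed

lemma weyl_group_simple_C_signed_perms: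
  assumes "1 \<le> n"
  shows "weyl_group n (insert (eps n + eps n) (simple_A n)) \<subseteq> signed_perms n {1, -1}"
proof
  fix w assume "w \<in> weyl_group n (insert (eps n + eps n) (simple_A n))"
  then show "w \<in> signed_perms n {1, -1}"
  proof induction
    case (refl \<alpha> w)
    from refl(1) show ?case
    proof
      assume "\<alpha> = eps n + eps n"
      moreover have "neg_coord n \<circ> w \<in> signed_perms n {1, -1}"
        by (rule neg_comp_signed_perms[OF refl(3) assms]) auto
      ultimately show ?case
        by (simp only: reflection_eq_neg_coord[OF assms])
    next
      assume "\<alpha> \<in> simple_A n"
      then obtain j where "1 \<le> j" "j < n" "\<alpha> = eps j - eps (Suc j)" by (elim simple_A_E)
      then show ?case
        using refl swap_comp_signed_perms by (simp only: reflection_eq_swap_coord)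
    qed
  qed (rule id_in_signed_perms, simp)
qed

text \<open>Coordinate j of the formula for the reflected \<rho>; this avoids summing over the
  roots.\<close>

lemma rho_swap:
  assumes "finite R" "1 \<le> j" "j < n" "eps j - eps (Suc j) \<in> R"
    "swap_coord j ` (R - {eps j - eps (Suc j)}) = R - {eps j - eps (Suc j)}"
    "dot n (eps j - eps (Suc j)) (eps j - eps (Suc j)) \<noteq> 0"
  shows "rho R (Suc j) = rho R j - 1"
proof -
  have "swap_coord j (rho R) = rho R - (eps j - eps (Suc j))"
    using reflection_rho_of_permutes[OF assms(1,4,6)] assms by (simp add: reflection_eq_swap_coord)
  from fun_cong[OF this, of j] show ?thesis
    by (simp add: swap_coord_def eps_def)
qed

lemma rho_A:
  assumes "1 \<le> j" "j < n"
  shows "rho (pos_roots_A n) (Suc j) = rho (pos_roots_A n) j - 1"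
  unfolding pos_roots_A_eq
  using assms norm_root[of "eps j - eps (Suc j)" n] roots_A_I[of 1 j "Suc j" "Suc n"]
    subsetD[OF roots_A_subset[of 1 "Suc n"], of "eps j - eps (Suc j)"]
  by (intro rho_swap[of _ j n] finite_roots_A swap_coord_roots_A) (auto simp: pos_roots_C_eq)

lemma rho_C:
  assumes "i \<in> {1..n}"
  shows "rho (pos_roots_C n) i = real (Suc n) - real i"
proof -
  let ?R = "pos_roots_C n" and ?\<alpha> = "eps n + eps n"
  have n: "1 \<le> n" using assms by simp
  have "?\<alpha> \<in> ?R" using n unfolding pos_roots_C_eq by (intro roots_C_I) auto
  \<comment> \<open>Reflecting in the long simple root gives - \<rho>_n = \<rho>_n - 2, which fixes
    the last coordinate as 1.\<close>
  then have "neg_coord n (rho ?R) = rho ?R - ?\<alpha>"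
    using reflection_rho_of_permutes[of ?R ?\<alpha> n] norm_root[of ?\<alpha> n] neg_coord_roots_C[OF n] finite_roots_C
    unfolding reflection_eq_neg_coord[OF n] by (simp add: pos_roots_C_eq)
  from fun_cong[OF this, of n] have last: "rho ?R n = 1"
    by (simp add: neg_coord_def eps_def)
  have "i \<le> n" using assms by simp
  then show ?thesis
    using assms
  proof (induction i rule: inc_induct)
    case base
    then show ?case by (simp add: last)
  next
    case (step j)
    then have "rho ?R (Suc j) = rho ?R j - 1"
      unfolding pos_roots_C_eq
      using norm_root[of "eps j - eps (Suc j)" n] roots_C_I(1)[of 1 j "Suc j" "Suc n"]
      by (intro rho_swap[of _ j n] finite_roots_C swap_coord_roots_C) (auto simp: pos_roots_C_eq)
    moreover have "rho ?R (Suc j) = real (Suc n) - real (Suc j)"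
      by (rule step.IH) (use step in simp)
    ultimately show ?case by simp
  qed
qed

lemma root_coord_Ints:
  assumes "\<alpha> \<in> roots_C a b"
  shows "\<alpha> i \<in> \<int>"
  using assms by (cases rule: roots_C_cases) (auto simp: eps_def)

lemma sum_roots_coord_Ints:
  assumes "\<Phi> \<subseteq> roots_C a b"
  shows "(\<Sum>\<Phi>) i \<in> \<int>"
proof -
  have "finite \<Phi>" using assms finite_roots_C by (rule finite_subset)
  then have "(\<Sum>\<Phi>) i = (\<Sum>\<alpha>\<in>\<Phi>. \<alpha> i)"
    by (induction \<Phi> rule: finite_induct) auto
  then show ?thesis
    using assms root_coord_Ints by (auto intro!: Ints_sum)
qed

lemma Ints_less_1_iff: "x \<in> \<int> \<Longrightarrow> x < 1 \<longleftrightarrow> x \<le> (0 :: real)"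
  by (auto elim!: Ints_cases)

text \<open>Since \<rho> pairs to 1 with eps j - eps (j + 1), consecutive coordinates of the sum
  differ by less than 1, and they are integers.\<close>

lemma antidominant_sum_mono:
  assumes \<Phi>: "\<Phi> \<subseteq> roots_C 1 (Suc n)"
    and \<rho>: "\<And>j. 1 \<le> j \<Longrightarrow> j < n \<Longrightarrow> \<rho> (Suc j) = \<rho> j - 1"
    and neg: "\<And>\<alpha>. \<alpha> \<in> simple_A n \<Longrightarrow> dot n \<alpha> (\<Sum>\<Phi> - \<rho>) < 0"
    and "1 \<le> i" "i \<le> k" "k \<le> n"
  shows "(\<Sum>\<Phi>) i \<le> (\<Sum>\<Phi>) k"
proof -
  define \<gamma> where "\<gamma> = \<Sum>\<Phi>"
  have int: "\<gamma> i \<in> \<int>" for i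
    unfolding \<gamma>_def using \<Phi> by (rule sum_roots_coord_Ints)
  have ascending: "\<gamma> j \<le> \<gamma> (Suc j)" if "1 \<le> j" "j < n" for j
  proof -
    have "dot n (eps j - eps (Suc j)) (\<gamma> - \<rho>) < 0"
      unfolding \<gamma>_def using that by (intro neg simple_A_I)
    then have "\<gamma> j - \<gamma> (Suc j) < 1"
      using that \<rho>[OF that] by (simp add: dot_diff_left dot_eps_left)
    then show ?thesis
      using Ints_less_1_iff[OF Ints_diff[OF int int]] by simp
  qed
  have "\<gamma> i \<le> \<gamma> k"
    using assms(5,6)
  proof (induction k rule: dec_induct)
    case (step k)
    then show ?case using ascending[of k] assms(4) by simp
  qed simp
  then show ?thesis by (simp add: \<gamma>_def)
qed

lemma reflection_data_A: "reflection_data n (pos_roots_A n)"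
proof
  let ?R = "pos_roots_A n"
  have RC: "?R \<subseteq> pos_roots_C n" by (simp add: pos_roots_A_eq pos_roots_C_eq roots_A_subset)
  show "finite ?R" by (simp add: pos_roots_A_eq finite_roots_A)
  show gen: "weyl_group n ?R \<subseteq> weyl_group n (simple_roots ?R)"
    unfolding simple_roots_A
  proof (cases "n = 0")
    case True
    then have "?R = {}" "simple_A n = {}" by (auto simp: pos_roots_A_def simple_A_def)
    then show "weyl_group n ?R \<subseteq> weyl_group n (simple_A n)" by simp
  next
    case False
    then show "weyl_group n ?R \<subseteq> weyl_group n (simple_A n)"
      using RC by (intro weyl_group_subset reflection_in_simple_weyl_group(2)) auto
  qed
  then have perm: "weyl_group n ?R \<subseteq> signed_perms n {1}"
    using weyl_group_simple_A_signed_perms unfolding simple_roots_A by (rule subset_trans)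
  then show "finite (weyl_group n ?R)"
    by (rule finite_subset) (simp add: finite_signed_perms)
  show "reflection n \<alpha> ` (?R - {\<alpha>}) = ?R - {\<alpha>}" if "\<alpha> \<in> simple_roots ?R" for \<alpha>
    using that unfolding simple_roots_A
    by (elim simple_A_E) (simp add: reflection_eq_swap_coord pos_roots_A_eq swap_coord_roots_A)
  show "dot n \<alpha> \<alpha> \<noteq> 0" if "\<alpha> \<in> ?R" for \<alpha>
    using RC that by (intro norm_root) blast
  show "\<exists>h. \<forall>\<alpha>\<in>?R. 0 < dot n h \<alpha>"
  proof (intro exI ballI)
    fix \<alpha> assume "\<alpha> \<in> ?R"
    then have "2 \<le> height 1 (Suc n) \<alpha>"
      using RC by (intro height_root_ge_2) (auto simp: pos_roots_C_eq)
    then show "0 < dot n (\<lambda>i. 2 * real (Suc n) - 2 * real i - 1) \<alpha>"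
      unfolding dot_height by simp
  qed
  show "\<alpha> i = 0" if "\<alpha> \<in> ?R" "i \<notin> {1..n}" for \<alpha> i
    using that roots_A_outside[of \<alpha> 1 "Suc n" i] by (auto simp: pos_roots_A_eq)
  show "w = id" if "w \<in> weyl_group n ?R" "w (rho ?R) = rho ?R" for w
  proof (rule signed_perms_stabilizer)
    show "w \<in> signed_perms n {1}" using perm that(1) by blast
    \<comment> \<open>The coordinates of \<rho> strictly decrease, so no nontrivial permutation
      fixes it.\<close>
    have less: "rho ?R j < rho ?R i" if "1 \<le> i" "i < j" "j \<le> n" for i j
    proof -
      have "Suc i \<le> j" using that by simp
      then show ?thesis
        using that(3)
      proof (induction j rule: dec_induct)
        case base
        then show ?case using rho_A[of i n] that by simp
      next
        case (step j)
        then show ?case using rho_A[of j n] that by simp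
      qed
    qed
    show "j = i \<and> c = 1" if "i \<in> {1..n}" "j \<in> {1..n}" "c \<in> {1}" "c * rho ?R j = rho ?R i" for i j c
      using that less[of i j] less[of j i] by (cases i j rule: linorder_cases) auto
  qed (rule that(2))
  show "dot n \<beta> (\<Sum>\<Phi>) \<le> 0"
    if "\<Phi> \<subseteq> ?R" "\<And>\<alpha>. \<alpha> \<in> simple_roots ?R \<Longrightarrow> dot n \<alpha> (\<Sum>\<Phi> - rho ?R) < 0" "\<beta> \<in> ?R" for \<Phi> \<beta>
  proof -
    obtain i k where ik: "1 \<le> i" "i < k" "k \<le> n" "\<beta> = eps i - eps k"
      using \<open>\<beta> \<in> ?R\<close> by (auto simp: pos_roots_A_def)
    have "(\<Sum>\<Phi>) i \<le> (\<Sum>\<Phi>) k"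
      using that(1,2) RC ik rho_A by (intro antidominant_sum_mono[of _ n "rho ?R"]) (auto simp: simple_roots_A pos_roots_C_eq)
    then show ?thesis
      using ik by (simp add: dot_diff_left dot_eps_left)
  qed
qed

lemma reflection_data_C:
  assumes n: "1 \<le> n"
  shows "reflection_data n (pos_roots_C n)"
proof
  let ?R = "pos_roots_C n"
  note simple = simple_roots_C[OF n]
  show "finite ?R" by (simp add: pos_roots_C_eq finite_roots_C)
  show gen: "weyl_group n ?R \<subseteq> weyl_group n (simple_roots ?R)"
    unfolding simple by (intro weyl_group_subset reflection_in_simple_weyl_group(1)[OF n])
  then have perm: "weyl_group n ?R \<subseteq> signed_perms n {1, -1}"
    using weyl_group_simple_C_signed_perms[OF n] unfolding simple by (rule subset_trans)
  then show "finite (weyl_group n ?R)"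
    by (rule finite_subset) (simp add: finite_signed_perms)
  show "reflection n \<alpha> ` (?R - {\<alpha>}) = ?R - {\<alpha>}" if "\<alpha> \<in> simple_roots ?R" for \<alpha>
    using that unfolding simple
  proof
    assume "\<alpha> = eps n + eps n"
    then show ?thesis
      using neg_coord_roots_C[OF n] by (simp only: reflection_eq_neg_coord[OF n] pos_roots_C_eq)
  next
    assume "\<alpha> \<in> simple_A n"
    then show ?thesis
      by (elim simple_A_E) (simp add: reflection_eq_swap_coord pos_roots_C_eq swap_coord_roots_C)
  qed
  show "dot n \<alpha> \<alpha> \<noteq> 0" if "\<alpha> \<in> ?R" for \<alpha>
    using that by (rule norm_root)
  show "\<exists>h. \<forall>\<alpha>\<in>?R. 0 < dot n h \<alpha>"
  proof (intro exI ballI)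
    fix \<alpha> assume "\<alpha> \<in> ?R"
    then have "2 \<le> height 1 (Suc n) \<alpha>"
      by (intro height_root_ge_2) (simp add: pos_roots_C_eq)
    then show "0 < dot n (\<lambda>i. 2 * real (Suc n) - 2 * real i - 1) \<alpha>"
      unfolding dot_height by simp
  qed
  show "\<alpha> i = 0" if "\<alpha> \<in> ?R" "i \<notin> {1..n}" for \<alpha> i
    using that roots_C_outside[of \<alpha> 1 "Suc n" i] by (auto simp: pos_roots_C_eq)
  show "w = id" if "w \<in> weyl_group n ?R" "w (rho ?R) = rho ?R" for w
  proof (rule signed_perms_stabilizer)
    show "w \<in> signed_perms n {1, -1}" using perm that(1) by blast
    show "j = i \<and> c = 1" if "i \<in> {1..n}" "j \<in> {1..n}" "c \<in> {1, -1}" "c * rho ?R j = rho ?R i" for i j c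
      using that by (auto simp: rho_C)
  qed (rule that(2))
  show "dot n \<beta> (\<Sum>\<Phi>) \<le> 0"
    if \<Phi>: "\<Phi> \<subseteq> ?R" and neg: "\<And>\<alpha>. \<alpha> \<in> simple_roots ?R \<Longrightarrow> dot n \<alpha> (\<Sum>\<Phi> - rho ?R) < 0" and "\<beta> \<in> ?R" for \<Phi> \<beta>
  proof -
    have mono: "(\<Sum>\<Phi>) i \<le> (\<Sum>\<Phi>) k" if "1 \<le> i" "i \<le> k" "k \<le> n" for i k
    proof (rule antidominant_sum_mono[OF _ _ _ that])
      show "\<Phi> \<subseteq> roots_C 1 (Suc n)" using \<Phi> by (simp only: pos_roots_C_eq)
      show "dot n \<alpha> (\<Sum>\<Phi> - rho ?R) < 0" if "\<alpha> \<in> simple_A n" for \<alpha>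
        using that by (intro neg) (simp add: simple)
    qed (simp add: rho_C)
    \<comment> \<open>The long simple root bounds the last coordinate by 0; with monotonicity all
      coordinates are then nonpositive.\<close>
    have "dot n (eps n + eps n) (\<Sum>\<Phi> - rho ?R) < 0"
      by (intro neg) (simp add: simple)
    then have "(\<Sum>\<Phi>) n < 1"
      using n unfolding dot_add_left by (simp add: dot_eps_left rho_C)
    then have last: "(\<Sum>\<Phi>) n \<le> 0"
      using Ints_less_1_iff[OF sum_roots_coord_Ints] \<Phi> by (simp add: pos_roots_C_eq)
    have "\<beta> \<in> roots_C 1 (Suc n)" using \<open>\<beta> \<in> ?R\<close> by (simp add: pos_roots_C_eq)
    then show ?thesis
    proof (cases rule: roots_C_cases)
      case (1 i j)
      then show ?thesis using mono[of i j] by (simp add: dot_diff_left dot_eps_left)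
    next
      case (2 i j)
      then have "dot n \<beta> (\<Sum>\<Phi>) = (\<Sum>\<Phi>) i + (\<Sum>\<Phi>) j"
        unfolding 2(4) dot_add_left by (simp add: dot_eps_left)
      then show ?thesis using mono[of i n] mono[of j n] last 2 by simp
    qed
  qed
qed

lemma straightening_gen_exponent:
  assumes "reflection_data n R" "simple_A n \<subseteq> simple_roots R"
    and \<rho>: "\<And>j. 1 \<le> j \<Longrightarrow> j < n \<Longrightarrow> rho R (Suc j) = rho R j - 1"
  shows "straightening n (gen_exponent n R)"
proof
  fix j and \<nu> \<nu>' :: vec
  assume j: "1 \<le> j" "j < n" and \<nu>': "\<nu>' j = \<nu> (Suc j) - 1" "\<nu>' (Suc j) = \<nu> j + 1"
    "\<And>i. i \<noteq> j \<Longrightarrow> i \<noteq> Suc j \<Longrightarrow> \<nu>' i = \<nu> i"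
  interpret reflection_data n R by fact
  have "swap_coord j (\<nu> + rho R) = \<nu>' + rho R"
    using \<nu>' \<rho>[OF j] by (auto simp: swap_coord_def fun_eq_iff)
  then have "reflection n (eps j - eps (Suc j)) (\<nu> + rho R) = \<nu>' + rho R"
    by (simp only: reflection_eq_swap_coord[OF j])
  moreover have "eps j - eps (Suc j) \<in> simple_roots R"
    using assms(2) simple_A_I[OF j] by blast
  ultimately show "gen_exponent n R \<nu>' = - gen_exponent n R \<nu>"
    by (rule gen_exponent_skew[rotated])
qed

text \<open>The pairing of the generating character is evaluated twice: by invariance it is the
  constant term, and by straightening from the zero weight it is the double sum.\<close>

lemma LA_expansion:
  "LA 1 (Suc n) u v = (\<Sum>a\<le>n. \<Sum>b\<le>n. of_int (u ^ a * v ^ b * geom_sum (u * v) (n + 1 - a - b)) *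
     gen_exponent n (pos_roots_A n) (tail_weight n 0 a b))"
proof -
  interpret reflection_data n "pos_roots_A n" by (rule reflection_data_A)
  interpret straightening n "gen_exponent n (pos_roots_A n)"
    by (intro straightening_gen_exponent reflection_data_A rho_A) (simp_all add: simple_roots_A)
  let ?F = "\<Prod>i = 1..<Suc n. phi u v i"
  have "act (reflection n \<alpha>) ?F = ?F" if "\<alpha> \<in> simple_roots (pos_roots_A n)" for \<alpha>
    using that unfolding simple_roots_A
  proof (elim simple_A_E)
    fix j assume j: "1 \<le> j" "j < n" "\<alpha> = eps j - eps (Suc j)"
    then show "act (reflection n \<alpha>) ?F = ?F"
      by (simp only: reflection_eq_swap_coord act_swap_prod_phi Suc_less_eq)
  qed
  then have "pairing ?F = LA 1 (Suc n) u v"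
    unfolding LA_def hall_def pos_roots_A_eq[symmetric] by (rule pairing_symmetric)
  moreover have "pairing (e_pow (- 0) * (\<Prod>i = Suc 0..<Suc n. phi u v i)) =
      (\<Sum>a\<le>n. \<Sum>b\<le>n. of_int (u ^ a * v ^ b * geom_sum (u * v) (n + 1 - a - b)) *
        gen_exponent n (pos_roots_A n) (0 + tail_weight n 0 a b))"
    by (rule pairing_straighten[OF pairing_add pairing_of_int_mult pairing_e_pow]) simp_all
  ultimately show ?thesis by simp
qed

lemma LC_expansion:
  assumes n: "1 \<le> n"
  shows "LC 1 (Suc n) u = (\<Sum>a\<le>n. \<Sum>b\<le>n. of_int (u ^ a * u ^ b * geom_sum (u * u) (n + 1 - a - b)) *
     gen_exponent n (pos_roots_C n) (tail_weight n 0 a b))"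
proof -
  interpret reflection_data n "pos_roots_C n" by (rule reflection_data_C[OF n])
  interpret straightening n "gen_exponent n (pos_roots_C n)"
    by (intro straightening_gen_exponent reflection_data_C n) (auto simp: simple_roots_C[OF n] rho_C)
  let ?F = "\<Prod>i = 1..<Suc n. phi u u i"
  have "act (reflection n \<alpha>) ?F = ?F" if "\<alpha> \<in> simple_roots (pos_roots_C n)" for \<alpha>
    using that unfolding simple_roots_C[OF n]
  proof
    assume "\<alpha> = eps n + eps n"
    then show ?thesis by (simp only: reflection_eq_neg_coord[OF n] act_neg_prod_phi)
  next
    assume "\<alpha> \<in> simple_A n"
    then show ?thesis
    proof (elim simple_A_E)
      fix j assume j: "1 \<le> j" "j < n" "\<alpha> = eps j - eps (Suc j)"
      then show "act (reflection n \<alpha>) ?F = ?F"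
        by (simp only: reflection_eq_swap_coord act_swap_prod_phi Suc_less_eq)
    qed
  qed
  then have "pairing ?F = LC 1 (Suc n) u"
    unfolding LC_def hall_def pos_roots_C_eq[symmetric] by (rule pairing_symmetric)
  moreover have "pairing (e_pow (- 0) * (\<Prod>i = Suc 0..<Suc n. phi u u i)) =
      (\<Sum>a\<le>n. \<Sum>b\<le>n. of_int (u ^ a * u ^ b * geom_sum (u * u) (n + 1 - a - b)) *
        gen_exponent n (pos_roots_C n) (0 + tail_weight n 0 a b))"
    by (rule pairing_straighten[OF pairing_add pairing_of_int_mult pairing_e_pow]) simp_all
  ultimately show ?thesis by simp
qed

section \<open>Comparison of coefficients\<close>

lemma dot_one_weyl_group_A:
  assumes "w \<in> weyl_group n (pos_roots_A n)"
  shows "dot n (w x) (\<lambda>_. 1) = dot n x (\<lambda>_. 1)"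
  using assms
proof induction
  case (refl \<alpha> w)
  have "dot n \<alpha> (\<lambda>_. 1) = 0"
  proof -
    obtain i j where "1 \<le> i" "i < j" "j \<le> n" "\<alpha> = eps i - eps j"
      using refl(1) by (auto simp: pos_roots_A_def)
    then show ?thesis by (simp add: dot_diff_left dot_eps_left)
  qed
  then show ?case
    using refl(3) by (simp add: dot_reflection_left)
qed simp

text \<open>Roots have coordinate sum 0 and the Weyl group preserves coordinate sums, so every
  partition function involved is taken outside the span of the roots.\<close>

lemma gen_exponent_A_eq_0:
  assumes "dot n \<mu> (\<lambda>_. 1) \<noteq> 0"
  shows "gen_exponent n (pos_roots_A n) \<mu> = 0"
proof -
  let ?R = "pos_roots_A n"
  define c where "c = dot n \<mu> (\<lambda>_. 1)"
  \<comment> \<open>The sign gives e^(-\<beta>) the positive level |c|, whichever sign c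
    has.\<close>
  define l where "l = (\<lambda>\<beta>. - sgn c * dot n \<beta> (\<lambda>_. 1))"
  have l: "Modules.additive l"
    by unfold_locales (simp add: l_def dot_add_left algebra_simps)
  have "l \<alpha> = 0" if "\<alpha> \<in> ?R" for \<alpha>
  proof -
    obtain i j where "1 \<le> i" "i < j" "j \<le> n" "\<alpha> = eps i - eps j"
      using \<open>\<alpha> \<in> ?R\<close> by (auto simp: pos_roots_A_def)
    then show ?thesis by (simp add: l_def dot_diff_left dot_eps_left)
  qed
  then have G: "(\<Prod>\<alpha>\<in>?R. geom_series \<alpha>) \<in> supp_ge l 0"
    by (intro supp_ge_prod supp_ge_geom_series l) simp
  have "kostant_partition ?R (w (\<mu> + rho ?R) - rho ?R) = 0" if "w \<in> weyl_group n ?R" for w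
  proof -
    let ?\<beta> = "w (\<mu> + rho ?R) - rho ?R"
    have "l (- ?\<beta>) = \<bar>c\<bar>"
      using dot_one_weyl_group_A[OF that, of "\<mu> + rho ?R"]
      by (simp only: l_def dot_minus_left dot_diff_left dot_add_left c_def) (simp add: abs_sgn mult.commute)
    then have "ee (- ?\<beta>) * (\<Prod>\<alpha>\<in>?R. geom_series \<alpha>) \<in> supp_ge l \<bar>c\<bar>"
      by (intro supp_ge_mult_0 l G supp_ge_ee) (simp only: order_refl)
    then show ?thesis
      unfolding kostant_partition_eq_ct by (rule ct_supp_ge[OF l]) (use assms in \<open>simp add: c_def\<close>)
  qed
  then show ?thesis
    unfolding gen_exponent_def by simp
qed

lemma sum_eps_apply: "finite I \<Longrightarrow> (\<Sum>i\<in>I. eps i) k = (if k \<in> I then 1 else 0)"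
  by (induction I rule: finite_induct) (auto simp: eps_def)

lemma tail_weight_gamma: "2 * a \<le> n \<Longrightarrow> tail_weight n 0 a a = gamma n a"
  by (auto simp: tail_weight_def gamma_def sum_eps_apply fun_eq_iff)

lemma tail_weight_omega: "a \<le> n \<Longrightarrow> tail_weight n 0 a 0 = omega a"
  by (auto simp: tail_weight_def omega_def sum_eps_apply fun_eq_iff)

lemma dot_one_tail_weight:
  assumes "a + b \<le> n"
  shows "dot n (tail_weight n 0 a b) (\<lambda>_. 1) = real a - real b"
proof -
  have "tail_weight n 0 a b = (\<Sum>i\<in>{1..a}. eps i) - (\<Sum>i\<in>{n - b + 1..n}. eps i)"
    using assms by (auto simp: tail_weight_def sum_eps_apply fun_eq_iff)
  moreover have "dot n (\<Sum>i\<in>I. eps i) (\<lambda>_. 1) = real (card I)" if "I \<subseteq> {1..n}" for I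
  proof -
    have "dot n (eps i) (\<lambda>_. 1) = 1" if "i \<in> I" for i
      using that \<open>I \<subseteq> {1..n}\<close> by (intro dot_eps_left) auto
    then show ?thesis by (simp add: dot_sum_left)
  qed
  ultimately show ?thesis
    using assms by (simp add: dot_diff_left)
qed

text \<open>Coordinate sum 0 forces b = a. For 2 a > n the coefficient is 0, so
  \<open>gamma n a\<close> matters only in its proper range.\<close>

lemma LA_eq_sum_gamma:
  "LA 1 (Suc n) z 1 = (\<Sum>a\<le>n. of_int (z ^ a * geom_sum z (n + 1 - 2 * a)) * gen_exponent n (pos_roots_A n) (gamma n a))"
  unfolding LA_expansion
proof (rule sum.cong)
  fix a assume a: "a \<in> {..n}"
  let ?K = "gen_exponent n (pos_roots_A n)"
  have "of_int (z ^ a * 1 ^ b * geom_sum (z * 1) (n + 1 - a - b)) * ?K (tail_weight n 0 a b) =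
      (if b = a then of_int (z ^ a * geom_sum z (n + 1 - 2 * a)) * ?K (gamma n a) else 0)" for b
  proof (cases "a + b \<le> n")
    case True
    then show ?thesis
      using gen_exponent_A_eq_0[of n "tail_weight n 0 a b"] dot_one_tail_weight[of a b n] tail_weight_gamma[of a n]
      by (cases "b = a") (simp_all add: mult_2)
  qed (simp add: mult_2)
  then have "(\<Sum>b\<le>n. of_int (z ^ a * 1 ^ b * geom_sum (z * 1) (n + 1 - a - b)) * ?K (tail_weight n 0 a b)) =
      (\<Sum>b\<le>n. if b = a then of_int (z ^ a * geom_sum z (n + 1 - 2 * a)) * ?K (gamma n a) else 0)"
    by (simp only:)
  then show "(\<Sum>b\<le>n. of_int (z ^ a * 1 ^ b * geom_sum (z * 1) (n + 1 - a - b)) * ?K (tail_weight n 0 a b)) =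
      of_int (z ^ a * geom_sum z (n + 1 - 2 * a)) * ?K (gamma n a)"
    using a by (simp only: sum.delta finite_atMost if_True)
qed simp

lemma LC_eq_sum_omega:
  assumes n: "1 \<le> n"
  shows "LC 1 (Suc n) u = (\<Sum>a\<le>n. of_int (u ^ a * geom_sum (u * u) (n + 1 - a)) * gen_exponent n (pos_roots_C n) (omega a))"
  unfolding LC_expansion[OF n]
proof (rule sum.cong)
  interpret reflection_data n "pos_roots_C n" by (rule reflection_data_C[OF n])
  fix a assume a: "a \<in> {..n}"
  let ?K = "gen_exponent n (pos_roots_C n)"
  have K0: "?K (tail_weight n 0 a b) = 0" if "0 < b" "a + b \<le> n" for b
  proof -
    let ?\<mu> = "tail_weight n 0 a b"
    \<comment> \<open>As \<rho> has last coordinate 1, the shifted weight has last coordinate 0 and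
      is fixed by the sign change.\<close>
    have "?\<mu> n = -1" using that n by (simp add: tail_weight_def)
    then have "neg_coord n (?\<mu> + rho (pos_roots_C n)) = ?\<mu> + rho (pos_roots_C n)"
      using n by (simp add: neg_coord_def rho_C fun_eq_iff)
    then have "?K ?\<mu> = - ?K ?\<mu>"
      using n by (intro gen_exponent_skew[of "eps n + eps n"])
        (simp_all only: reflection_eq_neg_coord[OF n] simple_roots_C[OF n] insertI1)
    then show ?thesis by (simp only: fps_int_eq_neg_self_iff)
  qed
  have "of_int (u ^ a * u ^ b * geom_sum (u * u) (n + 1 - a - b)) * ?K (tail_weight n 0 a b) =
      (if b = 0 then of_int (u ^ a * geom_sum (u * u) (n + 1 - a)) * ?K (omega a) else 0)" for b
    using a tail_weight_omega[of a n] K0[of b] by (cases "a + b \<le> n"; cases "b = 0") simp_all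
  then have "(\<Sum>b\<le>n. of_int (u ^ a * u ^ b * geom_sum (u * u) (n + 1 - a - b)) * ?K (tail_weight n 0 a b)) =
      (\<Sum>b\<le>n. if b = 0 then of_int (u ^ a * geom_sum (u * u) (n + 1 - a)) * ?K (omega a) else 0)"
    by (simp only:)
  then show "(\<Sum>b\<le>n. of_int (u ^ a * u ^ b * geom_sum (u * u) (n + 1 - a - b)) * ?K (tail_weight n 0 a b)) =
      of_int (u ^ a * geom_sum (u * u) (n + 1 - a)) * ?K (omega a)"
    by (simp only: sum.delta finite_atMost) simp
qed simp

text \<open>Passage from integers u to a variable, with power series in t as coefficients.\<close>

lemma poly_eq_of_int_points:
  fixes p q :: "'a :: idom poly"
  assumes inj: "inj (of_int :: int \<Rightarrow> 'a)" and "\<And>u. poly p (of_int u) = poly q (of_int u)"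
  shows "p = q"
proof (rule ccontr)
  assume "p \<noteq> q"
  then have "finite {x. poly (p - q) x = 0}"
    by (intro poly_roots_finite) simp
  moreover have "range of_int \<subseteq> {x. poly (p - q) x = 0}"
    using assms by auto
  ultimately have "finite (range (of_int :: int \<Rightarrow> 'a))"
    by (rule finite_subset[rotated])
  then have "finite (UNIV :: int set)"
    using inj by (rule finite_imageD)
  then show False
    by (simp add: infinite_UNIV_int)
qed

lemma coeff_spread:
  fixes c :: "'a :: comm_ring_1"
  shows "coeff (\<Sum>i<r. monom c (s + 2 * i)) (2 * p) =
    (if even s \<and> s \<le> 2 * p \<and> p < r + s div 2 then c else 0)"
proof -
  have "coeff (\<Sum>i<r. monom c (s + 2 * i)) (2 * p) = (\<Sum>i<r. if s + 2 * i = 2 * p then c else 0)"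
    by (simp add: coeff_sum)
  also have "\<dots> = (\<Sum>i<r. if i = p - s div 2 \<and> even s \<and> s \<le> 2 * p then c else 0)"
  proof -
    have "s + 2 * i = 2 * p \<longleftrightarrow> i = p - s div 2 \<and> even s \<and> s \<le> 2 * p" for i
      by presburger
    then show ?thesis by (simp only:)
  qed
  also have "\<dots> = (if even s \<and> s \<le> 2 * p \<and> p < r + s div 2 then c else 0)"
  proof (cases "even s \<and> s \<le> 2 * p")
    case True
    then have "p - s div 2 < r \<longleftrightarrow> p < r + s div 2" by presburger
    then show ?thesis using True by simp
  qed auto
  finally show ?thesis .
qed

lemma poly_spread:
  "poly (\<Sum>i<r. monom c (s + 2 * i)) (of_int u) = of_int (u ^ s * geom_sum (u * u) r) * (c :: 'a :: comm_ring_1)"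
  by (simp add: poly_sum poly_monom geom_sum_def sum_distrib_left power_add power_mult power_mult_distrib power2_eq_square mult_ac)

lemma partial_sums_eq:
  assumes n: "1 \<le> n" and p: "2 * p \<le> n"
  shows "(\<Sum>b\<le>p. gen_exponent n (pos_roots_C n) (omega (2 * b))) =
    (\<Sum>b\<le>p. gen_exponent n (pos_roots_A n) (gamma n b) oo fps_X ^ 2)"
proof -
  define KC where "KC a = gen_exponent n (pos_roots_C n) (omega a)" for a
  define KA where "KA a = gen_exponent n (pos_roots_A n) (gamma n a) oo fps_X ^ 2" for a
  \<comment> \<open>The two expansions as polynomials in u, with u^2 as the parameter of type
    A.\<close>
  define PC where "PC = (\<Sum>a\<le>n. \<Sum>i<n + 1 - a. monom (KC a) (a + 2 * i))"
  define PA where "PA = (\<Sum>a\<le>n. \<Sum>i<n + 1 - 2 * a. monom (KA a) (2 * a + 2 * i))"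
  have "poly PC (of_int u) = poly PA (of_int u)" for u
  proof -
    have "poly PC (of_int u) = LC 1 (Suc n) u"
      by (simp only: PC_def poly_sum[of _ "{..n}"] poly_spread LC_eq_sum_omega[OF n] KC_def)
    also have "\<dots> = LC 1 (1 + n) u" by simp
    also have "\<dots> = LA 1 (1 + n) (u * u) 1 oo fps_X ^ 2"
      by (rule LC_eq_LA_compose)
    also have "\<dots> = (\<Sum>a\<le>n. (of_int ((u * u) ^ a * geom_sum (u * u) (n + 1 - 2 * a)) *
        gen_exponent n (pos_roots_A n) (gamma n a)) oo fps_X ^ 2)"
      using LA_eq_sum_gamma[of n "u * u"] by (simp add: fps_compose_sum_distrib)
    also have "\<dots> = (\<Sum>a\<le>n. of_int ((u * u) ^ a * geom_sum (u * u) (n + 1 - 2 * a)) * KA a)"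
    proof (rule sum.cong)
      have "(of_int c * F) oo fps_X ^ 2 = of_int c * (F oo fps_X ^ 2 :: int fps)" for c F
        by (subst fps_compose_mult_distrib) (simp_all flip: fps_of_int)
      then show "(of_int ((u * u) ^ a * geom_sum (u * u) (n + 1 - 2 * a)) * gen_exponent n (pos_roots_A n) (gamma n a)) oo fps_X ^ 2
          = of_int ((u * u) ^ a * geom_sum (u * u) (n + 1 - 2 * a)) * KA a" for a
        unfolding KA_def by blast
    qed simp
    also have "\<dots> = poly PA (of_int u)"
      by (simp add: PA_def poly_sum[of _ "{..n}"] poly_spread power_mult power2_eq_square)
    finally show ?thesis .
  qed
  moreover have "inj (of_int :: int \<Rightarrow> int fps)"
  proof (rule injI)
    fix x y :: int
    assume "of_int x = (of_int y :: int fps)"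
    then have "fps_nth (of_int x :: int fps) 0 = fps_nth (of_int y) 0" by simp
    then show "x = y" by (simp flip: fps_of_int)
  qed
  ultimately have "PC = PA"
    by (intro poly_eq_of_int_points)
  then have "coeff PC (2 * p) = coeff PA (2 * p)"
    by simp
  moreover have "coeff PC (2 * p) = (\<Sum>b\<le>p. KC (2 * b))"
  proof -
    \<comment> \<open>Because 2 p \<le> n, the upper limit of each inner sum is never reached, and
      every even a \<le> 2 p contributes exactly once.\<close>
    have "coeff PC (2 * p) = (\<Sum>a\<le>n. if even a \<and> a \<le> 2 * p then KC a else 0)"
      unfolding PC_def coeff_sum[of _ "{..n}"] coeff_spread
      using p by (intro sum.cong refl if_cong) auto
    also have "\<dots> = (\<Sum>a\<in>{a \<in> {..n}. even a \<and> a \<le> 2 * p}. KC a)"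
      by (rule sum.inter_filter[symmetric]) simp
    also have "\<dots> = (\<Sum>b\<le>p. KC (2 * b))"
      using p by (intro sum.reindex_bij_witness[of _ "\<lambda>b. 2 * b" "\<lambda>a. a div 2"]) auto
    finally show ?thesis .
  qed
  moreover have "coeff PA (2 * p) = (\<Sum>b\<le>p. KA b)"
  proof -
    have "coeff PA (2 * p) = (\<Sum>a\<le>n. if a \<le> p then KA a else 0)"
      unfolding PA_def coeff_sum[of _ "{..n}"] coeff_spread
      using p by (intro sum.cong refl if_cong) auto
    also have "\<dots> = (\<Sum>a\<in>{a \<in> {..n}. a \<le> p}. KA a)"
      by (rule sum.inter_filter[symmetric]) simp
    also have "{a \<in> {..n}. a \<le> p} = {..p}"
      using p by auto
    finally show ?thesis .
  qed
  ultimately show ?thesis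
    by (simp add: KC_def KA_def)
qed

theorem theorem7p2:
  fixes n p :: nat
  assumes "n \<ge> 2" and "p \<in> {1..n div 2}"
  shows "gen_exponent n (pos_roots_C n) (omega (2 * p)) =
         fps_compose (gen_exponent n (pos_roots_A n) (gamma n p)) (fps_X ^ 2)"
proof -
  \<comment> \<open>As p is positive, the claim is the difference of the partial sums up to p and up
    to p - 1.\<close>
  obtain q where q: "p = Suc q"
    using assms(2) by (cases p) auto
  have "1 \<le> n" "2 * Suc q \<le> n" "2 * q \<le> n"
    using assms q by auto
  then show ?thesis
    using partial_sums_eq[of n "Suc q"] partial_sums_eq[of n q] by (simp add: q)
qed

end
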